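(* For any $k\ge 1$ and any permutation $\tau\in S_k$, $(213|\tau)\preceq_s (123|\tau)\preceq_s (312|\tau)$; that is, for every (proper) Young diagram $Y$, \[|S_Y(213|\tau)|\le |S_Y(123|\tau)|\le |S_Y(312|\tau)|.\] Moreover, \[|S_n(213|\tau)|< |S_n(123|\tau)| < |S_n(312|\tau)|\quad\text{for all } n\geq 2k+5.\]
   Context: Permutations are written in one-line notation. For $\sigma\in S_m$ and $\tau\in S_k$, $(\sigma|\tau)\in S_{m+k}$ is the permutation $(\sigma(1)+k,\ldots,\sigma(m)+k,\tau(1),\ldots,\tau(k))$. For example $(213|1)=(3241)$. $S_n(\rho)$ is the set of permutations in $S_n$ that avoid the pattern $\rho$ in the classical sense. $Y(a_1,\ldots,a_n)$, with $a_1\ge a_2\ge\cdots\ge a_n\ge 1$, denotes the left-justified Young diagram whose $i$-th row from the top has $a_i$ cells. Cells are coordinatized from the bottom left corner: $(x,y)$ is the cell in column $x$ (from the left) and row $y$ (from the bottom). A Young diagram of size $n$ is proper if it has exactly $n$ rows and $n$ columns and contains the staircase $Y(n,n-1,\ldots,2,1)$; all Young diagrams are assumed proper. A transversal $T$ of $Y$ is a set of $n$ cells of $Y$ with exactly one in every row and every column; equivalently a permutation $\pi$ of $\{1,\ldots,n\}$ such that every cell $(x,\pi(x))$ lies in $Y$. $T$ contains the pattern $\rho\in S_l$ in $Y$ if there are columns $x_1<\cdots<x_l$ such that $(\pi(x_1),\ldots,\pi(x_l))$ is order-isomorphic to $\rho$ and the cell $(x_l,\min_j\pi(x_j))$ belongs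 to $Y$. $S_Y(\rho)$ is the set of transversals of $Y$ that do not contain $\rho$ in $Y$. For permutations $\rho,\rho'$, $\rho\preceq_s\rho'$ means $|S_Y(\rho)|\le|S_Y(\rho')|$ for all Young diagrams $Y$. *)

theory Defs
  imports Main "HOL-Library.Sublist" "HOL-Combinatorics.Multiset_Permutations"
begin

text \<open>
  Permutations of $\{1, \ldots, n\}$ are lists in one-line notation, i.e. the elements of
  \<^term>\<open>permutations_of_set {1..n::nat}\<close>. Columns and rows are numbered from 1, so
  column \<open>x\<close> of the permutation \<open>p\<close> carries the value \<^term>\<open>p ! (x - 1)\<close>.
\<close>

text \<open>The permutation \<open>(\<sigma>|\<tau>)\<close>.\<close>

definition skew_sum :: "nat list \<Rightarrow> nat list \<Rightarrow> nat list" where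
  "skew_sum \<sigma> \<tau> = map (\<lambda>v. v + length \<tau>) \<sigma> @ \<tau>"

lemma "skew_sum [2, 1, 3] [1] = [3, 2, 4, 1]"
  by (simp add: skew_sum_def)

definition order_iso :: "nat list \<Rightarrow> nat list \<Rightarrow> bool" where
  "order_iso ys zs \<longleftrightarrow> length ys = length zs \<and>
     (\<forall>i<length ys. \<forall>j<length ys. ys ! i < ys ! j \<longleftrightarrow> zs ! i < zs ! j)"

definition perm_contains :: "nat list \<Rightarrow> nat list \<Rightarrow> bool" where
  "perm_contains p \<rho> \<longleftrightarrow> (\<exists>ys. subseq ys p \<and> order_iso ys \<rho>)"

definition perms_avoiding :: "nat \<Rightarrow> nat list \<Rightarrow> nat list set" where
  "perms_avoiding n \<rho> = {p \<in> permutations_of_set {1..n}. \<not> perm_contains p \<rho>}"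

text \<open>
  A Young diagram is the list of its row lengths, from the top row to the bottom row. Its cells
  are pairs (column, row), with columns counted from the left and rows from the \<^emph>\<open>bottom\<close>.
\<close>

definition young_diagram :: "nat list \<Rightarrow> bool" where
  "young_diagram Y \<longleftrightarrow> sorted_wrt (\<ge>) Y \<and> (\<forall>a\<in>set Y. a \<ge> 1)"

definition cells :: "nat list \<Rightarrow> (nat \<times> nat) set" where
  "cells Y = {(x, y). y \<in> {1..length Y} \<and> x \<in> {1..Y ! (length Y - y)}}"

definition staircase :: "nat \<Rightarrow> nat list" where
  "staircase n = rev [1..<Suc n]"

definition proper_diagram :: "nat list \<Rightarrow> bool" where
  "proper_diagram Y \<longleftrightarrow> young_diagram Y \<and> fst ` cells Y = {1..length Y} \<and>
     cells (staircase (length Y)) \<subseteq> cells Y"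

definition transversals :: "nat list \<Rightarrow> nat list set" where
  "transversals Y = {p \<in> permutations_of_set {1..length Y}.
     \<forall>x\<in>{1..length Y}. (x, p ! (x - 1)) \<in> cells Y}"

text \<open>
  Patterns are meant to be nonempty: \<^term>\<open>last xs\<close> and the minimum are unspecified for
  \<^term>\<open>xs = []\<close>.
\<close>

definition contains_in :: "nat list \<Rightarrow> nat list \<Rightarrow> nat list \<Rightarrow> bool" where
  "contains_in Y p \<rho> \<longleftrightarrow>
     (\<exists>xs. sorted_wrt (<) xs \<and> set xs \<subseteq> {1..length p} \<and>
        order_iso (map (\<lambda>x. p ! (x - 1)) xs) \<rho> \<and>
        (last xs, Min ((\<lambda>x. p ! (x - 1)) ` set xs)) \<in> cells Y)"

definition transversals_avoiding :: "nat list \<Rightarrow> nat list \<Rightarrow> nat list set" where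
  "transversals_avoiding Y \<rho> = {p \<in> transversals Y. \<not> contains_in Y p \<rho>}"

definition shape_le :: "nat list \<Rightarrow> nat list \<Rightarrow> bool"  (infix \<open>\<preceq>\<^sub>s\<close> 50) where
  "\<rho> \<preceq>\<^sub>s \<rho>' \<longleftrightarrow> (\<forall>Y. proper_diagram Y \<longrightarrow>
     card (transversals_avoiding Y \<rho>) \<le> card (transversals_avoiding Y \<rho>'))"

end

theory Submission
  imports Defs
begin

text \<open>
  Colour a cell white if it has a copy of \<open>\<tau>\<close> strictly to its south-east. The points of a
  transversal outside the white region already determine that region, and the transversal avoids
  \<open>(\<sigma>|\<tau>)\<close> iff its white points avoid \<open>\<sigma>\<close> in the smaller Young diagram left over by the other
  points (Backelin, West and Xin). So everything reduces to the patterns \<open>213\<close>, \<open>123\<close>, \<open>312\<close>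
  themselves and, for strictness, to one shape that separates them and can be left over.

  For \<open>213\<close> against \<open>123\<close>, build the transversals column by column. The admissible values for
  the next column always form an interval, and the interval lengths of the \<open>123\<close> process dominate
  those of the \<open>213\<close> process. For \<open>123\<close> against \<open>312\<close> the pattern \<open>321\<close> is interposed. The \<open>123\<close>
  process is a sum over two-column standard tableaux, written as ballot words, of walks in
  Young's lattice along the boundary of the diagram (a shadow of RSK); these walks and the
  \<open>321\<close> process satisfy the same recursion when a corner of the boundary is removed. Finally,
  turning occurrences of \<open>312\<close> into \<open>321\<close> keeps the left-to-right maxima, and these determine a
  transversal that avoids \<open>321\<close>.
\<close>

section \<open>Building transversals column by column\<close>

text \<open>Strictness cannot come from a square: there all patterns of length three are avoided by
  equally many permutations. So a second copy of \<open>\<tau>\<close> is spent on spoiling a square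
  of side five by one missing corner cell, which explains the size \<open>2 * k + 5\<close>. Columns
  are added from the left because the newest column has the fewest cells: a value at or below its
  bound is dead for all later occurrences, and a dead value never revives. The obstacle in comparing
  123 with 312 is that the state of the 123 process is a whole function of the bound, whereas a
  single number describes 321. RSK encodes the function in one tableau: its values are the lengths
  of the initial runs that remain after deletion of least entries. Summing over all tableaux of one
  shape then leaves two column lengths. Only an inequality is wanted here, so injectivity of
  insertion and deletion is all that is proved about them.\<close>

text \<open>A Young diagram is given by the list \<open>b\<close> that counts, for each column, the rows missing at the
  bottom: the cell in column \<open>i + 1\<close> and row \<open>y\<close> exists iff \<open>b ! i < y\<close>.\<close>

definition trans_lists :: "nat list \<Rightarrow> nat list set" where
  "trans_lists b = {p. length p = length b \<and> distinct p \<and> set p = {1..length b} \<and>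
     (\<forall>i<length b. b ! i < p ! i)}"

text \<open>All three values are compared with the bound of the last column of the occurrence: this
  expresses that the cell in that column and in the least of the three rows belongs to the
  diagram.\<close>

definition avoid_lists :: "(nat \<Rightarrow> nat \<Rightarrow> nat \<Rightarrow> bool) \<Rightarrow> nat list \<Rightarrow> nat list set" where
  "avoid_lists Q b = {p \<in> trans_lists b. \<forall>i j k. i < j \<longrightarrow> j < k \<longrightarrow> k < length b \<longrightarrow>
     b ! k < p ! i \<longrightarrow> b ! k < p ! j \<longrightarrow> b ! k < p ! k \<longrightarrow> \<not> Q (p ! i) (p ! j) (p ! k)}"

definition pat213 :: "nat \<Rightarrow> nat \<Rightarrow> nat \<Rightarrow> bool" where
  "pat213 x y z \<longleftrightarrow> y < x \<and> x < z"

definition pat123 :: "nat \<Rightarrow> nat \<Rightarrow> nat \<Rightarrow> bool" where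
  "pat123 x y z \<longleftrightarrow> x < y \<and> y < z"

definition pat321 :: "nat \<Rightarrow> nat \<Rightarrow> nat \<Rightarrow> bool" where
  "pat321 x y z \<longleftrightarrow> z < y \<and> y < x"

definition pat312 :: "nat \<Rightarrow> nat \<Rightarrow> nat \<Rightarrow> bool" where
  "pat312 x y z \<longleftrightarrow> y < z \<and> z < x"

text \<open>Patterns are transported along two relabellings: \<open>bump\<close>, and the
  enumeration of the rows left free by a core. The latter is known to increase only on an interval,
  hence the set \<open>A\<close>.\<close>

definition order_invariant :: "(nat \<Rightarrow> nat \<Rightarrow> nat \<Rightarrow> bool) \<Rightarrow> bool" where
  "order_invariant Q \<longleftrightarrow> (\<forall>f A. strict_mono_on A f \<longrightarrow>
     (\<forall>x\<in>A. \<forall>y\<in>A. \<forall>z\<in>A. Q (f x) (f y) (f z) \<longleftrightarrow> Q x y z))"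

lemma order_invariant_pats:
  "order_invariant pat213" "order_invariant pat123" "order_invariant pat321" "order_invariant pat312"
  unfolding order_invariant_def pat213_def pat123_def pat321_def pat312_def
  by (auto simp: strict_mono_on_less)

text \<open>Appending a last column with value \<open>v\<close> shifts the old values from \<open>v\<close> upwards. The condition
  \<open>b ! i < p ! i\<close> is insensitive to this as long as \<open>v\<close> exceeds the bounds of all earlier columns.\<close>

definition bump :: "nat \<Rightarrow> nat \<Rightarrow> nat" where
  "bump v u = (if u < v then u else Suc u)"

lemma bump_less_iff [simp]: "bump v x < bump v y \<longleftrightarrow> x < y"
  by (auto simp: bump_def)

lemma bump_eq_iff [simp]: "bump v x = bump v y \<longleftrightarrow> x = y"
  by (auto simp: bump_def)

lemma bump_neq [simp]: "bump v x \<noteq> v" "v \<noteq> bump v x"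
  by (auto simp: bump_def)

lemma bump_less [simp]: "bump v x < v \<longleftrightarrow> x < v"
  by (auto simp: bump_def)

lemma less_bump [simp]: "v < bump v x \<longleftrightarrow> v \<le> x"
  by (auto simp: bump_def)

lemma less_bump_low: "c < v \<Longrightarrow> c < bump v x \<longleftrightarrow> c < x"
  by (auto simp: bump_def)

lemma Q_bump:
  assumes "order_invariant Q" shows "Q (bump v x) (bump v y) (bump v z) \<longleftrightarrow> Q x y z"
proof -
  have "strict_mono_on UNIV (bump v)" by (auto simp: strict_mono_on_def)
  then show ?thesis using assms unfolding order_invariant_def by blast
qed

section \<open>Transversals as leaves of a generating tree\<close>

definition app :: "nat \<Rightarrow> nat list \<Rightarrow> nat list" where
  "app v p = map (bump v) p @ [v]"

lemma length_app [simp]: "length (app v p) = Suc (length p)"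
  by (simp add: app_def)

lemma app_nth: "i \<le> length p \<Longrightarrow> app v p ! i = (if i < length p then bump v (p ! i) else v)"
  by (auto simp: app_def nth_append)

lemma app_inj: "app v p = app w q \<longleftrightarrow> v = w \<and> p = q"
proof -
  have "map (bump v) p = map (bump v) q \<Longrightarrow> p = q"
    by (rule map_injective) (auto simp: inj_on_def)
  then show ?thesis by (auto simp: app_def)
qed

text \<open>Liveness is tested on the old values although the occurrences consist of bumped ones;
  for \<open>c < v\<close> the two tests agree by \<open>less_bump_low\<close>.\<close>

definition allowed :: "(nat \<Rightarrow> nat \<Rightarrow> nat \<Rightarrow> bool) \<Rightarrow> nat \<Rightarrow> nat list \<Rightarrow> nat set" where
  "allowed Q c p = {v. c < v \<and> v \<le> Suc (length p) \<and>
     (\<forall>i j. i < j \<longrightarrow> j < length p \<longrightarrow> c < p ! i \<longrightarrow> c < p ! j \<longrightarrow>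
        \<not> Q (bump v (p ! i)) (bump v (p ! j)) v)}"

lemma bump_image:
  assumes "1 \<le> v" "v \<le> Suc n"
  shows "insert v (bump v ` {1..n}) = {1..Suc n}"
proof -
  have "x \<in> bump v ` {1..n}" if "1 \<le> x" "x \<le> Suc n" "x \<noteq> v" for x
  proof (cases "x < v")
    case True
    then have "x = bump v x" "x \<in> {1..n}" using that assms by (auto simp: bump_def)
    then show ?thesis by blast
  next
    case False
    then have "x = bump v (x - 1)" "x - 1 \<in> {1..n}" using that assms by (auto simp: bump_def)
    then show ?thesis by blast
  qed
  then have "{1..Suc n} \<subseteq> insert v (bump v ` {1..n})" by fastforce
  moreover have "bump v x \<in> {1..Suc n}" if "x \<in> {1..n}" for x
    using that by (auto simp: bump_def)
  then have "insert v (bump v ` {1..n}) \<subseteq> {1..Suc n}"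
    using assms by (auto simp del: image_Suc_atLeastAtMost)
  ultimately show ?thesis by (rule equalityI[rotated])
qed

lemma app_surj:
  assumes "distinct q" "set q = {1..Suc n}" "length q = Suc n"
  obtains p v where "q = app v p" "distinct p" "set p = {1..n}" "length p = n" "1 \<le> v" "v \<le> Suc n"
proof -
  define v where "v = last q"
  define r where "r = butlast q"
  define p where "p = map (\<lambda>u. if u < v then u else u - 1) r"
  have q: "q = r @ [v]" using assms(3) unfolding v_def r_def
    by (metis append_butlast_last_id length_0_conv nat.simps(3))
  have v: "1 \<le> v" "v \<le> Suc n" using assms(2) unfolding q by auto
  have vr: "v \<notin> set r" using assms(1) q by simp
  have "map (bump v) p = map (\<lambda>u. u) r"
    unfolding p_def map_map
  proof (rule map_cong)
    fix u assume "u \<in> set r"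
    then have "u \<noteq> v" using vr by auto
    then show "(bump v \<circ> (\<lambda>u. if u < v then u else u - 1)) u = u"
      by (auto simp: bump_def)
  qed simp
  then have r: "map (bump v) p = r" by simp
  have qa: "q = app v p" unfolding app_def r q ..
  have d: "distinct p" using assms(1) unfolding q r[symmetric] by (simp add: distinct_map)
  have "set r = {1..Suc n} - {v}" using assms(1,2) unfolding q by auto
  also have "\<dots> = bump v ` {1..n}" using bump_image[OF v] by (auto simp del: image_Suc_atLeastAtMost)
  finally have "bump v ` set p = bump v ` {1..n}" using r by (metis set_map)
  then have "set p = {1..n}" by (subst (asm) inj_image_eq_iff) (auto simp: inj_on_def)
  with qa d v show ?thesis using that assms(3) by (simp add: app_def)
qed

text \<open>In a sorted list the last bound \<open>c\<close> dominates all earlier ones, so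
  \<open>v\<close> lies above every bound and shifting the values from \<open>v\<close> on never
  crosses one.\<close>

lemma app_in_trans_lists:
  assumes b: "sorted (b @ [c])" and v: "c < v" "v \<le> Suc (length b)"
  shows "app v p \<in> trans_lists (b @ [c]) \<longleftrightarrow> p \<in> trans_lists b"
proof (cases "length p = length b")
  case len: True
  have inj: "inj (bump v)" by (auto simp: inj_on_def)
  have d: "distinct (app v p) \<longleftrightarrow> distinct p"
    by (auto simp: app_def distinct_map intro: inj_on_subset[OF inj])
  have s: "set (app v p) = {1..Suc (length b)} \<longleftrightarrow> set p = {1..length b}" if "distinct p"
  proof -
    have im: "insert v (bump v ` {1..length b}) = {1..Suc (length b)}"
      by (rule bump_image) (use v in auto)
    have nv: "v \<notin> bump v ` A" for A by auto
    have "set (app v p) = insert v (bump v ` set p)" by (simp add: app_def)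
    then show ?thesis unfolding im[symmetric] using nv inj
      by (metis Diff_insert_absorb inj_image_eq_iff)
  qed
  have bc: "b ! i \<le> c" if "i < length b" for i
    using b that by (auto simp: sorted_append)
  have "(\<forall>i<length (b @ [c]). (b @ [c]) ! i < app v p ! i) \<longleftrightarrow> (\<forall>i<length b. b ! i < p ! i)"
  proof -
    have "(b @ [c]) ! i < app v p ! i \<longleftrightarrow> b ! i < p ! i" if "i < length b" for i
      using that bc[OF that] v len by (simp add: app_nth nth_append less_bump_low)
    moreover have "(b @ [c]) ! length b < app v p ! length b" using v len by (simp add: app_nth nth_append)
    ultimately show ?thesis by (auto simp: less_Suc_eq)
  qed
  with d s len show ?thesis by (auto simp: trans_lists_def)
qed (auto simp: trans_lists_def)

text \<open>Occurrences that end in the new column are governed by \<open>allowed\<close>; all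
  others are occurrences in \<open>p\<close> already, because \<open>bump\<close> preserves order
  and bounds.\<close>

lemma avoid_lists_snoc:
  assumes Q: "order_invariant Q" and b: "sorted (b @ [c])"
  shows "avoid_lists Q (b @ [c]) = (\<Union>p\<in>avoid_lists Q b. (\<lambda>v. app v p) ` allowed Q c p)"
proof -
  have *: "app v p \<in> avoid_lists Q (b @ [c]) \<longleftrightarrow> p \<in> avoid_lists Q b \<and> v \<in> allowed Q c p"
    if v: "c < v" "v \<le> Suc (length b)" for v p
  proof (cases "p \<in> trans_lists b")
    case True
    then have len: "length p = length b" by (auto simp: trans_lists_def)
    have bc: "b ! i \<le> c" if "i < length b" for i
      using b that by (auto simp: sorted_append)
    have low: "(b @ [c]) ! k < bump v x \<longleftrightarrow> (b @ [c]) ! k < x" if "k \<le> length b" for k x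
      using bc[of k] v that by (intro less_bump_low) (auto simp: nth_append)
    let ?P = "\<lambda>b p i j k. b ! k < p ! i \<longrightarrow> b ! k < p ! j \<longrightarrow> b ! k < p ! k \<longrightarrow>
                 \<not> Q (p ! i) (p ! j) (p ! k)"
    have 1: "?P (b @ [c]) (app v p) i j k \<longleftrightarrow> ?P b p i j k" if "i < j" "j < k" "k < length b" for i j k
      using that len low[of k] by (simp add: app_nth Q_bump[OF Q] nth_append)
    have 2: "?P (b @ [c]) (app v p) i j (length b) \<longleftrightarrow>
        (c < p ! i \<longrightarrow> c < p ! j \<longrightarrow> \<not> Q (bump v (p ! i)) (bump v (p ! j)) v)"
      if "i < j" "j < length b" for i j
      using that len low[of "length b"] v by (simp add: app_nth nth_append)
    have "(\<forall>i j k. i < j \<longrightarrow> j < k \<longrightarrow> k < length (b @ [c]) \<longrightarrow> ?P (b @ [c]) (app v p) i j k) \<longleftrightarrow>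
      (\<forall>i j k. i < j \<longrightarrow> j < k \<longrightarrow> k < length b \<longrightarrow> ?P b p i j k) \<and>
      (\<forall>i j. i < j \<longrightarrow> j < length b \<longrightarrow> c < p ! i \<longrightarrow> c < p ! j \<longrightarrow> \<not> Q (bump v (p ! i)) (bump v (p ! j)) v)"
      (is "?L \<longleftrightarrow> ?R1 \<and> ?R2")
    proof
      assume L: ?L
      have ?R1
      proof (intro allI impI)
        fix i j k assume h: "i < j" "j < k" "k < length b" "b ! k < p ! i" "b ! k < p ! j" "b ! k < p ! k"
        have "?P (b @ [c]) (app v p) i j k" using L h by simp
        then show "\<not> Q (p ! i) (p ! j) (p ! k)" using 1[OF h(1-3)] h by blast
      qed
      moreover have ?R2
      proof (intro allI impI)
        fix i j assume h: "i < j" "j < length b" "c < p ! i" "c < p ! j"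
        have "?P (b @ [c]) (app v p) i j (length b)" using L h by simp
        then show "\<not> Q (bump v (p ! i)) (bump v (p ! j)) v" using 2[OF h(1-2)] h by blast
      qed
      ultimately show "?R1 \<and> ?R2" ..
    next
      assume R: "?R1 \<and> ?R2"
      show ?L
      proof (intro allI, rule impI, rule impI, rule impI)
        fix i j k assume h: "i < j" "j < k" "k < length (b @ [c])"
        show "?P (b @ [c]) (app v p) i j k"
        proof (cases "k = length b")
          case True
          then show ?thesis using 2[of i j] h R by simp
        next
          case False
          then have "k < length b" using h by simp
          then show ?thesis using 1[of i j k] h R by simp
        qed
      qed
    qed
    then show ?thesis using True app_in_trans_lists[OF b v, of p] v len
      unfolding avoid_lists_def allowed_def by simp
  qed (auto simp: avoid_lists_def app_in_trans_lists[OF b v])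
  show ?thesis
  proof (intro set_eqI iffI)
    fix q assume q: "q \<in> avoid_lists Q (b @ [c])"
    then have qt: "q \<in> trans_lists (b @ [c])" by (simp add: avoid_lists_def)
    then obtain p v where pv: "q = app v p" "length p = length b" "v \<le> Suc (length b)"
      by (auto simp: trans_lists_def elim!: app_surj[of q "length b"])
    have "(b @ [c]) ! length b < q ! length b" using qt by (auto simp: trans_lists_def)
    then have "c < v" using pv by (simp add: app_nth nth_append)
    then show "q \<in> (\<Union>p\<in>avoid_lists Q b. (\<lambda>v. app v p) ` allowed Q c p)"
      using *[of v p] pv q by blast
  next
    fix q assume "q \<in> (\<Union>p\<in>avoid_lists Q b. (\<lambda>v. app v p) ` allowed Q c p)"
    then obtain p v where pv: "p \<in> avoid_lists Q b" "v \<in> allowed Q c p" "q = app v p" by blast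
    then have "c < v" "v \<le> Suc (length b)" by (auto simp: allowed_def avoid_lists_def trans_lists_def)
    then show "q \<in> avoid_lists Q (b @ [c])" using * pv by blast
  qed
qed

text \<open>A generating tree whose nodes are the standardized restrictions to the columns built so
  far. It consumes columns from the front, like the counting recursions below, whereas
  \<open>avoid_lists_snoc\<close> peels off the last one; \<open>ext_snoc\<close> reconciles the
  two.\<close>

fun ext :: "(nat \<Rightarrow> nat \<Rightarrow> nat \<Rightarrow> bool) \<Rightarrow> nat list \<Rightarrow> nat list \<Rightarrow> nat list set" where
  "ext Q p [] = {p}"
| "ext Q p (c # b) = (\<Union>v\<in>allowed Q c p. ext Q (app v p) b)"

lemma ext_snoc: "ext Q p (b @ [c]) = (\<Union>q\<in>ext Q p b. (\<lambda>v. app v q) ` allowed Q c q)"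
  by (induction b arbitrary: p) auto

lemma avoid_lists_eq_ext:
  assumes Q: "order_invariant Q" and b: "sorted b"
  shows "avoid_lists Q b = ext Q [] b"
  using b
proof (induction b rule: rev_induct)
  case Nil
  then show ?case by (auto simp: avoid_lists_def trans_lists_def)
next
  case (snoc c b)
  then show ?case using avoid_lists_snoc[OF Q snoc.prems] by (simp add: ext_snoc sorted_append)
qed

text \<open>\<open>app v p\<close> determines both \<open>v\<close> and \<open>p\<close>, so
  different branches have disjoint sets of leaves and their cardinalities add up.\<close>

lemma ext_inj: "q \<in> ext Q p b \<Longrightarrow> q \<in> ext Q p' b \<Longrightarrow> p = p'"
proof (induction b arbitrary: p p')
  case (Cons c b)
  then obtain v v' where "q \<in> ext Q (app v p) b" "q \<in> ext Q (app v' p') b" by auto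
  then have "app v p = app v' p'" by (rule Cons.IH)
  then show ?case by (simp add: app_inj)
qed simp

lemma finite_allowed: "finite (allowed Q c p)"
  by (rule finite_subset[of _ "{..Suc (length p)}"]) (auto simp: allowed_def)

lemma finite_ext: "finite (ext Q p b)"
  by (induction b arbitrary: p) (auto simp: finite_allowed)

lemma card_ext_Cons: "card (ext Q p (c # b)) = (\<Sum>v\<in>allowed Q c p. card (ext Q (app v p) b))"
  unfolding ext.simps
proof (rule card_UN_disjoint)
  show "\<forall>i\<in>allowed Q c p. \<forall>j\<in>allowed Q c p. i \<noteq> j \<longrightarrow> ext Q (app i p) b \<inter> ext Q (app j p) b = {}"
    using ext_inj app_inj by blast
qed (auto simp: finite_allowed finite_ext)

section \<open>State functions of the three processes\<close>

definition is_perm :: "nat list \<Rightarrow> bool" where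
  "is_perm p \<longleftrightarrow> distinct p \<and> set p = {1..length p}"

lemma is_perm_app:
  assumes "is_perm p" "1 \<le> v" "v \<le> Suc (length p)"
  shows "is_perm (app v p)"
proof -
  have "distinct (map (bump v) p)" using assms by (auto simp: is_perm_def distinct_map inj_on_def)
  moreover have "set (app v p) = {1..Suc (length p)}"
    using bump_image[OF assms(2,3)] assms(1) by (simp add: app_def is_perm_def)
  ultimately show ?thesis by (auto simp: is_perm_def app_def)
qed

lemma is_perm_ex:
  assumes "is_perm p" "1 \<le> u" "u \<le> length p"
  obtains i where "i < length p" "p ! i = u"
  using assms by (metis atLeastAtMost_iff in_set_conv_nth is_perm_def)

text \<open>If \<open>v > x + 1\<close>, the value \<open>x + 1\<close> is present, live and below
  \<open>v\<close>, so \<open>v\<close> tops a live ascent and caps the next value at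
  \<open>v\<close>. If \<open>v = x + 1\<close>, it is the least live value and tops no ascent; the
  old live values just move up by one. If \<open>v \<le> x\<close>, then \<open>v\<close> is dead
  and the live values are the shifted old ones above \<open>x - 1\<close>.\<close>

definition upd123 :: "(nat \<Rightarrow> nat) \<Rightarrow> nat \<Rightarrow> nat \<Rightarrow> nat" where
  "upd123 \<tau> v x = (if Suc x < v then v else if Suc x = v then Suc (\<tau> x) else Suc (\<tau> (x - 1)))"

fun count123 :: "(nat \<Rightarrow> nat) \<Rightarrow> nat list \<Rightarrow> nat" where
  "count123 \<tau> [] = 1"
| "count123 \<tau> (c # b) = (\<Sum>v\<in>{c<..\<tau> c}. count123 (upd123 \<tau> v) b)"

text \<open>A live \<open>v\<close> forms a descent with the old value \<open>v\<close>, which has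
  become \<open>v + 1\<close> and caps the next value there. If \<open>v\<close> is a new maximum
  there is no such descent, but then \<open>v + 1\<close> is the absolute limit anyway.\<close>

definition upd213 :: "(nat \<Rightarrow> nat) \<Rightarrow> nat \<Rightarrow> nat \<Rightarrow> nat" where
  "upd213 \<tau> v x = (if x < v then Suc v else Suc (\<tau> (x - 1)))"

fun count213 :: "(nat \<Rightarrow> nat) \<Rightarrow> nat list \<Rightarrow> nat" where
  "count213 \<tau> [] = 1"
| "count213 \<tau> (c # b) = (\<Sum>v\<in>{c<..\<tau> c}. count213 (upd213 \<tau> v) b)"

text \<open>Appending the maximum \<open>Suc n\<close> creates no inversion; any other admissible
  \<open>v\<close> is a new inversion bottom and exceeds the old ones.\<close>

fun count321 :: "nat \<Rightarrow> nat \<Rightarrow> nat list \<Rightarrow> nat" where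
  "count321 n \<eta> [] = 1"
| "count321 n \<eta> (c # b) =
     (\<Sum>v\<in>{max c \<eta><..Suc n}. count321 (Suc n) (if v = Suc n then \<eta> else v) b)"

text \<open>\<open>\<tau> x\<close> is the largest value that may be appended to \<open>p\<close> when only the values above \<open>x\<close> count;
  bounds below \<open>c\<close> do not occur any more. For the pattern \<open>321\<close> the values of the inversion
  bottoms are automatically live, so one number \<open>\<eta>\<close>, the largest inversion bottom, suffices.\<close>

definition rep123 :: "nat \<Rightarrow> (nat \<Rightarrow> nat) \<Rightarrow> nat list \<Rightarrow> bool" where
  "rep123 c \<tau> p \<longleftrightarrow> (\<forall>x v. c \<le> x \<longrightarrow> x \<le> length p \<longrightarrow> x < v \<longrightarrow>
     (v \<le> \<tau> x \<longleftrightarrow> v \<le> Suc (length p) \<and>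
        \<not> (\<exists>i j. i < j \<and> j < length p \<and> x < p ! i \<and> p ! i < p ! j \<and> p ! j < v)))"

definition rep213 :: "nat \<Rightarrow> (nat \<Rightarrow> nat) \<Rightarrow> nat list \<Rightarrow> bool" where
  "rep213 c \<tau> p \<longleftrightarrow> (\<forall>x v. c \<le> x \<longrightarrow> x \<le> length p \<longrightarrow> x < v \<longrightarrow>
     (v \<le> \<tau> x \<longleftrightarrow> v \<le> Suc (length p) \<and>
        \<not> (\<exists>i j. i < j \<and> j < length p \<and> x < p ! j \<and> p ! j < p ! i \<and> p ! i < v)))"

definition rep321 :: "nat \<Rightarrow> nat list \<Rightarrow> bool" where
  "rep321 \<eta> p \<longleftrightarrow> (\<forall>v\<ge>1. v \<le> \<eta> \<longleftrightarrow> (\<exists>i j. i < j \<and> j < length p \<and> p ! j < p ! i \<and> v \<le> p ! j))"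

lemma rep123_mono: "rep123 c \<tau> p \<Longrightarrow> c \<le> d \<Longrightarrow> rep123 d \<tau> p"
  unfolding rep123_def by (meson order_trans)

lemma rep213_mono: "rep213 c \<tau> p \<Longrightarrow> c \<le> d \<Longrightarrow> rep213 d \<tau> p"
  unfolding rep213_def by (meson order_trans)

lemma allowed_rep123:
  assumes "rep123 c \<tau> p" "c \<le> length p"
  shows "allowed pat123 c p = {c<..\<tau> c}"
proof -
  have "v \<in> allowed pat123 c p \<longleftrightarrow> v \<in> {c<..\<tau> c}" for v
  proof (cases "c < v")
    case True
    then have "v \<le> \<tau> c \<longleftrightarrow> v \<le> Suc (length p) \<and>
        \<not> (\<exists>i j. i < j \<and> j < length p \<and> c < p ! i \<and> p ! i < p ! j \<and> p ! j < v)"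
      using assms by (simp add: rep123_def)
    moreover have "c < p ! j" if "c < p ! i" "p ! i < p ! j" for i j using that by simp
    ultimately show ?thesis using True unfolding allowed_def pat123_def by auto
  qed (auto simp: allowed_def)
  then show ?thesis by blast
qed

lemma allowed_rep213:
  assumes "rep213 c \<tau> p" "c \<le> length p"
  shows "allowed pat213 c p = {c<..\<tau> c}"
proof -
  have "v \<in> allowed pat213 c p \<longleftrightarrow> v \<in> {c<..\<tau> c}" for v
  proof (cases "c < v")
    case True
    then have "v \<le> \<tau> c \<longleftrightarrow> v \<le> Suc (length p) \<and>
        \<not> (\<exists>i j. i < j \<and> j < length p \<and> c < p ! j \<and> p ! j < p ! i \<and> p ! i < v)"
      using assms by (simp add: rep213_def)
    moreover have "c < p ! i" if "c < p ! j" "p ! j < p ! i" for i j using that by simp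
    ultimately show ?thesis using True unfolding allowed_def pat213_def by auto
  qed (auto simp: allowed_def)
  then show ?thesis by blast
qed

lemma allowed_rep321:
  assumes "rep321 \<eta> p" "c \<le> length p"
  shows "allowed pat321 c p = {max c \<eta><..Suc (length p)}"
proof -
  have "v \<in> allowed pat321 c p \<longleftrightarrow> v \<in> {max c \<eta><..Suc (length p)}" for v
  proof (cases "c < v")
    case True
    then have *: "v \<le> \<eta> \<longleftrightarrow> (\<exists>i j. i < j \<and> j < length p \<and> p ! j < p ! i \<and> v \<le> p ! j)"
      using assms(1) by (auto simp: rep321_def)
    have "c < p ! j" "c < p ! i" if "v \<le> p ! j" "p ! j < p ! i" for i j
      using True that by auto
    then have "(c < p ! i \<longrightarrow> c < p ! j \<longrightarrow> \<not> (v \<le> p ! j \<and> p ! j < p ! i)) \<longleftrightarrow>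
        \<not> (p ! j < p ! i \<and> v \<le> p ! j)" for i j by blast
    then have "v \<in> allowed pat321 c p \<longleftrightarrow> v \<le> Suc (length p) \<and> \<not> v \<le> \<eta>"
      using True unfolding * by (simp add: allowed_def pat321_def) blast
    then show ?thesis using True by auto
  qed (auto simp: allowed_def)
  then show ?thesis by blast
qed

lemma less_Suc_pairs:
  fixes n :: nat
  shows "(\<exists>i j. i < j \<and> j < Suc n \<and> R i j) \<longleftrightarrow>
    (\<exists>i j. i < j \<and> j < n \<and> R i j) \<or> (\<exists>i<n. R i n)"
  by (auto simp: less_Suc_eq)

lemma ex_pairs_app:
  "(\<exists>i j. i < j \<and> j < Suc (length p) \<and> R (app v p ! i) (app v p ! j)) \<longleftrightarrow>
    (\<exists>i j. i < j \<and> j < length p \<and> R (bump v (p ! i)) (bump v (p ! j))) \<or>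
    (\<exists>i<length p. R (bump v (p ! i)) v)"
proof -
  have "(\<exists>i j. i < j \<and> j < length p \<and> R (app v p ! i) (app v p ! j)) \<longleftrightarrow>
      (\<exists>i j. i < j \<and> j < length p \<and> R (bump v (p ! i)) (bump v (p ! j)))"
    by (intro ex_cong1 conj_cong refl) (simp add: app_nth)
  moreover have "(\<exists>i<length p. R (app v p ! i) (app v p ! length p)) \<longleftrightarrow>
      (\<exists>i<length p. R (bump v (p ! i)) v)"
    by (intro ex_cong1 conj_cong refl) (simp add: app_nth)
  ultimately show ?thesis unfolding less_Suc_pairs by simp
qed

lemma bump_gt: "1 \<le> v \<Longrightarrow> v \<le> x \<Longrightarrow> x < bump v u \<longleftrightarrow> x - 1 < u \<and> v \<le> u"
  by (auto simp: bump_def)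

lemma bump_lt: "v < w \<Longrightarrow> bump v u < w \<longleftrightarrow> u < w - 1"
  by (auto simp: bump_def)

lemma rep123_app:
  assumes r: "rep123 c \<tau> p" and p: "is_perm p" and v: "c < v" "v \<le> \<tau> c" and c: "c \<le> length p"
  shows "rep123 c (upd123 \<tau> v) (app v p)"
proof -
  let ?n = "length p"
  have vn: "v \<le> Suc ?n" and no: "\<And>i j. i < j \<Longrightarrow> j < ?n \<Longrightarrow> c < p ! i \<Longrightarrow> p ! i < p ! j \<Longrightarrow> \<not> p ! j < v"
    using r[unfolded rep123_def, rule_format, of c v] v c by auto
  have \<tau>: "w \<le> \<tau> x \<longleftrightarrow> w \<le> Suc ?n \<and>
        \<not> (\<exists>i j. i < j \<and> j < ?n \<and> x < p ! i \<and> p ! i < p ! j \<and> p ! j < w)"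
    if "c \<le> x" "x \<le> ?n" "x < w" for x w using r that unfolding rep123_def by blast
  have main: "w \<le> upd123 \<tau> v x \<longleftrightarrow> w \<le> Suc (Suc ?n) \<and>
      \<not> ((\<exists>i j. i < j \<and> j < ?n \<and> x < bump v (p ! i) \<and> p ! i < p ! j \<and> bump v (p ! j) < w) \<or>
         (\<exists>i<?n. x < bump v (p ! i) \<and> p ! i < v \<and> v < w))"
    if x: "c \<le> x" "x \<le> Suc ?n" "x < w" for x w
  proof -
    consider "Suc x < v" | "Suc x = v" | "v \<le> x" by linarith
    then show ?thesis
    proof cases
      case 1
      then obtain i where i: "i < ?n" "p ! i = Suc x" using is_perm_ex[OF p, of "Suc x"] vn by auto
      then have wit: "x < bump v (p ! i)" "p ! i < v" using 1 by (auto simp: bump_def)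
      have "\<not> (i < j \<and> j < ?n \<and> x < bump v (p ! i) \<and> p ! i < p ! j \<and> bump v (p ! j) < w)"
        if "w \<le> v" for i j
      proof
        assume h: "i < j \<and> j < ?n \<and> x < bump v (p ! i) \<and> p ! i < p ! j \<and> bump v (p ! j) < w"
        then have "bump v (p ! j) < v" using that by linarith
        then have "p ! j < v" by simp
        moreover have "x < p ! i" using h 1 less_bump_low[of x v] by simp
        ultimately show False using no[of i j] h x by simp
      qed
      moreover have "\<exists>i<?n. x < bump v (p ! i) \<and> p ! i < v \<and> v < w" if "\<not> w \<le> v"
        using i wit that by (intro exI[of _ i]) auto
      ultimately show ?thesis using 1 wit vn unfolding upd123_def by (cases "w \<le> v") auto
    next
      case 2
      have eq: "x < bump v u \<longleftrightarrow> x < u" for u using 2 less_bump_low[of x v] by simp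
      show ?thesis
      proof (cases "w = v")
        case True
        have "x < Suc (\<tau> x)" using \<tau>[of x "Suc x"] x 2 vn by (auto simp: le_Suc_eq)
        moreover have "False" if "x < u" "u < u'" "bump v u' < v" for u u' using that 2 by simp
        ultimately show ?thesis using True 2 vn by (auto simp: upd123_def eq)
      next
        case False
        then have w: "v < w" using x 2 by simp
        have "x < w - 1" "x \<le> ?n" using w 2 vn by auto
        from \<tau>[OF x(1) this(2,1)] have "w - 1 \<le> \<tau> x \<longleftrightarrow> w - 1 \<le> Suc ?n \<and>
          \<not> (\<exists>i j. i < j \<and> j < ?n \<and> x < p ! i \<and> p ! i < p ! j \<and> p ! j < w - 1)" .
        moreover have "\<not> (x < u \<and> u < v)" for u using 2 by simp
        ultimately show ?thesis using 2 w by (simp add: upd123_def eq bump_lt) auto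
      qed
    next
      case 3
      have y: "c \<le> x - 1" "x - 1 \<le> ?n" "x - 1 < w - 1" using 3 v x by auto
      have vw: "v < w" using 3 x by simp
      have "v \<le> u" if "x - 1 < u" for u using that 3 by simp
      then have eq: "x < bump v u \<longleftrightarrow> x - 1 < u" for u using bump_gt[OF _ 3, of u] v by auto
      have "\<not> (x - 1 < u \<and> u < v)" for u using 3 by auto
      then show ?thesis using \<tau>[OF y] 3 vw x by (simp add: upd123_def eq bump_lt) auto
    qed
  qed
  have ex: "(\<exists>i j. i < j \<and> j < Suc ?n \<and> x < app v p ! i \<and> app v p ! i < app v p ! j \<and> app v p ! j < w)
    \<longleftrightarrow> (\<exists>i j. i < j \<and> j < ?n \<and> x < bump v (p ! i) \<and> p ! i < p ! j \<and> bump v (p ! j) < w) \<or>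
         (\<exists>i<?n. x < bump v (p ! i) \<and> p ! i < v \<and> v < w)" for x w
    using ex_pairs_app[of p "\<lambda>a b. x < a \<and> a < b \<and> b < w" v] by simp
  show ?thesis unfolding rep123_def length_app ex
    by (intro allI impI) (rule main; simp)
qed

lemma rep213_app:
  assumes r: "rep213 c \<tau> p" and p: "is_perm p" and v: "c < v" "v \<le> \<tau> c" and c: "c \<le> length p"
  shows "rep213 c (upd213 \<tau> v) (app v p)"
proof -
  let ?n = "length p"
  have vn: "v \<le> Suc ?n" and no: "\<And>i j. i < j \<Longrightarrow> j < ?n \<Longrightarrow> c < p ! j \<Longrightarrow> p ! j < p ! i \<Longrightarrow> \<not> p ! i < v"
    using r[unfolded rep213_def, rule_format, of c v] v c by auto
  have \<tau>: "w \<le> \<tau> x \<longleftrightarrow> w \<le> Suc ?n \<and>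
        \<not> (\<exists>i j. i < j \<and> j < ?n \<and> x < p ! j \<and> p ! j < p ! i \<and> p ! i < w)"
    if "c \<le> x" "x \<le> ?n" "x < w" for x w using r that unfolding rep213_def by blast
  have main: "w \<le> upd213 \<tau> v x \<longleftrightarrow> w \<le> Suc (Suc ?n) \<and>
      \<not> ((\<exists>i j. i < j \<and> j < ?n \<and> x < bump v (p ! j) \<and> p ! j < p ! i \<and> bump v (p ! i) < w) \<or>
         (\<exists>i<?n. x < v \<and> v \<le> p ! i \<and> bump v (p ! i) < w))"
    if x: "c \<le> x" "x \<le> Suc ?n" "x < w" for x w
  proof (cases "x < v")
    case True
    have A: "\<not> (i < j \<and> j < ?n \<and> x < bump v (p ! j) \<and> p ! j < p ! i \<and> bump v (p ! i) < w)"
      if "w \<le> Suc v" for i j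
    proof
      assume h: "i < j \<and> j < ?n \<and> x < bump v (p ! j) \<and> p ! j < p ! i \<and> bump v (p ! i) < w"
      then have "bump v (p ! i) \<le> v" using that by linarith
      then have "bump v (p ! i) < v" using bump_neq[of v "p ! i"] by linarith
      then have "p ! i < v" by simp
      moreover have "x < p ! j" using h True less_bump_low[of x v] by simp
      ultimately show False using no[of i j] h x by simp
    qed
    have B: "\<not> (v \<le> u \<and> bump v u < w)" if "w \<le> Suc v" for u using that by (auto simp: bump_def)
    have C: "\<exists>i<?n. v \<le> p ! i \<and> bump v (p ! i) < w" if "Suc v < w" "w \<le> Suc (Suc ?n)"
    proof -
      have "1 \<le> v" "v \<le> ?n" using that v by auto
      then obtain i where "i < ?n" "p ! i = v" by (rule is_perm_ex[OF p])
      then show ?thesis using that by (auto simp: bump_def)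
    qed
    show ?thesis
    proof (cases "w \<le> Suc v")
      case w: True
      then show ?thesis using A B vn True by (auto simp: upd213_def)
    next
      case False
      then have "Suc v < w" by simp
      then show ?thesis using C True by (cases "w \<le> Suc (Suc ?n)") (simp_all add: upd213_def)
    qed
  next
    case False
    then have 3: "v \<le> x" by simp
    have y: "c \<le> x - 1" "x - 1 \<le> ?n" "x - 1 < w - 1" using 3 v x by auto
    have vw: "v < w" using 3 x by simp
    have "v \<le> u" if "x - 1 < u" for u using that 3 by simp
    then have eq: "x < bump v u \<longleftrightarrow> x - 1 < u" for u using bump_gt[OF _ 3, of u] v by auto
    show ?thesis using \<tau>[OF y] 3 vw x by (simp add: upd213_def eq bump_lt) auto
  qed
  have ex: "(\<exists>i j. i < j \<and> j < Suc ?n \<and> x < app v p ! j \<and> app v p ! j < app v p ! i \<and> app v p ! i < w)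
    \<longleftrightarrow> (\<exists>i j. i < j \<and> j < ?n \<and> x < bump v (p ! j) \<and> p ! j < p ! i \<and> bump v (p ! i) < w) \<or>
         (\<exists>i<?n. x < v \<and> v \<le> p ! i \<and> bump v (p ! i) < w)" for x w
    using ex_pairs_app[of p "\<lambda>a b. x < b \<and> b < a \<and> a < w" v] by simp
  show ?thesis unfolding rep213_def length_app ex
    by (intro allI impI) (rule main; simp)
qed

lemma rep321_app:
  assumes r: "rep321 \<eta> p" and p: "is_perm p" and v: "\<eta> < v" "v \<le> Suc (length p)"
  shows "rep321 (if v = Suc (length p) then \<eta> else v) (app v p)"
proof -
  let ?n = "length p"
  have \<eta>: "w \<le> \<eta> \<longleftrightarrow> (\<exists>i j. i < j \<and> j < ?n \<and> p ! j < p ! i \<and> w \<le> p ! j)" if "1 \<le> w" for w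
    using r that unfolding rep321_def by blast
  have v1: "1 \<le> v" using v by simp
  have no: "p ! j < v" if "i < j" "j < ?n" "p ! j < p ! i" for i j
    using \<eta>[OF v1] v that by (meson not_le)
  have pn: "p ! j \<le> ?n" if "j < ?n" for j
  proof -
    have "p ! j \<in> set p" using that by simp
    then show ?thesis using p by (simp add: is_perm_def)
  qed
  have main: "w \<le> (if v = Suc ?n then \<eta> else v) \<longleftrightarrow>
      (\<exists>i j. i < j \<and> j < ?n \<and> p ! j < p ! i \<and> w \<le> bump v (p ! j)) \<or> (\<exists>i<?n. v \<le> p ! i \<and> w \<le> v)"
    if w: "1 \<le> w" for w
  proof -
    \<comment> \<open>Old inversion bottoms lie below \<open>v\<close>, so \<open>bump\<close> fixes
      them.\<close>
    have bj: "bump v (p ! j) = p ! j" if "i < j" "j < ?n" "p ! j < p ! i" for i j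
      using no[OF that] by (simp add: bump_def)
    have E: "(\<exists>i j. i < j \<and> j < ?n \<and> p ! j < p ! i \<and> w \<le> bump v (p ! j)) \<longleftrightarrow> w \<le> \<eta>"
      unfolding \<eta>[OF w] by (intro ex_cong1 conj_cong refl) (simp add: bj)
    show ?thesis
    proof (cases "v = Suc ?n")
      case True
      have "\<not> v \<le> p ! i" if "i < ?n" for i using pn[OF that] True by simp
      then show ?thesis using E True by auto
    next
      case False
      then have "v \<le> ?n" using v by simp
      then obtain i where "i < ?n" "p ! i = v" by (rule is_perm_ex[OF p v1])
      then have "(\<exists>i<?n. v \<le> p ! i \<and> w \<le> v) \<longleftrightarrow> w \<le> v" by auto
      then show ?thesis using E False v by auto
    qed
  qed
  have ex: "(\<exists>i j. i < j \<and> j < Suc ?n \<and> app v p ! j < app v p ! i \<and> w \<le> app v p ! j)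
    \<longleftrightarrow> (\<exists>i j. i < j \<and> j < ?n \<and> p ! j < p ! i \<and> w \<le> bump v (p ! j)) \<or> (\<exists>i<?n. v \<le> p ! i \<and> w \<le> v)" for w
    using ex_pairs_app[of p "\<lambda>a b. b < a \<and> w \<le> b" v] by simp
  show ?thesis unfolding rep321_def length_app ex
    by (intro allI impI) (rule main)
qed

text \<open>The bound on \<open>b ! i\<close> ensures \<open>d \<le> length p\<close> at every step,
  the range of arguments in which \<open>rep123\<close> gives information.\<close>

lemma card_ext_123:
  "\<lbrakk>rep123 c \<tau> p; is_perm p; sorted (c # b); \<And>i. i < length b \<Longrightarrow> b ! i \<le> length p + i\<rbrakk>
    \<Longrightarrow> card (ext pat123 p b) = count123 \<tau> b"
proof (induction b arbitrary: c \<tau> p)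
  case (Cons d b)
  have d: "d \<le> length p" using Cons.prems(4)[of 0] by simp
  have r: "rep123 d \<tau> p" using Cons.prems(1,3) by (auto intro: rep123_mono)
  have "card (ext pat123 (app v p) b) = count123 (upd123 \<tau> v) b" if v: "v \<in> {d<..\<tau> d}" for v
  proof (rule Cons.IH)
    show "rep123 d (upd123 \<tau> v) (app v p)" using rep123_app[OF r Cons.prems(2)] v d by auto
    have "v \<in> allowed pat123 d p" using allowed_rep123[OF r d] v by simp
    then show "is_perm (app v p)" using Cons.prems(2) by (intro is_perm_app) (auto simp: allowed_def)
    show "sorted (d # b)" using Cons.prems(3) by simp
    show "b ! i \<le> length (app v p) + i" if "i < length b" for i
      using Cons.prems(4)[of "Suc i"] that by simp
  qed
  then show ?case unfolding card_ext_Cons allowed_rep123[OF r d] count123.simps by (intro sum.cong refl)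
qed simp

lemma card_ext_213:
  "\<lbrakk>rep213 c \<tau> p; is_perm p; sorted (c # b); \<And>i. i < length b \<Longrightarrow> b ! i \<le> length p + i\<rbrakk>
    \<Longrightarrow> card (ext pat213 p b) = count213 \<tau> b"
proof (induction b arbitrary: c \<tau> p)
  case (Cons d b)
  have d: "d \<le> length p" using Cons.prems(4)[of 0] by simp
  have r: "rep213 d \<tau> p" using Cons.prems(1,3) by (auto intro: rep213_mono)
  have "card (ext pat213 (app v p) b) = count213 (upd213 \<tau> v) b" if v: "v \<in> {d<..\<tau> d}" for v
  proof (rule Cons.IH)
    show "rep213 d (upd213 \<tau> v) (app v p)" using rep213_app[OF r Cons.prems(2)] v d by auto
    have "v \<in> allowed pat213 d p" using allowed_rep213[OF r d] v by simp
    then show "is_perm (app v p)" using Cons.prems(2) by (intro is_perm_app) (auto simp: allowed_def)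
    show "sorted (d # b)" using Cons.prems(3) by simp
    show "b ! i \<le> length (app v p) + i" if "i < length b" for i
      using Cons.prems(4)[of "Suc i"] that by simp
  qed
  then show ?case unfolding card_ext_Cons allowed_rep213[OF r d] count213.simps by (intro sum.cong refl)
qed simp

lemma card_ext_321:
  "\<lbrakk>rep321 \<eta> p; is_perm p; \<And>i. i < length b \<Longrightarrow> b ! i \<le> length p + i\<rbrakk>
    \<Longrightarrow> card (ext pat321 p b) = count321 (length p) \<eta> b"
proof (induction b arbitrary: \<eta> p)
  case (Cons d b)
  have d: "d \<le> length p" using Cons.prems(3)[of 0] by simp
  have "card (ext pat321 (app v p) b) =
      count321 (Suc (length p)) (if v = Suc (length p) then \<eta> else v) b"
    if v: "v \<in> {max d \<eta><..Suc (length p)}" for v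
  proof -
    have "card (ext pat321 (app v p) b) =
        count321 (length (app v p)) (if v = Suc (length p) then \<eta> else v) b"
    proof (rule Cons.IH)
      show "rep321 (if v = Suc (length p) then \<eta> else v) (app v p)"
        using rep321_app[OF Cons.prems(1,2)] v by auto
      show "is_perm (app v p)" using Cons.prems(2) v by (intro is_perm_app) auto
      show "b ! i \<le> length (app v p) + i" if "i < length b" for i
        using Cons.prems(3)[of "Suc i"] that by simp
    qed
    then show ?thesis by simp
  qed
  then show ?case unfolding card_ext_Cons allowed_rep321[OF Cons.prems(1) d] count321.simps by (intro sum.cong refl)
qed simp

lemma card_avoid_lists:
  assumes b: "sorted b" "\<forall>i<length b. b ! i \<le> i"
  shows "card (avoid_lists pat123 b) = count123 Suc b"
    and "card (avoid_lists pat213 b) = count213 Suc b"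
    and "card (avoid_lists pat321 b) = count321 0 0 b"
proof -
  have s: "sorted (0 # b)" using b by simp
  have p: "is_perm []" by (simp add: is_perm_def)
  have r: "rep123 0 Suc []" "rep213 0 Suc []" "rep321 0 []"
    by (auto simp: rep123_def rep213_def rep321_def)
  have l: "b ! i \<le> length ([] :: nat list) + i" if "i < length b" for i using b(2) that by simp
  show "card (avoid_lists pat123 b) = count123 Suc b"
    unfolding avoid_lists_eq_ext[OF order_invariant_pats(2) b(1)] by (rule card_ext_123[OF r(1) p s l])
  show "card (avoid_lists pat213 b) = count213 Suc b"
    unfolding avoid_lists_eq_ext[OF order_invariant_pats(1) b(1)] by (rule card_ext_213[OF r(2) p s l])
  have "card (avoid_lists pat321 b) = count321 (length ([] :: nat list)) 0 b"
    unfolding avoid_lists_eq_ext[OF order_invariant_pats(3) b(1)] by (rule card_ext_321[OF r(3) p l])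
  then show "card (avoid_lists pat321 b) = count321 0 0 b" by simp
qed

text \<open>After one step the processes are in different states, so arbitrary
  \<open>\<tau> \<le> \<tau>'\<close> have to be compared. Where the updates disagree, the 123 side
  takes its bound at a later argument, or takes a bound of \<open>\<tau>'\<close> where the 213 side
  is capped at \<open>\<tau> d + 1\<close>; monotonicity of \<open>\<tau>'\<close> decides both
  cases.\<close>

lemma count213_le_count123:
  "\<lbrakk>sorted (c # b); \<And>x. c \<le> x \<Longrightarrow> \<tau> x \<le> \<tau>' x; \<And>x y. c \<le> x \<Longrightarrow> x \<le> y \<Longrightarrow> \<tau>' x \<le> \<tau>' y;
    \<And>x. c \<le> x \<Longrightarrow> x < \<tau>' x\<rbrakk> \<Longrightarrow> count213 \<tau> b \<le> count123 \<tau>' b"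
proof (induction b arbitrary: c \<tau> \<tau>')
  case Nil
  show ?case by simp
next
  case (Cons d b)
  have cd: "c \<le> d" and s: "sorted (d # b)" using Cons.prems(1) by auto
  \<comment> \<open>This rotation of the admissible interval makes \<open>upd213 \<tau> v\<close> and \<open>upd123 \<tau> (\<sigma> v)\<close> almost
    agree: they differ only at the argument \<open>v\<close>, where the latter is larger.\<close>
  define \<sigma> where "\<sigma> v = (if v < \<tau> d then Suc v else Suc d)" for v
  have le: "\<tau> x \<le> \<tau>' x" if "d \<le> x" for x by (rule Cons.prems(2)) (use that cd in linarith)
  have mono: "\<tau>' x \<le> \<tau>' y" if "d \<le> x" "x \<le> y" for x y by (rule Cons.prems(3)) (use that cd in linarith)+
  have infl: "x < \<tau>' x" if "d \<le> x" for x by (rule Cons.prems(4)) (use that cd in linarith)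
  have inj: "inj_on \<sigma> {d<..\<tau> d}" by (auto simp: inj_on_def \<sigma>_def split: if_splits)
  have sub: "\<sigma> ` {d<..\<tau> d} \<subseteq> {d<..\<tau>' d}"
    using le[of d] infl[of d] by (auto simp: \<sigma>_def)
  have step: "count213 (upd213 \<tau> v) b \<le> count123 (upd123 \<tau>' (\<sigma> v)) b" if v: "v \<in> {d<..\<tau> d}" for v
  proof (rule Cons.IH[OF s])
    have "\<sigma> v \<in> {d<..\<tau>' d}" using sub v by blast
    then have w: "d < \<sigma> v" "\<sigma> v \<le> \<tau>' d" by auto
    fix x assume x: "d \<le> x"
    have pred: "d \<le> x - 1" "x - 1 \<le> x" if "x \<noteq> d" using that x by linarith+
    show "upd213 \<tau> v x \<le> upd123 \<tau>' (\<sigma> v) x"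
    proof (cases "v < \<tau> d")
      case True
      then have \<sigma>: "\<sigma> v = Suc v" by (simp add: \<sigma>_def)
      show ?thesis
      proof (cases "x < v")
        case True
        then show ?thesis by (simp add: upd213_def upd123_def \<sigma>)
      next
        case False
        then have "x \<noteq> d" using v by auto
        then have "\<tau> (x - 1) \<le> \<tau>' (x - 1)" "\<tau>' (x - 1) \<le> \<tau>' x"
          using le mono pred by blast+
        then show ?thesis using False by (auto simp: upd213_def upd123_def \<sigma>)
      qed
    next
      case False
      then have vd: "v = \<tau> d" "\<sigma> v = Suc d" "d < \<tau> d" using v by (auto simp: \<sigma>_def)
      show ?thesis
      proof (cases "x = d")
        case True
        then show ?thesis using vd le[of d] by (simp add: upd213_def upd123_def)
      next
        case False
        then have "\<tau> (x - 1) \<le> \<tau>' (x - 1)" "\<tau>' d \<le> \<tau>' (x - 1)" "\<tau> d \<le> \<tau>' d"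
          using le mono pred by blast+
        then show ?thesis using False vd x by (simp add: upd213_def upd123_def)
      qed
    qed
    \<comment> \<open>This joins the constant piece \<open>\<sigma> v\<close> of the update
      monotonically to the pieces taken from \<open>\<tau>'\<close>.\<close>
    have A: "\<sigma> v \<le> \<tau>' z" if "d \<le> z" for z using w(2) mono[of d z] that by linarith
    show "x < upd123 \<tau>' (\<sigma> v) x"
    proof (cases "x = d")
      case True
      then show ?thesis using infl[of d] w by (auto simp: upd123_def)
    next
      case False
      then have "x - 1 < \<tau>' (x - 1)" using infl pred by blast
      then have "x < Suc (\<tau>' (x - 1))" by linarith
      then show ?thesis using infl[OF x] by (auto simp: upd123_def)
    qed
    fix y assume y: "x \<le> y"
    then have dy: "d \<le> y" using x by simp
    consider "Suc y \<le> \<sigma> v" | "\<sigma> v < Suc y" "Suc x < \<sigma> v" | "\<sigma> v < Suc y" "\<sigma> v \<le> Suc x" by linarith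
    then show "upd123 \<tau>' (\<sigma> v) x \<le> upd123 \<tau>' (\<sigma> v) y"
    proof cases
      case 1
      then show ?thesis using y A[OF dy] mono[OF x y] by (auto simp: upd123_def)
    next
      case 2
      then have "\<sigma> v \<le> \<tau>' (y - 1)" using w by (intro A) linarith
      then show ?thesis using 2 by (simp add: upd123_def)
    next
      case 3
      show ?thesis
      proof (cases "y = x")
        case False
        then have "\<tau>' x \<le> \<tau>' (y - 1)" using x y by (intro mono) linarith+
        moreover have "\<tau>' (x - 1) \<le> \<tau>' (y - 1)" if "Suc x \<noteq> \<sigma> v"
          using 3 that x y w by (intro mono) linarith+
        ultimately show ?thesis using 3 by (simp add: upd123_def)
      qed simp
    qed
  qed
  have "count213 \<tau> (d # b) \<le> (\<Sum>v\<in>{d<..\<tau> d}. count123 (upd123 \<tau>' (\<sigma> v)) b)"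
    unfolding count213.simps by (rule sum_mono) (rule step)
  also have "\<dots> = (\<Sum>w\<in>\<sigma> ` {d<..\<tau> d}. count123 (upd123 \<tau>' w) b)"
    unfolding sum.reindex[OF inj] comp_def ..
  also have "\<dots> \<le> count123 \<tau>' (d # b)"
    unfolding count123.simps by (rule sum_mono2) (use sub in auto)
  finally show ?case .
qed

lemma card_avoid_lists_213_le_123:
  assumes b: "sorted b" "\<forall>i<length b. b ! i \<le> i"
  shows "card (avoid_lists pat213 b) \<le> card (avoid_lists pat123 b)"
  unfolding card_avoid_lists[OF b] by (rule count213_le_count123[of 0]) (use b(1) in auto)

section \<open>Ballot words and walks in Young's lattice\<close>

text \<open>Words with \<^term>\<open>True\<close> as up step and \<^term>\<open>False\<close> as down step. \<open>behead\<close> is the effect of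
  jeu de taquin on the tableau when its least entry is removed, \<open>insert_down g\<close> that of row
  insertion of a new entry above the \<open>g\<close> smallest ones; flips happen at the first return to 0.\<close>

fun flip_return :: "nat \<Rightarrow> bool list \<Rightarrow> bool list" where
  "flip_return l [] = []"
| "flip_return l (True # P) = True # flip_return (Suc l) P"
| "flip_return l (False # P) = (if l = 1 then True # P else False # flip_return (l - 1) P)"

fun ballot :: "nat \<Rightarrow> bool list \<Rightarrow> bool" where
  "ballot l [] = True"
| "ballot l (True # P) = ballot (Suc l) P"
| "ballot l (False # P) = (0 < l \<and> ballot (l - 1) P)"

text \<open>The \<open>run P\<close> least entries are those that precede the first entry of the
  second column. Row insertion of a value with \<open>g\<close> smaller ones opens no third column
  exactly if \<open>g \<le> run P\<close>.\<close>

definition run :: "bool list \<Rightarrow> nat" where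
  "run P = length (takeWhile id P)"

definition behead :: "bool list \<Rightarrow> bool list" where
  "behead P = flip_return 1 (tl P)"

definition insert_down :: "nat \<Rightarrow> bool list \<Rightarrow> bool list" where
  "insert_down g P = (if g = 0 then True # P else take g P @ False # flip_return g (drop g P))"

abbreviation ups :: "bool list \<Rightarrow> nat" where "ups P \<equiv> count_list P True"
abbreviation downs :: "bool list \<Rightarrow> nat" where "downs P \<equiv> count_list P False"

lemma bool_list_cases:
  obtains "P = []" | Q where "P = True # Q" | Q where "P = False # Q"
  by (cases P) auto

lemma count_list_replicate [simp]: "count_list (replicate n x) y = (if x = y then n else 0)"
  by (induction n) auto

lemma run_simps [simp]: "run [] = 0" "run (True # P) = Suc (run P)" "run (False # P) = 0"
  by (auto simp: run_def)

lemma run_replicate [simp]: "run (replicate g True @ P) = g + run P"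
  by (induction g) auto

lemma run_split: "g \<le> run P \<Longrightarrow> \<exists>Q. P = replicate g True @ Q"
proof (induction g arbitrary: P)
  case (Suc g)
  then obtain P' where P: "P = True # P'" by (cases P rule: bool_list_cases) auto
  then show ?case using Suc by auto
qed simp

lemma flip_return_replicate [simp]:
  "flip_return l (replicate g True @ P) = replicate g True @ flip_return (l + g) P"
  by (induction g arbitrary: l) auto

lemma insert_down_replicate:
  "insert_down g (replicate g True @ P) =
     (if g = 0 then True # P else replicate g True @ False # flip_return g P)"
  by (simp add: insert_down_def)

section \<open>Flips, insertion and deletion on ballot words\<close>

lemma length_flip_return [simp]: "length (flip_return l P) = length P"
  by (induction l P rule: flip_return.induct) auto

lemma length_behead [simp]: "length (behead P) = length P - 1"
  by (simp add: behead_def)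

lemma length_insert_down [simp]: "g \<le> run P \<Longrightarrow> length (insert_down g P) = Suc (length P)"
  using run_split[of g P] by (auto simp: insert_down_replicate)

lemma ballot_mono: "ballot l P \<Longrightarrow> l \<le> m \<Longrightarrow> ballot m P"
proof (induction l P arbitrary: m rule: ballot.induct)
  case (3 l P)
  have "ballot (m - 1) P" by (rule "3.IH") (use "3.prems" in auto)
  then show ?case using 3 by simp
qed auto

text \<open>Before its first return the path from \<open>l\<close> is positive, so starting one
  lower does no harm; the flip lifts everything behind it by two.\<close>

lemma ballot_flip_return: "1 \<le> l \<Longrightarrow> ballot l P \<Longrightarrow> ballot (l - 1) (flip_return l P)"
proof (induction l P rule: flip_return.induct)
  case (2 l P)
  then show ?case by simp
next
  case (3 l P)
  show ?case
  proof (cases "l = 1")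
    case True
    then show ?thesis using 3 by (auto intro: ballot_mono)
  next
    case False
    then show ?thesis using 3 by simp
  qed
qed simp

lemma flip_return_ballot: "ballot (l - 1) P \<Longrightarrow> 1 \<le> l \<Longrightarrow> flip_return l P = P"
proof (induction l P rule: flip_return.induct)
  case (2 l P)
  then show ?case by simp
next
  case (3 l P)
  then show ?case by (cases "l = 1") auto
qed simp

lemma count_flip_return:
  "(ups (flip_return l P) = ups P \<and> downs (flip_return l P) = downs P \<and> flip_return l P = P) \<or>
   (ups (flip_return l P) = Suc (ups P) \<and> Suc (downs (flip_return l P)) = downs P)"
  by (induction l P rule: flip_return.induct) auto

text \<open>Just before a flip the path from \<open>l\<close> stands at height 1, so the path from
  \<open>l - 2\<close> would stand at -1.\<close>

lemma no_flip: "2 \<le> l \<Longrightarrow> ballot (l - 2) (flip_return l P) \<Longrightarrow> flip_return l P = P"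
proof (induction l P rule: flip_return.induct)
  case (2 l P)
  then have "Suc l - 2 = Suc (l - 2)" by simp
  then show ?case using 2 by simp
next
  case (3 l P)
  then have "l \<noteq> 1" "l \<noteq> 2" by auto
  then show ?case using 3 by (auto simp: numeral_2_eq_2)
qed simp

text \<open>Flipping is reversible because two different flip positions would leave one of the two words
  below the axis between them.\<close>

lemma flip_return_inj:
  "\<lbrakk>1 \<le> l; ballot l P; ballot l P'; downs P = downs P'; flip_return l P = flip_return l P'\<rbrakk> \<Longrightarrow> P = P'"
proof (induction P arbitrary: l P')
  case Nil
  then have "length P' = 0" by (metis length_flip_return list.size(3))
  then show ?case by simp
next
  case (Cons x P)
  then obtain x' Q where P': "P' = x' # Q"
    by (metis length_flip_return length_0_conv list.distinct(1) neq_Nil_conv)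
  \<comment> \<open>Here \<open>l = 1\<close> and the first word is flipped at once. Its tail
    \<open>flip_return 2 B\<close> stays nonnegative from 0, so by \<open>no_flip\<close> the second
    word is not flipped at all, and the numbers of down steps differ.\<close>
  have False_True: False if l: "1 \<le> l" "ballot l (False # A)" "downs (False # A) = downs (True # B)"
    "flip_return l (False # A) = flip_return l (True # B)" for A B
  proof -
    have l1: "l = 1" using l(4) by (auto split: if_splits)
    then have A: "A = flip_return 2 B" "ballot 0 A" using l by (auto simp: numeral_2_eq_2)
    then have "flip_return 2 B = B" using no_flip[of 2 B] by simp
    then show False using l(3) A by simp
  qed
  show ?case
  proof (cases x; cases x')
    assume "x" "x'"
    then show ?thesis using Cons.IH[of "Suc l" Q] Cons.prems P' by simp
  next
    assume "\<not> x" "\<not> x'"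
    then show ?thesis using Cons.IH[of "l - 1" Q] Cons.prems P' by (cases "l = 1") auto
  next
    assume "x" "\<not> x'"
    then show ?thesis using False_True[of Q P] Cons.prems P' by simp
  next
    assume "\<not> x" "x'"
    then show ?thesis using False_True[of P Q] Cons.prems P' by simp
  qed
qed

lemma behead_True: "ballot 0 P \<Longrightarrow> behead (True # P) = P"
  by (simp add: behead_def flip_return_ballot)

text \<open>Deletion of the least entry commutes with insertion unless that entry is the inserted
  one; merely the number of smaller entries drops by one. The remaining case is
  \<open>behead_True\<close>.\<close>

lemma behead_insert_down:
  assumes "Suc g \<le> run P"
  shows "behead (insert_down (Suc g) P) = insert_down g (behead P)"
proof -
  obtain Q where P: "P = replicate (Suc g) True @ Q" using run_split[OF assms] by blast
  have "insert_down g (behead P) = insert_down g (replicate g True @ flip_return (Suc g) Q)"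
    by (simp add: P behead_def)
  then show ?thesis unfolding insert_down_replicate P
    by (cases g) (auto simp: behead_def insert_down_def)
qed

lemma ballot_replicate: "ballot l (replicate g True @ P) \<longleftrightarrow> ballot (l + g) P"
  by (induction g arbitrary: l) auto

lemma ballot_insert_down:
  assumes "ballot 0 P" "g \<le> run P" shows "ballot 0 (insert_down g P)"
proof -
  obtain Q where P: "P = replicate g True @ Q" using run_split[OF assms(2)] by blast
  then have "ballot g Q" using assms(1) by (simp add: ballot_replicate)
  then show ?thesis using ballot_flip_return[of g Q] ballot_mono[of 0 Q 1]
    unfolding P insert_down_replicate by (auto simp: ballot_replicate)
qed

lemma ballot_behead: "ballot 0 P \<Longrightarrow> ballot 0 (behead P)"
  using ballot_flip_return[of 1 "tl P"] by (cases P rule: bool_list_cases) (auto simp: behead_def)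

lemma run_behead: "run P - 1 \<le> run (behead P)"
proof (cases "run P")
  case (Suc g)
  then obtain Q where P: "P = replicate (Suc g) True @ Q" using run_split[of "Suc g" P] by auto
  then have "behead P = replicate g True @ flip_return (Suc g) Q" by (simp add: behead_def)
  then show ?thesis using Suc by simp
qed simp

lemma run_insert_down: "g \<le> run P \<Longrightarrow> 1 \<le> g \<Longrightarrow> run (insert_down g P) = g"
  using run_split[of g P] by (auto simp: insert_down_replicate)

section \<open>Two-column standard tableaux of a given shape\<close>

text \<open>Standard tableaux with column lengths \<open>a\<close> and \<open>b\<close>: the
  \<open>i\<close>-th letter tells the column of the entry \<open>i\<close>, with
  \<open>True\<close> for the first column.\<close>

definition syt :: "nat \<Rightarrow> nat \<Rightarrow> bool list set" where
  "syt a b = {P. ballot 0 P \<and> ups P = a \<and> downs P = b}"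

lemma ups_downs: "ups P + downs P = length P"
  by (induction P) auto

lemma finite_syt: "finite (syt a b)"
proof (rule finite_subset)
  show "syt a b \<subseteq> {P. set P \<subseteq> UNIV \<and> length P = a + b}"
    using ups_downs by (auto simp: syt_def)
  show "finite {P. set P \<subseteq> (UNIV :: bool set) \<and> length P = a + b}"
    by (rule finite_lists_length_eq) simp
qed

lemma ballot_downs: "ballot l P \<Longrightarrow> downs P \<le> l + ups P"
  by (induction l P rule: ballot.induct) auto

lemma syt_empty: "a < b \<Longrightarrow> syt a b = {}"
  using ballot_downs[of 0] by (fastforce simp: syt_def)

text \<open>\<open>P\<close> is the tableau of the live values. In the second argument
  \<open>True\<close> stands for a new column, which inserts a value, and \<open>False\<close> for
  the loss of the lowest row, which deletes the least live value.\<close>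

fun count_words :: "bool list \<Rightarrow> bool list \<Rightarrow> nat" where
  "count_words P [] = (if P = [] then 1 else 0)"
| "count_words P (True # W) = (\<Sum>g\<le>run P. count_words (insert_down g P) W)"
| "count_words P (False # W) = (if P = [] then 0 else count_words (behead P) W)"

text \<open>Walks on partitions with column lengths \<open>a \<ge> b\<close>: an up step adds a box, a down step removes one.\<close>

fun count_walks :: "nat \<Rightarrow> nat \<Rightarrow> bool list \<Rightarrow> nat" where
  "count_walks a b [] = (if a = 0 \<and> b = 0 then 1 else 0)"
| "count_walks a b (True # W) = count_walks (Suc a) b W + (if b < a then count_walks a (Suc b) W else 0)"
| "count_walks a b (False # W) = (if b < a then count_walks (a - 1) b W else 0) +
     (if 0 < b then count_walks a (b - 1) W else 0)"

text \<open>For \<open>g \<ge> 1\<close> the run of the result reveals \<open>g\<close>, and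
  \<open>flip_return_inj\<close> undoes the flip. An insertion with \<open>g = 0\<close> can agree
  with one with \<open>g \<ge> 1\<close> only if the latter flips nothing, and then the two tableaux
  had different column lengths.\<close>

lemma insert_down_inj:
  "inj_on (\<lambda>(P, g). insert_down g P) (SIGMA P:syt a b. {..run P})"
proof -
  have 0: False if P: "P \<in> syt a b" and P': "P' \<in> syt a b" "g \<le> run P'" "1 \<le> g"
    and eq: "True # P = insert_down g P'" for P P' g
  proof -
    obtain Q where Q: "P' = replicate g True @ Q" using run_split[OF P'(2)] by blast
    have e: "True # P = replicate g True @ False # flip_return g Q"
      using eq P'(3) unfolding Q by (simp add: insert_down_replicate)
    obtain h where g: "g = Suc h" using P'(3) by (cases g) auto
    then have e': "P = replicate h True @ False # flip_return g Q" using e by simp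
    have bal: "0 < h" "ballot (h - 1) (flip_return g Q)"
      using P unfolding e' by (auto simp: syt_def ballot_replicate)
    then have "flip_return g Q = Q" using no_flip[of g Q] g by (simp add: numeral_2_eq_2)
    then have "ups P = h + ups Q" "downs P = Suc (downs Q)" "ups P' = g + ups Q"
      unfolding e' Q by (auto simp: count_list_append)
    then show False using P P' g by (auto simp: syt_def)
  qed
  have 1: "P = P' \<and> g = g'" if P: "P \<in> syt a b" "g \<le> run P" "1 \<le> g"
    and P': "P' \<in> syt a b" "g' \<le> run P'" "1 \<le> g'"
    and eq: "insert_down g P = insert_down g' P'" for P P' g g'
  proof -
    have g: "g = g'" using run_insert_down P P' eq by metis
    obtain Q where Q: "P = replicate g True @ Q" using run_split[OF P(2)] by blast
    obtain Q' where Q': "P' = replicate g True @ Q'" using run_split[OF P'(2)] g by blast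
    have "flip_return g Q = flip_return g Q'"
      using eq P(3) unfolding Q Q' g[symmetric] by (simp add: insert_down_replicate)
    moreover have "ballot g Q" "ballot g Q'" "downs Q = downs Q'"
      using P(1) P'(1) unfolding Q Q' by (auto simp: syt_def ballot_replicate count_list_append)
    ultimately have "Q = Q'" using flip_return_inj P(3) by blast
    then show ?thesis using Q Q' g by simp
  qed
  show ?thesis
  proof (rule inj_onI, clarify)
    fix P g P' g'
    assume h: "P \<in> syt a b" "g \<le> run P" "P' \<in> syt a b" "g' \<le> run P'"
      "insert_down g P = insert_down g' P'"
    show "P = P' \<and> g = g'"
    proof (cases "g = 0"; cases "g' = 0")
      assume "g = 0" "g' = 0"
      then show ?thesis using h by (simp add: insert_down_def)
    next
      assume "g = 0" "g' \<noteq> 0"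
      then show ?thesis using h 0[of P P' g'] by (simp add: insert_down_def)
    next
      assume "g \<noteq> 0" "g' = 0"
      then show ?thesis using h 0[of P' P g] by (simp add: insert_down_def)
    next
      assume "g \<noteq> 0" "g' \<noteq> 0"
      then show ?thesis using h 1[of P g P' g'] by simp
    qed
  qed
qed

lemma insert_down_syt:
  assumes "P \<in> syt a b" "g \<le> run P"
  shows "insert_down g P \<in> syt (Suc a) b \<union> syt a (Suc b)"
proof -
  obtain Q where Q: "P = replicate g True @ Q" using run_split[OF assms(2)] by blast
  have "ballot 0 (insert_down g P)" using assms ballot_insert_down by (auto simp: syt_def)
  moreover have "ups P = a" "downs P = b" using assms by (auto simp: syt_def)
  then have "(ups (insert_down g P) = Suc a \<and> downs (insert_down g P) = b) \<or>
      (ups (insert_down g P) = a \<and> downs (insert_down g P) = Suc b)"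
    using count_flip_return[of g Q] unfolding Q insert_down_replicate
    by (auto simp: count_list_append)
  ultimately show ?thesis by (auto simp: syt_def)
qed

lemma behead_inj: "inj_on behead (syt a b)"
proof (rule inj_onI)
  fix P P' assume h: "P \<in> syt a b" "P' \<in> syt a b" "behead P = behead P'"
  show "P = P'"
  proof (cases "P = []")
    case True
    then have "a = 0" "b = 0" using h by (auto simp: syt_def)
    then have "length P' = 0" using h(2) ups_downs[of P'] by (simp add: syt_def)
    then show ?thesis using True by simp
  next
    case False
    have "P' \<noteq> []" using h False ups_downs[of P] by (auto simp: syt_def)
    then obtain Q Q' where Q: "P = True # Q" "P' = True # Q'"
      using h False by (cases P rule: bool_list_cases; cases P' rule: bool_list_cases) (auto simp: syt_def)
    then show ?thesis using h flip_return_inj[of 1 Q Q'] by (auto simp: syt_def behead_def)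
  qed
qed

lemma behead_syt:
  assumes "P \<in> syt a b" "P \<noteq> []"
  shows "behead P \<in> (if b < a then syt (a - 1) b else {}) \<union> (if 0 < b then syt a (b - 1) else {})"
proof -
  obtain Q where Q: "P = True # Q" using assms by (cases P rule: bool_list_cases) (auto simp: syt_def)
  have bal: "ballot 0 (behead P)" using assms ballot_behead by (auto simp: syt_def)
  have ab: "a = Suc (ups Q)" "b = downs Q" using assms Q by (auto simp: syt_def)
  have "downs (behead P) \<le> ups (behead P)" using ballot_downs[OF bal] by simp
  then show ?thesis using count_flip_return[of 1 Q] bal ab by (auto simp: syt_def Q behead_def)
qed

text \<open>Summation over one shape forgets the tableau: an up step maps the pairs of a tableau and
  an insertion position injectively to tableaux with one box more, a down step maps tableaux
  injectively to those with one box less.\<close>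

lemma sum_count_words_le: "(\<Sum>P\<in>syt a b. count_words P W) \<le> count_walks a b W"
proof (induction W arbitrary: a b)
  case Nil
  have "P = [] \<Longrightarrow> P \<in> syt a b \<Longrightarrow> a = 0 \<and> b = 0" for P by (auto simp: syt_def)
  then have "(\<Sum>P\<in>syt a b. count_words P []) \<le> (\<Sum>P\<in>syt a b. if P = [] then (if a = 0 \<and> b = 0 then 1 else 0) else 0)"
    by (intro sum_mono) auto
  also have "\<dots> \<le> count_walks a b []" by (simp add: finite_syt)
  finally show ?case .
next
  case (Cons x W)
  show ?case
  proof (cases x)
    case True
    have "(\<Sum>P\<in>syt a b. count_words P (x # W)) =
        (\<Sum>(P, g)\<in>(SIGMA P:syt a b. {..run P}). count_words (insert_down g P) W)"
      using True by (simp add: sum.Sigma finite_syt)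
    also have "\<dots> = (\<Sum>P\<in>(\<lambda>(P, g). insert_down g P) ` (SIGMA P:syt a b. {..run P}). count_words P W)"
      by (subst sum.reindex[OF insert_down_inj]) (simp add: case_prod_beta comp_def)
    also have "\<dots> \<le> (\<Sum>P\<in>syt (Suc a) b \<union> syt a (Suc b). count_words P W)"
      by (rule sum_mono2) (use insert_down_syt in \<open>auto simp: finite_syt\<close>)
    also have "\<dots> = (\<Sum>P\<in>syt (Suc a) b. count_words P W) + (\<Sum>P\<in>syt a (Suc b). count_words P W)"
      by (rule sum.union_disjoint[OF finite_syt finite_syt]) (auto simp: syt_def)
    also have "\<dots> \<le> count_walks a b (x # W)"
      using Cons.IH[of "Suc a" b] Cons.IH[of a "Suc b"] syt_empty[of a "Suc b"] True by (cases "b < a") auto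
    finally show ?thesis .
  next
    case False
    let ?A = "if b < a then syt (a - 1) b else {}" and ?B = "if 0 < b then syt a (b - 1) else {}"
    have "(\<Sum>P\<in>syt a b. count_words P (x # W)) = (\<Sum>P\<in>syt a b - {[]}. count_words (behead P) W)"
      using False by (intro sum.mono_neutral_cong_right) (auto simp: finite_syt)
    also have "\<dots> = (\<Sum>P\<in>behead ` (syt a b - {[]}). count_words P W)"
      by (subst sum.reindex) (auto intro: inj_on_subset[OF behead_inj])
    also have "\<dots> \<le> (\<Sum>P\<in>?A \<union> ?B. count_words P W)"
    proof (rule sum_mono2)
      show "finite (?A \<union> ?B)" by (auto simp: finite_syt)
      show "behead ` (syt a b - {[]}) \<subseteq> ?A \<union> ?B" using behead_syt by blast
    qed simp
    also have "\<dots> = (\<Sum>P\<in>?A. count_words P W) + (\<Sum>P\<in>?B. count_words P W)"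
    proof (rule sum.union_disjoint)
      show "finite ?A" "finite ?B" by (auto simp: finite_syt)
      show "?A \<inter> ?B = {}" by (auto simp: syt_def)
    qed
    also have "\<dots> \<le> count_walks a b (x # W)"
      using Cons.IH[of "a - 1" b] Cons.IH[of a "b - 1"] False by auto
    finally show ?thesis .
  qed
qed

text \<open>The \<open>321\<close> process seen along the boundary: \<open>m\<close> values are live, the top \<open>h\<close> of which exceed every
  inversion bottom.\<close>

fun count_heights :: "nat \<Rightarrow> nat \<Rightarrow> bool list \<Rightarrow> nat" where
  "count_heights m h [] = (if m = 0 then 1 else 0)"
| "count_heights m h (True # W) = (\<Sum>h'\<in>{1..Suc h}. count_heights (Suc m) h' W)"
| "count_heights m h (False # W) = (if m = 0 then 0 else count_heights (m - 1) (min h (m - 1)) W)"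

section \<open>Exchanging neighbouring steps of the boundary\<close>

text \<open>The relation \<open>U D - D U = 1\<close> of Young's lattice, restricted to two columns:
  the box that would open a third column is lost, and it exists exactly if \<open>b > 0\<close>,
  which then cancels the 1.\<close>

lemma count_walks_swap:
  "b \<le> a \<Longrightarrow> count_walks a b (True # False # W) =
    count_walks a b (False # True # W) + (if b = 0 then count_walks a b W else 0)"
  by (cases a; cases b) auto

text \<open>If \<open>h < m\<close>, every new height is at most \<open>m\<close>, so the deletion
  does not cut it and both orders agree. If \<open>h = m\<close>, a new maximum gives height
  \<open>m + 1\<close>, which the deletion cuts to \<open>m\<close>: one additional summand.\<close>

lemma count_heights_swap:
  assumes "h \<le> m"
  shows "count_heights m h (True # False # W) =
    count_heights m h (False # True # W) + (if h = m then count_heights m h W else 0)"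
proof (cases "h = m")
  case True
  have "count_heights m h (True # False # W) = (\<Sum>h'\<in>insert (Suc m) {1..m}. count_heights m (min h' m) W)"
    using True by (simp add: atLeastAtMostSuc_conv)
  also have "\<dots> = count_heights m m W + (\<Sum>h'\<in>{1..m}. count_heights m (min h' m) W)"
    by (subst sum.insert) auto
  also have "(\<Sum>h'\<in>{1..m}. count_heights m (min h' m) W) = (\<Sum>h'\<in>{1..m}. count_heights m h' W)"
    by (rule sum.cong) auto
  finally show ?thesis using True by (cases m) auto
next
  case False
  then have "h < m" using assms by simp
  have "count_heights m h (True # False # W) = (\<Sum>h'\<in>{1..Suc h}. count_heights m (min h' m) W)"
    by simp
  also have "\<dots> = (\<Sum>h'\<in>{1..Suc h}. count_heights m h' W)"
    using \<open>h < m\<close> by (intro sum.cong) auto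
  finally show ?thesis using \<open>h < m\<close> by (cases m) (auto simp: min_def)
qed

text \<open>Moving the down step to the front leaves a remainder only while the second column is
  empty, that is, after \<open>i\<close> additions to the first column; the exchanged pair of steps
  is gone from the remaining word.\<close>

lemma count_walks_shift:
  "b \<le> a \<Longrightarrow> count_walks a b (replicate r True @ False # W) =
    count_walks a b (False # replicate r True @ W) +
    (if b = 0 then \<Sum>i<r. count_walks (a + i) 0 (replicate (r - 1 - i) True @ W) else 0)"
proof (induction r arbitrary: a b)
  case (Suc r)
  have "count_walks a b (replicate (Suc r) True @ False # W) =
      count_walks a b (True # False # replicate r True @ W) +
      (if b = 0 then \<Sum>i<r. count_walks (Suc a + i) 0 (replicate (r - 1 - i) True @ W) else 0)"
    using Suc.IH[of b "Suc a"] Suc.IH[of "Suc b" a] Suc.prems by auto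
  also have "\<dots> = count_walks a b (False # replicate (Suc r) True @ W) +
      (if b = 0 then count_walks a 0 (replicate r True @ W) +
        (\<Sum>i<r. count_walks (Suc a + i) 0 (replicate (r - 1 - i) True @ W)) else 0)"
    using count_walks_swap[OF Suc.prems] by simp
  also have "count_walks a 0 (replicate r True @ W) +
        (\<Sum>i<r. count_walks (Suc a + i) 0 (replicate (r - 1 - i) True @ W)) =
      (\<Sum>i<Suc r. count_walks (a + i) 0 (replicate (Suc r - 1 - i) True @ W))"
    by (subst sum.lessThan_Suc_shift) simp
  finally show ?case .
qed simp

text \<open>Here remainders arise only at full height, which survives an up step just when a new
  maximum is appended; so they start at \<open>m + i\<close> in both arguments, in parallel to
  \<open>count_walks_shift\<close>.\<close>

lemma count_heights_shift:
  "h \<le> m \<Longrightarrow> count_heights m h (replicate r True @ False # W) =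
    count_heights m h (False # replicate r True @ W) +
    (if h = m then \<Sum>i<r. count_heights (m + i) (m + i) (replicate (r - 1 - i) True @ W) else 0)"
proof (induction r arbitrary: m h)
  case (Suc r)
  let ?S = "\<Sum>i<r. count_heights (Suc m + i) (Suc m + i) (replicate (r - 1 - i) True @ W)"
  have "count_heights m h (replicate (Suc r) True @ False # W) =
      (\<Sum>h'\<in>{1..Suc h}. count_heights (Suc m) h' (replicate r True @ False # W))" by simp
  also have "\<dots> = (\<Sum>h'\<in>{1..Suc h}. count_heights (Suc m) h' (False # replicate r True @ W) +
      (if h' = Suc m then ?S else 0))"
    using Suc.prems by (intro sum.cong refl Suc.IH) auto
  also have "\<dots> = count_heights m h (True # False # replicate r True @ W) +
      (\<Sum>h'\<in>{1..Suc h}. if h' = Suc m then ?S else 0)"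
    by (simp only: sum.distrib count_heights.simps(2))
  also have "(\<Sum>h'\<in>{1..Suc h}. if h' = Suc m then ?S else 0) = (if h = m then ?S else 0)"
    using Suc.prems by (subst sum.delta) auto
  also have "count_heights m h (True # False # replicate r True @ W) + (if h = m then ?S else 0) =
      count_heights m h (False # replicate (Suc r) True @ W) +
      (if h = m then count_heights m m (replicate r True @ W) + ?S else 0)"
    using count_heights_swap[OF Suc.prems] by simp
  also have "count_heights m m (replicate r True @ W) + ?S =
      (\<Sum>i<Suc r. count_heights (m + i) (m + i) (replicate (Suc r - 1 - i) True @ W))"
    by (subst sum.lessThan_Suc_shift) simp
  finally show ?case .
qed simp

lemma count_only_ups:
  "count_walks a b (replicate r True) = (if a = 0 \<and> b = 0 \<and> r = 0 then 1 else 0)"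
  "count_heights m h (replicate r True) = (if m = 0 \<and> r = 0 then 1 else 0)"
  by (induction r arbitrary: a b m h) auto

lemma first_down: "(\<exists>r V. W = replicate r True @ False # V) \<or> (\<exists>r. W = replicate r True)"
proof (induction W)
  case (Cons x W)
  show ?case
  proof (cases x)
    case True
    have "x # replicate r True = replicate (Suc r) True" for r using True by simp
    then show ?thesis using Cons.IH by (metis append_Cons)
  next
    case False
    then have "x # W = replicate 0 True @ False # W" by simp
    then show ?thesis by blast
  qed
qed auto

text \<open>The states \<open>(m, 0)\<close> and \<open>(m, m)\<close> correspond and are closed
  under the shift recursion: the leading down step leads to \<open>(m - 1, 0)\<close> and
  \<open>(m - 1, m - 1)\<close>, the remainders to \<open>(m + i, 0)\<close> and
  \<open>(m + i, m + i)\<close>, always with a shorter word. Words of up steps only are the base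
  case.\<close>

lemma count_walks_eq_count_heights: "count_walks m 0 W = count_heights m m W"
proof (induction W arbitrary: m rule: length_induct)
  case (1 W)
  consider r V where "W = replicate r True @ False # V" | r where "W = replicate r True"
    using first_down[of W] by blast
  then show ?case
  proof cases
    case (1 r V)
    have IH: "count_walks m' 0 V' = count_heights m' m' V'" if "length V' < length W" for m' V'
      using "1.IH" that by blast
    have "count_walks m 0 (False # replicate r True @ V) = count_heights m m (False # replicate r True @ V)"
      using IH[of "replicate r True @ V" "m - 1"] 1 by auto
    moreover have "(\<Sum>i<r. count_walks (m + i) 0 (replicate (r - 1 - i) True @ V)) =
        (\<Sum>i<r. count_heights (m + i) (m + i) (replicate (r - 1 - i) True @ V))"
      using 1 by (intro sum.cong refl IH) auto
    ultimately show ?thesis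
        unfolding 1 count_walks_shift[OF le0] count_heights_shift[OF order_refl]
      by (simp only: simp_thms if_True)
  next
    case (2 r)
    show ?thesis unfolding 2 count_only_ups by (simp only: simp_thms if_True)
  qed
qed

section \<open>The processes read along the boundary of the diagram\<close>

text \<open>\<open>c\<close> is the current bound and \<open>n\<close> the number of columns so far.
  The trailing \<open>False\<close> steps remove the rows that are still live, so that every
  complete walk ends in the empty state.\<close>

fun boundary_word :: "nat \<Rightarrow> nat list \<Rightarrow> nat \<Rightarrow> bool list" where
  "boundary_word c [] n = replicate (n - c) False"
| "boundary_word c (d # b) n = replicate (d - c) False @ True # boundary_word d b (Suc n)"

lemma ballot_behead_pow: "ballot 0 P \<Longrightarrow> ballot 0 ((behead ^^ k) P)"
  by (induction k) (auto intro: ballot_behead)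

lemma length_behead_pow: "length ((behead ^^ k) P) = length P - k"
  by (induction k) auto

lemma run_behead_pow: "run P - k \<le> run ((behead ^^ k) P)"
proof (induction k)
  case (Suc k)
  then show ?case using run_behead[of "(behead ^^ k) P"] by simp
qed simp

text \<open>The new entry has \<open>g\<close> smaller ones: the first \<open>g\<close> deletions
  commute with the insertion, and the next one removes the new entry itself.\<close>

lemma behead_pow_insert_down:
  assumes "ballot 0 P" "g \<le> run P"
  shows "(behead ^^ k) (insert_down g P) =
    (if k \<le> g then insert_down (g - k) ((behead ^^ k) P) else (behead ^^ (k - 1)) P)"
proof (induction k)
  case (Suc k)
  consider "k < g" | "k = g" | "g < k" by linarith
  then show ?case
  proof cases
    case 1
    then obtain h where h: "g - k = Suc h" by (metis Suc_diff_Suc)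
    then have "Suc h \<le> run ((behead ^^ k) P)" using run_behead_pow[of P k] assms(2) by linarith
    from behead_insert_down[OF this] show ?thesis using Suc 1 h by (simp add: diff_Suc)
  next
    case 2
    then show ?thesis using Suc behead_True[OF ballot_behead_pow[OF assms(1), of g]]
      by (simp add: insert_down_def)
  next
    case 3
    then obtain j where "k = Suc j" by (cases k) auto
    then show ?thesis using Suc 3 by simp
  qed
qed simp

lemma count_words_downs:
  "k \<le> length P \<Longrightarrow> count_words P (replicate k False @ W) = count_words ((behead ^^ k) P) W"
proof (induction k arbitrary: P)
  case (Suc k)
  then have "P \<noteq> []" by auto
  then show ?case using Suc by (simp add: funpow_swap1)
qed simp

text \<open>For the bound \<open>c + k\<close> only values above it count, and their tableau arises
  from \<open>P\<close> by deleting the \<open>k\<close> least entries. The next value may then have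
  at most \<open>run\<close> live ones below it, which is the invariant on
  \<open>\<tau>\<close>.\<close>

lemma count123_eq_count_words:
  "\<lbrakk>\<forall>k. \<tau> (c + k) = Suc (c + k + run ((behead ^^ k) P)); ballot 0 P; length P = n - c; c \<le> n;
    sorted (c # b); \<forall>i<length b. b ! i \<le> n + i\<rbrakk>
    \<Longrightarrow> count123 \<tau> b = count_words P (boundary_word c b n)"
proof (induction b arbitrary: \<tau> c P n)
  case Nil
  have "length ((behead ^^ (n - c)) P) = 0" using Nil by (simp add: length_behead_pow)
  then show ?case using Nil count_words_downs[of "n - c" P "[]"] by simp
next
  case (Cons d b)
  note \<tau> = Cons.prems(1)
  have d: "c \<le> d" "d \<le> n" and s: "sorted (d # b)" and bn: "\<forall>i<length b. b ! i \<le> Suc n + i"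
    using Cons.prems(5) Cons.prems(6)[rule_format, of 0] Cons.prems(6)[rule_format, of "Suc i" for i] by auto
  define P' where "P' = (behead ^^ (d - c)) P"
  have P': "ballot 0 P'" "length P' = n - d"
    using Cons.prems(2,3) d by (auto simp: P'_def ballot_behead_pow length_behead_pow)
  have \<tau>': "\<tau> (d + k) = Suc (d + k + run ((behead ^^ k) P'))" for k
  proof -
    have "(behead ^^ k) P' = (behead ^^ ((d - c) + k)) P"
      unfolding P'_def by (metis add.commute comp_apply funpow_add)
    moreover have "d + k = c + ((d - c) + k)" using d by simp
    ultimately show ?thesis using \<tau> by metis
  qed
  have \<tau>d: "\<tau> d = Suc (d + run P')" using \<tau>'[of 0] by simp
  have im: "{d<..\<tau> d} = (\<lambda>g. Suc (d + g)) ` {..run P'}"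
  proof (intro set_eqI iffI)
    fix v assume "v \<in> {d<..\<tau> d}"
    then have "v = Suc (d + (v - Suc d))" "v - Suc d \<in> {..run P'}" by (auto simp: \<tau>d)
    then show "v \<in> (\<lambda>g. Suc (d + g)) ` {..run P'}" by blast
  qed (auto simp: \<tau>d)
  have step: "count123 (upd123 \<tau> (Suc (d + g))) b =
      count_words (insert_down g P') (boundary_word d b (Suc n))" if g: "g \<le> run P'" for g
  proof (rule Cons.IH)
    show "\<forall>k. upd123 \<tau> (Suc (d + g)) (d + k) = Suc (d + k + run ((behead ^^ k) (insert_down g P')))"
    proof
      fix k
      \<comment> \<open>With \<open>x = d + k\<close> and \<open>v = Suc (d + g)\<close> these are
        the three cases of \<open>upd123\<close>.\<close>
      consider "k < g" | "k = g" | "g < k" by linarith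
      then show "upd123 \<tau> (Suc (d + g)) (d + k) = Suc (d + k + run ((behead ^^ k) (insert_down g P')))"
      proof cases
        case 1
        then have "run (insert_down (g - k) ((behead ^^ k) P')) = g - k"
          using run_behead_pow[of P' k] g by (intro run_insert_down) linarith+
        then show ?thesis using 1 behead_pow_insert_down[OF P'(1) g, of k] by (simp add: upd123_def)
      next
        case 2
        then show ?thesis using behead_pow_insert_down[OF P'(1) g, of k] \<tau>'[of k]
          by (simp add: upd123_def insert_down_def)
      next
        case 3
        then obtain j where "k = Suc j" by (cases k) auto
        then show ?thesis using 3 behead_pow_insert_down[OF P'(1) g, of k] \<tau>'[of j]
          by (simp add: upd123_def)
      qed
    qed
    show "ballot 0 (insert_down g P')" using ballot_insert_down P'(1) g by blast
    show "length (insert_down g P') = Suc n - d" using P' g d by simp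
  qed (use d s bn in auto)
  have "count123 \<tau> (d # b) = (\<Sum>g\<le>run P'. count123 (upd123 \<tau> (Suc (d + g))) b)"
    unfolding count123.simps im by (subst sum.reindex) (auto simp: inj_on_def)
  also have "\<dots> = count_words P' (True # boundary_word d b (Suc n))"
    unfolding count_words.simps by (rule sum.cong) (auto intro: step)
  also have "\<dots> = count_words P (boundary_word c (d # b) n)"
    using count_words_downs[of "d - c" P] Cons.prems(3) d by (simp add: P'_def del: count_words.simps)
  finally show ?case .
qed

lemma count_heights_downs:
  "k \<le> m \<Longrightarrow> h \<le> m \<Longrightarrow> count_heights m h (replicate k False @ W) = count_heights (m - k) (min h (m - k)) W"
proof (induction k arbitrary: m h)
  case (Suc k)
  have "min (min h (m - 1)) (m - 1 - k) = min h (m - 1 - k)" by auto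
  then show ?case using Suc.IH[of "m - 1" "min h (m - 1)"] Suc.prems by simp
qed simp

text \<open>Of \<open>n\<close> values \<open>n - c\<close> are live, and the top
  \<open>n - max \<eta> c\<close> of these exceed every inversion bottom.\<close>

lemma count321_eq_count_heights:
  "\<lbrakk>\<eta> \<le> n; c \<le> n; sorted (c # b); \<forall>i<length b. b ! i \<le> n + i\<rbrakk>
    \<Longrightarrow> count321 n \<eta> b = count_heights (n - c) (n - max \<eta> c) (boundary_word c b n)"
proof (induction b arbitrary: \<eta> c n)
  case Nil
  then show ?case using count_heights_downs[of "n - c" "n - c" "n - max \<eta> c" "[]"] by simp
next
  case (Cons d b)
  have d: "c \<le> d" "d \<le> n" and s: "sorted (d # b)" and bn: "\<forall>i<length b. b ! i \<le> Suc n + i"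
    using Cons.prems(3) Cons.prems(4)[rule_format, of 0] Cons.prems(4)[rule_format, of "Suc i" for i] by auto
  define f where "f h = count_heights (Suc n - d) h (boundary_word d b (Suc n))" for h
  define M where "M = max d \<eta>"
  have M: "d \<le> M" "M \<le> n" using d Cons.prems(1) by (auto simp: M_def)
  \<comment> \<open>An appended \<open>v\<close> has \<open>Suc n - v\<close> values above it; a new
    maximum instead enlarges the old top part of size \<open>n - M\<close> by one.\<close>
  have step: "count321 (Suc n) (if v = Suc n then \<eta> else v) b = f (if v = Suc n then Suc n - M else Suc n - v)"
    if v: "v \<in> {M<..Suc n}" for v
  proof -
    have "count321 (Suc n) (if v = Suc n then \<eta> else v) b =
        count_heights (Suc n - d) (Suc n - max (if v = Suc n then \<eta> else v) d) (boundary_word d b (Suc n))"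
      using Cons.prems(1) v d s bn by (intro Cons.IH) auto
    moreover have "max v d = v" using v M by auto
    ultimately show ?thesis by (simp add: f_def M_def max.commute)
  qed
  have "count321 n \<eta> (d # b) = (\<Sum>v\<in>{M<..Suc n}. f (if v = Suc n then Suc n - M else Suc n - v))"
    unfolding count321.simps M_def[symmetric] by (rule sum.cong[OF refl step])
  also have "{M<..Suc n} = insert (Suc n) {M<..n}" using M by auto
  also have "(\<Sum>v\<in>\<dots>. f (if v = Suc n then Suc n - M else Suc n - v)) =
      f (Suc n - M) + (\<Sum>v\<in>{M<..n}. f (Suc n - v))"
    by (subst sum.insert) (auto intro!: sum.cong)
  also have "(\<Sum>v\<in>{M<..n}. f (Suc n - v)) = (\<Sum>h\<in>{1..n - M}. f h)"
    by (rule sum.reindex_bij_witness[of _ "\<lambda>h. Suc n - h" "\<lambda>v. Suc n - v"]) auto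
  also have "f (Suc n - M) + (\<Sum>h\<in>{1..n - M}. f h) = (\<Sum>h\<in>{1..Suc (n - M)}. f h)"
    using M by (simp add: Suc_diff_le add.commute)
  also have "\<dots> = count_heights (n - d) (n - M) (True # boundary_word d b (Suc n))"
    using d by (simp add: f_def Suc_diff_le del: sum.cl_ivl_Suc)
  also have "\<dots> = count_heights (n - c) (n - max \<eta> c) (boundary_word c (d # b) n)"
  proof -
    have "min (n - max \<eta> c) (n - d) = n - M" "n - c - (d - c) = n - d" using d M_def by auto
    then show ?thesis using count_heights_downs[of "d - c" "n - c" "n - max \<eta> c"] d
      by (simp del: count_heights.simps)
  qed
  finally show ?case .
qed

lemma card_avoid_lists_123_le_321:
  assumes b: "sorted b" "\<forall>i<length b. b ! i \<le> i"
  shows "card (avoid_lists pat123 b) \<le> card (avoid_lists pat321 b)"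
proof -
  have behead_Nil: "(behead ^^ k) [] = []" for k by (induction k) (auto simp: behead_def)
  have s: "sorted (0 # b)" using b by simp
  have "count123 Suc b = count_words [] (boundary_word 0 b 0)"
    by (rule count123_eq_count_words) (use s b in \<open>auto simp: behead_Nil\<close>)
  also have "\<dots> \<le> (\<Sum>P\<in>syt 0 0. count_words P (boundary_word 0 b 0))"
  proof (rule member_le_sum)
    show "[] \<in> syt 0 0" by (simp add: syt_def)
  qed (auto simp: finite_syt)
  also have "\<dots> \<le> count_walks 0 0 (boundary_word 0 b 0)" by (rule sum_count_words_le)
  also have "\<dots> = count_heights 0 0 (boundary_word 0 b 0)" by (rule count_walks_eq_count_heights)
  also have "\<dots> = count321 0 0 b"
    using count321_eq_count_heights[of 0 0 0 b] s b by simp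
  finally show ?thesis unfolding card_avoid_lists[OF b] .
qed

section \<open>Left-to-right maxima\<close>

definition left_maxima :: "nat list \<Rightarrow> (nat \<times> nat) set" where
  "left_maxima p = {(i, p ! i) | i. i < length p \<and> (\<forall>j<i. p ! j < p ! i)}"

lemma finite_avoid_lists: "finite (avoid_lists Q b)"
proof (rule finite_subset)
  show "avoid_lists Q b \<subseteq> {p. set p \<subseteq> {1..length b} \<and> length p = length b}"
    by (auto simp: avoid_lists_def trans_lists_def)
  show "finite {p. set p \<subseteq> {1..length b} \<and> length p = length b}"
    by (rule finite_lists_length_eq) simp
qed

lemma swap_in_trans_lists:
  assumes b: "sorted b" and p: "p \<in> trans_lists b" and jk: "j < k" "k < length b"
    and le: "p ! j < p ! k" "b ! k < p ! j"
  shows "p[j := p ! k, k := p ! j] \<in> trans_lists b"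
proof -
  have len: "length p = length b" using p by (simp add: trans_lists_def)
  have "mset (p[j := p ! k, k := p ! j]) = mset p" using jk len by (intro mset_swap) auto
  then have "set (p[j := p ! k, k := p ! j]) = set p" "distinct (p[j := p ! k, k := p ! j]) = distinct p"
    by (metis set_mset_mset, metis mset_eq_imp_distinct_iff)
  moreover have "b ! i < p[j := p ! k, k := p ! j] ! i" if "i < length b" for i
  proof -
    have "b ! i < p ! i" "b ! j < p ! j" using p that jk by (auto simp: trans_lists_def)
    then show ?thesis using le jk len that by (cases "i = j"; cases "i = k") auto
  qed
  ultimately show ?thesis using p by (auto simp: trans_lists_def)
qed

text \<open>The swapped values stay to the right of \<open>p ! i\<close> and below it, so neither is
  ever a maximum; and a maximum to the right of \<open>i\<close> exceeds \<open>p ! i\<close>, hence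
  both of them.\<close>

lemma left_maxima_swap:
  assumes ijk: "i < j" "j < k" "k < length p" and le: "p ! j < p ! k" "p ! k < p ! i"
  shows "left_maxima (p[j := p ! k, k := p ! j]) = left_maxima p"
proof -
  define q where "q = p[j := p ! k, k := p ! j]"
  have len: "length q = length p" by (simp add: q_def)
  have qj: "q ! j = p ! k" and qk: "q ! k = p ! j" using ijk by (auto simp: q_def)
  have qx: "q ! x = p ! x" if "x \<noteq> j" "x \<noteq> k" for x using that by (simp add: q_def)
  have qi: "q ! i = p ! i" using qx ijk by simp
  have eq: "(\<forall>y<x. q ! y < q ! x) \<and> q ! x = v \<longleftrightarrow> (\<forall>y<x. p ! y < p ! x) \<and> p ! x = v" for x v
  proof (cases "x = j \<or> x = k")
    case True
    then have i: "i < x" using ijk by auto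
    have "\<not> p ! i < p ! x" "\<not> q ! i < q ! x" using True le qi qj qk by auto
    then show ?thesis using i by blast
  next
    case False
    then have x: "q ! x = p ! x" using qx by simp
    have "(\<forall>y<x. q ! y < p ! x) \<longleftrightarrow> (\<forall>y<x. p ! y < p ! x)"
    proof (cases "j < x")
      case True
      then have i: "i < x" using ijk by simp
      have "p ! y < p ! x \<longleftrightarrow> q ! y < p ! x" if "p ! i < p ! x" for y
        using that le qj qk qx[of y] by (cases "y = j"; cases "y = k") auto
      then show ?thesis using i qi by metis
    next
      case False
      then have "q ! y = p ! y" if "y < x" for y using that ijk by (intro qx) auto
      then show ?thesis by simp
    qed
    then show ?thesis using x by simp
  qed
  have "left_maxima r = {(x, v). x < length r \<and> (\<forall>y<x. r ! y < r ! x) \<and> r ! x = v}" for r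
    by (auto simp: left_maxima_def)
  then show ?thesis unfolding q_def[symmetric] by (simp only: eq len)
qed

text \<open>The termination measure for turning 312 into 321: the larger value moves to the
  left.\<close>

lemma weight_swap:
  fixes p :: "nat list"
  assumes "j < k" "k < length p" "p ! j < p ! k"
  shows "(\<Sum>i<length p. i * p[j := p ! k, k := p ! j] ! i) < (\<Sum>i<length p. i * p ! i)"
proof -
  let ?q = "p[j := p ! k, k := p ! j]"
  have split: "(\<Sum>i<length p. i * r ! i) = j * r ! j + k * r ! k + (\<Sum>i\<in>{..<length p} - {j, k}. i * r ! i)"
    for r :: "nat list"
  proof -
    have "(\<Sum>i<length p. i * r ! i) = (\<Sum>i\<in>{j, k}. i * r ! i) + (\<Sum>i\<in>{..<length p} - {j, k}. i * r ! i)"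
      using assms by (subst sum.subset_diff[of "{j, k}"]) auto
    then show ?thesis using assms by simp
  qed
  have "(\<Sum>i\<in>{..<length p} - {j, k}. i * ?q ! i) = (\<Sum>i\<in>{..<length p} - {j, k}. i * p ! i)"
    by (rule sum.cong) auto
  moreover have "j * p ! k + k * p ! j < j * p ! j + k * p ! k"
  proof -
    obtain d e where "k = j + Suc d" "p ! k = p ! j + Suc e"
      using assms by (metis less_imp_Suc_add add_Suc_right)
    then show ?thesis by (simp add: algebra_simps)
  qed
  ultimately show ?thesis unfolding split using assms by simp
qed

lemma avoid312_same_left_maxima:
  assumes b: "sorted b"
  shows "p \<in> trans_lists b \<Longrightarrow> \<exists>q\<in>avoid_lists pat312 b. left_maxima q = left_maxima p"
proof (induction "\<Sum>i<length p. i * p ! i" arbitrary: p rule: less_induct)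
  case less
  show ?case
  proof (cases "p \<in> avoid_lists pat312 b")
    case False
    then obtain i j k where ijk: "i < j" "j < k" "k < length b" "b ! k < p ! j" "p ! j < p ! k" "p ! k < p ! i"
      using less.prems by (auto simp: avoid_lists_def pat312_def)
    let ?q = "p[j := p ! k, k := p ! j]"
    have len: "length p = length b" using less.prems by (simp add: trans_lists_def)
    have "(\<Sum>i<length ?q. i * ?q ! i) < (\<Sum>i<length p. i * p ! i)"
      using weight_swap[of j k p] ijk len by simp
    then obtain q where "q \<in> avoid_lists pat312 b" "left_maxima q = left_maxima ?q"
      using less.hyps swap_in_trans_lists[OF b less.prems ijk(2,3)] ijk by blast
    then show ?thesis using left_maxima_swap[of i j k p] ijk len by auto
  qed auto
qed

text \<open>At the first difference, say with \<open>p ! x < q ! x\<close>, the value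
  \<open>q ! x\<close> is no maximum of \<open>q\<close>, so something larger precedes it. The value
  \<open>p ! x\<close> has to occur later in \<open>q\<close> and completes a 321.\<close>

lemma avoid321_left_maxima_unique:
  assumes b: "sorted b" and p: "p \<in> avoid_lists pat321 b" and q: "q \<in> avoid_lists pat321 b"
    and eq: "left_maxima p = left_maxima q"
  shows "p = q"
proof -
  \<comment> \<open>The last entry of a 321 is its least and sits on a cell, so every classical 321
    lies in the diagram.\<close>
  have no321: "\<not> (i < j \<and> j < k \<and> k < length b \<and> r ! k < r ! j \<and> r ! j < r ! i)"
    if "r \<in> avoid_lists pat321 b" for r i j k
  proof
    assume h: "i < j \<and> j < k \<and> k < length b \<and> r ! k < r ! j \<and> r ! j < r ! i"
    then have "b ! k < r ! k" using that by (auto simp: avoid_lists_def trans_lists_def)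
    then show False using that h unfolding avoid_lists_def pat321_def by fastforce
  qed
  have False if x: "x < length b" "\<forall>y<x. p ! y = q ! y" and less: "p ! x < q ! x"
    and p: "p \<in> avoid_lists pat321 b" and q: "q \<in> avoid_lists pat321 b"
    and eq: "left_maxima p = left_maxima q" for x p q
  proof -
    have len: "length p = length b" "length q = length b" "set p = set q" "distinct p" "distinct q"
      using p q by (auto simp: avoid_lists_def trans_lists_def)
    have "p ! x \<in> set q" using len x by (metis nth_mem)
    then obtain z where z: "z < length b" "q ! z = p ! x" using len by (metis in_set_conv_nth)
    have "z \<noteq> x" using z less by auto
    moreover have "\<not> z < x"
    proof
      assume "z < x"
      then have "p ! z = p ! x" using x z by simp
      moreover have "z < length p" "x < length p" using \<open>z < x\<close> x(1) len(1) by auto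
      ultimately have "z = x" using nth_eq_iff_index_eq[OF len(4)] by blast
      then show False using \<open>z < x\<close> by simp
    qed
    ultimately have "x < z" by simp
    have "(x, q ! x) \<notin> left_maxima q"
      unfolding eq[symmetric] using less by (auto simp: left_maxima_def)
    then have "\<not> (\<forall>j<x. q ! j < q ! x)" using x(1) len(2) by (auto simp: left_maxima_def)
    then obtain y where y: "y < x" "q ! x \<le> q ! y" using not_less by blast
    moreover have "q ! x \<noteq> q ! y" using y x(1) len nth_eq_iff_index_eq[OF len(5), of x y] by simp
    ultimately show False using no321[OF q, of y x z] \<open>x < z\<close> z less by auto
  qed note * = this
  have len: "length p = length b" "length q = length b"
    using p q by (auto simp: avoid_lists_def trans_lists_def)
  show ?thesis
  proof (rule ccontr)
    assume "p \<noteq> q"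
    then have ex: "\<exists>x. x < length b \<and> p ! x \<noteq> q ! x" using len by (auto simp: list_eq_iff_nth_eq)
    define x where "x = (LEAST x. x < length b \<and> p ! x \<noteq> q ! x)"
    have x: "x < length b" "p ! x \<noteq> q ! x" using LeastI_ex[OF ex] by (auto simp: x_def)
    have "\<forall>y<x. p ! y = q ! y"
      using not_less_Least[of _ "\<lambda>x. x < length b \<and> p ! x \<noteq> q ! x"] x unfolding x_def[symmetric]
      by (metis less_trans)
    then show False using *[of x p q] *[of x q p] x p q eq by (metis linorder_neqE_nat)
  qed
qed

lemma avoid_321_to_312:
  assumes b: "sorted b"
  obtains f where "inj_on f (avoid_lists pat321 b)" "f ` avoid_lists pat321 b \<subseteq> avoid_lists pat312 b"
    "\<And>p. p \<in> avoid_lists pat321 b \<Longrightarrow> left_maxima (f p) = left_maxima p"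
proof -
  have "\<forall>p\<in>avoid_lists pat321 b. \<exists>q. q \<in> avoid_lists pat312 b \<and> left_maxima q = left_maxima p"
    using avoid312_same_left_maxima[OF b] by (auto simp: avoid_lists_def)
  then obtain f where f: "\<forall>p\<in>avoid_lists pat321 b. f p \<in> avoid_lists pat312 b \<and> left_maxima (f p) = left_maxima p"
    by metis
  moreover have "inj_on f (avoid_lists pat321 b)"
  proof (rule inj_onI)
    fix p q assume h: "p \<in> avoid_lists pat321 b" "q \<in> avoid_lists pat321 b" "f p = f q"
    then have "left_maxima p = left_maxima q" using f by metis
    then show "p = q" using avoid321_left_maxima_unique[OF b] h by blast
  qed
  ultimately show ?thesis using that by blast
qed

lemma card_avoid_lists_321_le_312:
  "sorted b \<Longrightarrow> card (avoid_lists pat321 b) \<le> card (avoid_lists pat312 b)"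
  using avoid_321_to_312 card_inj_on_le finite_avoid_lists by metis

text \<open>Images of distinct 321-avoiders have distinct left-to-right maxima, so at most one of
  \<open>p\<close> and \<open>q\<close> is an image.\<close>

lemma card_avoid_lists_321_less_312:
  assumes b: "sorted b" and p: "p \<in> avoid_lists pat312 b" and q: "q \<in> avoid_lists pat312 b"
    and eq: "left_maxima p = left_maxima q" and ne: "p \<noteq> q"
  shows "card (avoid_lists pat321 b) < card (avoid_lists pat312 b)"
proof -
  obtain f where inj: "inj_on f (avoid_lists pat321 b)"
    and f: "f ` avoid_lists pat321 b \<subseteq> avoid_lists pat312 b"
    and lm: "\<And>r. r \<in> avoid_lists pat321 b \<Longrightarrow> left_maxima (f r) = left_maxima r"
    using avoid_321_to_312[OF b] by blast
  have "\<not> (p \<in> f ` avoid_lists pat321 b \<and> q \<in> f ` avoid_lists pat321 b)"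
  proof
    assume "p \<in> f ` avoid_lists pat321 b \<and> q \<in> f ` avoid_lists pat321 b"
    then obtain r s where rs: "r \<in> avoid_lists pat321 b" "s \<in> avoid_lists pat321 b" "p = f r" "q = f s"
      by blast
    then have "r = s" using lm eq avoid321_left_maxima_unique[OF b] by metis
    then show False using rs ne by simp
  qed
  then have "f ` avoid_lists pat321 b \<subset> avoid_lists pat312 b" using f p q by blast
  then have "card (f ` avoid_lists pat321 b) < card (avoid_lists pat312 b)"
    by (rule psubset_card_mono[OF finite_avoid_lists])
  then show ?thesis using inj by (simp add: card_image)
qed

section \<open>A shape that separates the three patterns\<close>

text \<open>The shape is the square of side five without its bottom right cell; on the full square
  both numbers would be the Catalan number 42.\<close>

lemma separating_shape_213_123:
  "card (avoid_lists pat213 [0, 0, 0, 0, 1]) < card (avoid_lists pat123 [0, 0, 0, 0, 1])"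
proof -
  have b: "sorted [0, 0, 0, 0, 1 :: nat]" "\<forall>i<length [0, 0, 0, 0, 1 :: nat]. [0, 0, 0, 0, 1] ! i \<le> i"
    by (auto simp: less_Suc_eq)
  have "count213 Suc [0, 0, 0, 0, 1] = 37" by code_simp
  moreover have "count123 Suc [0, 0, 0, 0, 1] = 41" by code_simp
  ultimately show ?thesis unfolding card_avoid_lists[OF b] by simp
qed

lemma separating_shape_321_312:
  "card (avoid_lists pat321 [0, 0, 0, 0, 1]) < card (avoid_lists pat312 [0, 0, 0, 0, 1])"
proof (rule card_avoid_lists_321_less_312)
  \<comment> \<open>Each word contains a classical 312, namely \<open>3 1 2\<close> and
    \<open>5 1 4\<close>; it does not count because it uses the value 1 and ends in the last column,
    where row 1 is missing.\<close>
  show "[3, 1, 5, 4, 2] \<in> avoid_lists pat312 [0, 0, 0, 0, 1]" "[3, 2, 5, 1, 4] \<in> avoid_lists pat312 [0, 0, 0, 0, 1]"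
    by (auto simp: avoid_lists_def trans_lists_def pat312_def less_Suc_eq)
  show "left_maxima [3, 1, 5, 4, 2] = left_maxima [3, 2, 5, 1, 4]"
    by (auto simp: left_maxima_def less_Suc_eq)
qed auto

section \<open>White cells\<close>

text \<open>White regions depend on the transversal and are later restricted to arbitrary columns
  and rows, so diagrams appear here as sets of cells.\<close>

definition nw_closed :: "(nat \<times> nat) set \<Rightarrow> bool" where
  "nw_closed Y \<longleftrightarrow> (\<forall>x y x' y'. (x, y) \<in> Y \<longrightarrow> x' \<le> x \<longrightarrow> y \<le> y' \<longrightarrow> (x', y') \<in> Y)"

definition transversal :: "nat set \<Rightarrow> nat set \<Rightarrow> (nat \<times> nat) set \<Rightarrow> (nat \<times> nat) set \<Rightarrow> bool" where
  "transversal C R Y T \<longleftrightarrow> T \<subseteq> Y \<and> inj_on fst T \<and> inj_on snd T \<and> fst ` T = C \<and> snd ` T = R"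

definition contains3 :: "(nat \<Rightarrow> nat \<Rightarrow> nat \<Rightarrow> bool) \<Rightarrow> (nat \<times> nat) set \<Rightarrow> (nat \<times> nat) set \<Rightarrow> bool" where
  "contains3 Q Y T \<longleftrightarrow> (\<exists>x y z u v w. (x, u) \<in> T \<and> (y, v) \<in> T \<and> (z, w) \<in> T \<and> x < y \<and> y < z \<and>
     Q u v w \<and> (z, u) \<in> Y \<and> (z, v) \<in> Y \<and> (z, w) \<in> Y)"

definition avoid_sets ::
    "(nat \<Rightarrow> nat \<Rightarrow> nat \<Rightarrow> bool) \<Rightarrow> nat set \<Rightarrow> nat set \<Rightarrow> (nat \<times> nat) set \<Rightarrow> (nat \<times> nat) set set" where
  "avoid_sets Q C R Y = {T. transversal C R Y T \<and> \<not> contains3 Q Y T}"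

definition occurrence :: "nat list \<Rightarrow> (nat \<times> nat) set \<Rightarrow> (nat \<times> nat) set \<Rightarrow> (nat \<times> nat) list \<Rightarrow> bool" where
  "occurrence \<tau> Y T ps \<longleftrightarrow> ps \<noteq> [] \<and> set ps \<subseteq> T \<and> sorted_wrt (\<lambda>p q. fst p < fst q) ps \<and>
     order_iso (map snd ps) \<tau> \<and> (fst (last ps), Min (snd ` set ps)) \<in> Y"

definition white :: "nat list \<Rightarrow> (nat \<times> nat) set \<Rightarrow> (nat \<times> nat) set \<Rightarrow> (nat \<times> nat) set" where
  "white \<tau> Y T = {(x, y). \<exists>ps. occurrence \<tau> Y T ps \<and> (\<forall>q\<in>set ps. x < fst q \<and> snd q < y)}"

lemma nw_closedD: "nw_closed Y \<Longrightarrow> (x, y) \<in> Y \<Longrightarrow> x' \<le> x \<Longrightarrow> y \<le> y' \<Longrightarrow> (x', y') \<in> Y"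
  unfolding nw_closed_def by blast

lemma nw_closed_white: "nw_closed (white \<tau> Y T)"
  unfolding nw_closed_def white_def by (auto intro: le_less_trans less_le_trans)

lemma white_subset:
  assumes "nw_closed Y" shows "white \<tau> Y T \<subseteq> Y"
proof
  fix c assume "c \<in> white \<tau> Y T"
  then obtain x y ps where c: "c = (x, y)" and ps: "occurrence \<tau> Y T ps" "\<forall>q\<in>set ps. x < fst q \<and> snd q < y"
    by (auto simp: white_def)
  have ne: "ps \<noteq> []" "finite (snd ` set ps)" "snd ` set ps \<noteq> {}" using ps by (auto simp: occurrence_def)
  then have "x \<le> fst (last ps)" using ps(2) by (simp add: less_imp_le)
  moreover have "Min (snd ` set ps) \<in> snd ` set ps" using ne by (intro Min_in)
  then have "Min (snd ` set ps) \<le> y" using ps(2) by auto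
  moreover have "(fst (last ps), Min (snd ` set ps)) \<in> Y" using ps(1) by (simp add: occurrence_def)
  ultimately show "c \<in> Y" unfolding c using nw_closedD[OF assms] by blast
qed

lemma occurrence_mono: "occurrence \<tau> Y T ps \<Longrightarrow> T \<subseteq> U \<Longrightarrow> occurrence \<tau> Y U ps"
  unfolding occurrence_def by blast

lemma white_mono: "T \<subseteq> U \<Longrightarrow> white \<tau> Y T \<subseteq> white \<tau> Y U"
  unfolding white_def using occurrence_mono by blast

lemma white_trans:
  assumes "q \<in> white \<tau> Y T" "x < fst q" "snd q < y"
  shows "(x, y) \<in> white \<tau> Y T"
proof -
  have "(fst q, snd q) \<in> white \<tau> Y T" using assms(1) by simp
  then show ?thesis using nw_closedD[OF nw_closed_white] assms(2,3) by (meson less_imp_le)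
qed

text \<open>A copy of \<open>\<tau>\<close> through a white point \<open>q\<close> can be traded for
  a copy south-east of \<open>q\<close>, which \<open>M\<close> already provides.\<close>

lemma white_absorb:
  assumes "U \<subseteq> white \<tau> Y M" shows "white \<tau> Y (M \<union> U) = white \<tau> Y M"
proof
  show "white \<tau> Y (M \<union> U) \<subseteq> white \<tau> Y M"
  proof
    fix c assume "c \<in> white \<tau> Y (M \<union> U)"
    then obtain x y ps where c: "c = (x, y)" and ps: "occurrence \<tau> Y (M \<union> U) ps"
      "\<forall>q\<in>set ps. x < fst q \<and> snd q < y" by (auto simp: white_def)
    show "c \<in> white \<tau> Y M"
    proof (cases "set ps \<subseteq> M")
      case True
      then have "occurrence \<tau> Y M ps" using ps(1) by (simp add: occurrence_def)
      then show ?thesis using ps(2) c by (auto simp: white_def)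
    next
      case False
      then obtain q where "q \<in> set ps" "q \<in> U" using ps(1) by (auto simp: occurrence_def)
      then show ?thesis using white_trans assms ps(2) c by blast
    qed
  qed
qed (rule white_mono, simp)

text \<open>If a copy of \<open>\<tau>\<close> uses a white point, another copy lies south-east of
  that point. The columns increase strictly, so this ends with a copy free of white points.\<close>

lemma white_core:
  assumes "finite T" shows "white \<tau> Y (T - white \<tau> Y T) = white \<tau> Y T" (is "?A = ?B")
proof
  obtain N where N: "\<forall>q\<in>T. fst q \<le> N"
    using assms finite_nat_set_iff_bounded_le[of "fst ` T"] by auto
  have "(x, y) \<in> ?A" if "(x, y) \<in> ?B" for x y
    using that
  proof (induction "N - x" arbitrary: x y rule: less_induct)
    case less
    then obtain ps where ps: "occurrence \<tau> Y T ps" "\<forall>q\<in>set ps. x < fst q \<and> snd q < y"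
      by (auto simp: white_def)
    show ?case
    proof (cases "set ps \<inter> ?B = {}")
      case True
      then have "occurrence \<tau> Y (T - ?B) ps" using ps(1) by (auto simp: occurrence_def)
      then show ?thesis using ps(2) by (auto simp: white_def)
    next
      case False
      then obtain q where q: "q \<in> set ps" "q \<in> ?B" by blast
      have "q \<in> T" using q ps(1) by (auto simp: occurrence_def)
      then have "N - fst q < N - x" using N q(1) ps(2) by (metis diff_less_mono2 less_le_trans)
      then have "(fst q, snd q) \<in> ?A" using less.hyps[of "fst q" "snd q"] q(2) by simp
      then show ?thesis using white_trans[of q] q(1) ps(2) by simp
    qed
  qed
  then show "?B \<subseteq> ?A" by auto
qed (rule white_mono, simp)

lemma transversal_finite:
  assumes "transversal C R Y T" "finite C" shows "finite T"
  using assms unfolding transversal_def by (metis finite_imageD)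

lemma finite_transversals:
  assumes "finite C" "finite R" shows "finite {T. transversal C R Y T}"
proof (rule finite_subset)
  show "{T. transversal C R Y T} \<subseteq> Pow (C \<times> R)"
    unfolding transversal_def by (auto simp: image_iff) (metis fst_conv imageI, metis snd_conv imageI)
qed (use assms in simp)

section \<open>Splitting a transversal into its core and its white points\<close>

definition cores :: "nat list \<Rightarrow> nat set \<Rightarrow> nat set \<Rightarrow> (nat \<times> nat) set \<Rightarrow> (nat \<times> nat) set set" where
  "cores \<tau> C R Y = (\<lambda>T. T - white \<tau> Y T) ` {T. transversal C R Y T}"

definition residual :: "(nat \<Rightarrow> nat \<Rightarrow> nat \<Rightarrow> bool) \<Rightarrow> nat list \<Rightarrow> nat set \<Rightarrow> nat set \<Rightarrow> (nat \<times> nat) set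
    \<Rightarrow> (nat \<times> nat) set \<Rightarrow> (nat \<times> nat) set set" where
  "residual Q \<tau> C R Y M = avoid_sets Q (C - fst ` M) (R - snd ` M) (white \<tau> Y M)"

text \<open>The points \<open>(x, u)\<close> and \<open>(y, v)\<close> lie to the left of the white
  cells \<open>(z, u)\<close> and \<open>(z, v)\<close>, so they are white themselves.\<close>

lemma contains3_white:
  assumes "T \<inter> white \<tau> Y M = U"
  shows "contains3 Q (white \<tau> Y M) T \<longleftrightarrow> contains3 Q (white \<tau> Y M) U"
proof
  assume "contains3 Q (white \<tau> Y M) T"
  then obtain x y z u v w where *: "(x, u) \<in> T" "(y, v) \<in> T" "(z, w) \<in> T" "x < y" "y < z" "Q u v w"
     "(z, u) \<in> white \<tau> Y M" "(z, v) \<in> white \<tau> Y M" "(z, w) \<in> white \<tau> Y M"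
    unfolding contains3_def by blast
  have "(x, u) \<in> white \<tau> Y M" "(y, v) \<in> white \<tau> Y M"
    using * nw_closedD[OF nw_closed_white] by (meson less_imp_le less_trans order_refl)+
  then have "(x, u) \<in> U" "(y, v) \<in> U" "(z, w) \<in> U" using * assms by blast+
  then show "contains3 Q (white \<tau> Y M) U" unfolding contains3_def using * by blast
next
  assume "contains3 Q (white \<tau> Y M) U"
  then show "contains3 Q (white \<tau> Y M) T" using assms unfolding contains3_def by blast
qed

lemma transversal_union:
  assumes Y: "nw_closed Y" and M: "M \<subseteq> Y" "inj_on fst M" "inj_on snd M" "fst ` M \<subseteq> C" "snd ` M \<subseteq> R"
    and U: "transversal (C - fst ` M) (R - snd ` M) (white \<tau> Y M) U"
  shows "transversal C R Y (M \<union> U)"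
proof -
  have U: "U \<subseteq> white \<tau> Y M" "inj_on fst U" "inj_on snd U" "fst ` U = C - fst ` M" "snd ` U = R - snd ` M"
    using U unfolding transversal_def by blast+
  have "M \<union> U \<subseteq> Y" using M(1) subset_trans[OF U(1) white_subset[OF Y]] by simp
  moreover have "fst ` (M - U) \<inter> fst ` (U - M) = {}" "snd ` (M - U) \<inter> snd ` (U - M) = {}"
    using U(4,5) by blast+
  then have "inj_on fst (M \<union> U)" "inj_on snd (M \<union> U)" unfolding inj_on_Un using U(2,3) M(2,3) by blast+
  moreover have "fst ` (M \<union> U) = C" "snd ` (M \<union> U) = R" unfolding image_Un U(4,5) using M(4,5) by blast+
  ultimately show ?thesis unfolding transversal_def by simp
qed

text \<open>A core has to come from a whole transversal, hence the witness \<open>U\<close>. Any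
  filling of the white region serves, since by \<open>white_absorb\<close> it leaves this region
  unchanged.\<close>

lemma coresI:
  assumes Y: "nw_closed Y" and M: "M \<subseteq> Y" "inj_on fst M" "inj_on snd M" "fst ` M \<subseteq> C" "snd ` M \<subseteq> R"
    and U: "transversal (C - fst ` M) (R - snd ` M) (white \<tau> Y M) U"
    and disj: "M \<inter> white \<tau> Y M = {}"
  shows "M \<in> cores \<tau> C R Y"
proof -
  have "U \<subseteq> white \<tau> Y M" using U by (simp add: transversal_def)
  then have "(M \<union> U) - white \<tau> Y (M \<union> U) = M" using disj white_absorb[of U \<tau> Y M] by auto
  then show ?thesis using transversal_union[OF Y M U] unfolding cores_def by (metis (mono_tags) imageI mem_Collect_eq)
qed

lemma cores_props:
  assumes Y: "nw_closed Y" and C: "finite C" and M: "M \<in> cores \<tau> C R Y"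
  shows "M \<inter> white \<tau> Y M = {}" "M \<subseteq> Y" "inj_on fst M" "inj_on snd M" "fst ` M \<subseteq> C" "snd ` M \<subseteq> R"
proof -
  obtain T where T: "transversal C R Y T" "M = T - white \<tau> Y T" using M by (auto simp: cores_def)
  then have "white \<tau> Y M = white \<tau> Y T" using white_core transversal_finite[OF _ C] by blast
  then show "M \<inter> white \<tau> Y M = {}" using T by auto
  show "M \<subseteq> Y" "inj_on fst M" "inj_on snd M" "fst ` M \<subseteq> C" "snd ` M \<subseteq> R"
    using T by (auto simp: transversal_def inj_on_diff)
qed

text \<open>By \<open>white_core\<close> and \<open>white_absorb\<close> a transversal and its core
  have the same white region. So the transversals with core \<open>M\<close> are exactly the unions
  of \<open>M\<close> with a transversal of its white region in the free columns and rows.\<close>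

lemma card_skew_avoiding:
  assumes Y: "nw_closed Y" and C: "finite C" and R: "finite R"
  shows "card {T. transversal C R Y T \<and> \<not> contains3 Q (white \<tau> Y T) T} =
    (\<Sum>M\<in>cores \<tau> C R Y. card (residual Q \<tau> C R Y M))"
proof -
  let ?W = "white \<tau> Y"
  have fin: "finite (cores \<tau> C R Y)" unfolding cores_def by (intro finite_imageI finite_transversals C R)
  have fin_res: "finite (residual Q \<tau> C R Y M)" for M
    unfolding residual_def avoid_sets_def
    by (rule finite_subset[OF _ finite_transversals[of "C - fst ` M" "R - snd ` M" "?W M"]]) (use C R in auto)
  let ?S = "SIGMA M:cores \<tau> C R Y. residual Q \<tau> C R Y M"
  have W: "?W (M \<union> U) = ?W M" "(M \<union> U) - ?W M = M" "(M \<union> U) \<inter> ?W M = U"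
    if "M \<in> cores \<tau> C R Y" "U \<in> residual Q \<tau> C R Y M" for M U
  proof -
    have U: "U \<subseteq> ?W M" using that(2) by (simp add: residual_def avoid_sets_def transversal_def)
    then show "?W (M \<union> U) = ?W M" by (rule white_absorb)
    show "(M \<union> U) - ?W M = M" "(M \<union> U) \<inter> ?W M = U"
      using cores_props(1)[OF Y C that(1)] U by auto
  qed
  have "bij_betw (\<lambda>(M, U). M \<union> U) ?S {T. transversal C R Y T \<and> \<not> contains3 Q (?W T) T}"
  proof (rule bij_betw_imageI)
    show "inj_on (\<lambda>(M, U). M \<union> U) ?S"
    proof (rule inj_onI, clarify)
      fix M U M' U' assume *: "M \<in> cores \<tau> C R Y" "U \<in> residual Q \<tau> C R Y M"
        "M' \<in> cores \<tau> C R Y" "U' \<in> residual Q \<tau> C R Y M'" "M \<union> U = M' \<union> U'"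
      then have "?W M = ?W M'" using W(1) by metis
      then show "M = M' \<and> U = U'" using * W(2,3) by metis
    qed
    show "(\<lambda>(M, U). M \<union> U) ` ?S = {T. transversal C R Y T \<and> \<not> contains3 Q (?W T) T}"
    proof (intro set_eqI iffI)
      fix T assume "T \<in> (\<lambda>(M, U). M \<union> U) ` ?S"
      then obtain M U where MU: "M \<in> cores \<tau> C R Y" "U \<in> residual Q \<tau> C R Y M" "T = M \<union> U" by auto
      note cp = cores_props[OF Y C MU(1)]
      have U: "transversal (C - fst ` M) (R - snd ` M) (?W M) U" "\<not> contains3 Q (?W M) U"
        using MU(2) unfolding residual_def avoid_sets_def by blast+
      have "transversal C R Y T" unfolding MU(3) by (rule transversal_union[OF Y cp(2-6) U(1)])
      moreover have "\<not> contains3 Q (?W T) T"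
        using U(2) contains3_white[OF W(3)[OF MU(1,2)]] W(1)[OF MU(1,2)] MU(3) by simp
      ultimately show "T \<in> {T. transversal C R Y T \<and> \<not> contains3 Q (?W T) T}" by simp
    next
      fix T assume "T \<in> {T. transversal C R Y T \<and> \<not> contains3 Q (?W T) T}"
      then have T: "transversal C R Y T" "\<not> contains3 Q (?W T) T" by auto
      define M where "M = T - ?W T"
      define U where "U = T \<inter> ?W T"
      have M: "M \<in> cores \<tau> C R Y" using T by (auto simp: cores_def M_def)
      have WM: "?W M = ?W T" unfolding M_def by (rule white_core[OF transversal_finite[OF T(1) C]])
      have TMU: "T = M \<union> U" "M \<inter> U = {}" by (auto simp: M_def U_def)
      have inj: "inj_on fst T" "inj_on snd T" "fst ` T = C" "snd ` T = R" using T by (auto simp: transversal_def)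
      have sub: "T - M \<subseteq> T" "M \<subseteq> T" and TM: "T - M = U" using TMU by blast+
      have "fst ` U = C - fst ` M" "snd ` U = R - snd ` M"
        using inj_on_image_set_diff[OF inj(1) sub] inj_on_image_set_diff[OF inj(2) sub]
        unfolding TM inj(3,4) .
      moreover have "inj_on fst U" "inj_on snd U"
        using inj(1,2) sub(1) unfolding TM by (blast intro: inj_on_subset)+
      moreover have "U \<subseteq> ?W M" unfolding WM U_def by simp
      ultimately have "transversal (C - fst ` M) (R - snd ` M) (?W M) U"
        unfolding transversal_def by simp
      moreover have "\<not> contains3 Q (?W M) U"
        using T(2) contains3_white[of T \<tau> Y M U] WM by (simp add: U_def)
      ultimately have "U \<in> residual Q \<tau> C R Y M" by (simp add: residual_def avoid_sets_def)
      then show "T \<in> (\<lambda>(M, U). M \<union> U) ` ?S" using M TMU(1) by (intro image_eqI[of _ _ "(M, U)"]) simp_all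
    qed
  qed
  then have "card {T. transversal C R Y T \<and> \<not> contains3 Q (?W T) T} = card ?S"
    by (simp add: bij_betw_same_card)
  also have "\<dots> = (\<Sum>M\<in>cores \<tau> C R Y. card (residual Q \<tau> C R Y M))"
    using fin fin_res by simp
  finally show ?thesis .
qed

section \<open>Renumbering free columns and rows\<close>

text \<open>The shape left over by a core is scattered over \<open>cols\<close> and
  \<open>rows\<close>; enumerating both turns it into a list \<open>b\<close>. The index
  \<open>j\<close> starts at 0 and the values of \<open>p\<close> at 1, hence
  \<open>b ! i \<le> j\<close> here against \<open>b ! i < p ! i\<close> in
  \<open>trans_lists\<close>.\<close>

locale compression =
  fixes cols rows b :: "nat list" and Y :: "(nat \<times> nat) set"
  assumes cols: "sorted_wrt (<) cols" "length cols = length b"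
    and rows: "sorted_wrt (<) rows" "length rows = length b"
    and bY: "\<And>i j. i < length b \<Longrightarrow> j < length b \<Longrightarrow> (cols ! i, rows ! j) \<in> Y \<longleftrightarrow> b ! i \<le> j"
begin

definition cell :: "nat list \<Rightarrow> nat \<Rightarrow> nat \<times> nat" where
  "cell p i = (cols ! i, rows ! (p ! i - 1))"

definition graph :: "nat list \<Rightarrow> (nat \<times> nat) set" where
  "graph p = cell p ` {..<length b}"

lemma cols_less: "i < length b \<Longrightarrow> j < length b \<Longrightarrow> cols ! i < cols ! j \<longleftrightarrow> i < j"
  using cols by (metis linorder_neqE_nat not_less_iff_gr_or_eq sorted_wrt_nth_less)

lemma rows_less: "i < length b \<Longrightarrow> j < length b \<Longrightarrow> rows ! i < rows ! j \<longleftrightarrow> i < j"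
  using rows by (metis linorder_neqE_nat not_less_iff_gr_or_eq sorted_wrt_nth_less)

lemma cols_eq: "i < length b \<Longrightarrow> j < length b \<Longrightarrow> cols ! i = cols ! j \<longleftrightarrow> i = j"
  using cols_less by (metis less_irrefl linorder_neqE_nat)

lemma rows_eq: "i < length b \<Longrightarrow> j < length b \<Longrightarrow> rows ! i = rows ! j \<longleftrightarrow> i = j"
  using rows_less by (metis less_irrefl linorder_neqE_nat)

lemma perm_range:
  assumes "p \<in> trans_lists b" "i < length b"
  shows "1 \<le> p ! i" "p ! i \<le> length b" "p ! i - 1 < length b"
proof -
  have "p ! i \<in> set p" using assms by (auto simp: trans_lists_def)
  then show "1 \<le> p ! i" "p ! i \<le> length b" using assms by (auto simp: trans_lists_def)
  then show "p ! i - 1 < length b" by linarith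
qed

lemma perm_Y:
  assumes "p \<in> trans_lists b" "i < length b" "k < length b"
  shows "(cols ! k, rows ! (p ! i - 1)) \<in> Y \<longleftrightarrow> b ! k < p ! i"
  using bY[of k "p ! i - 1"] perm_range[OF assms(1,2)] assms(3) by auto

lemma graph_transversal:
  assumes p: "p \<in> trans_lists b"
  shows "transversal (set cols) (set rows) Y (graph p)"
  unfolding transversal_def
proof (intro conjI)
  show "graph p \<subseteq> Y" using perm_Y[OF p] p by (auto simp: graph_def cell_def trans_lists_def)
  show "inj_on fst (graph p)" by (auto simp: inj_on_def graph_def cell_def cols_eq)
  show "inj_on snd (graph p)"
  proof (rule inj_onI)
    fix s t assume st: "s \<in> graph p" "t \<in> graph p" "snd s = snd t"
    then obtain i j where ij: "i < length b" "j < length b" "s = cell p i" "t = cell p j"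
      by (auto simp: graph_def)
    then have "p ! i - 1 = p ! j - 1" using st(3) rows_eq perm_range[OF p] by (auto simp: cell_def)
    then have "p ! i = p ! j" using perm_range[OF p ij(1)] perm_range[OF p ij(2)] by linarith
    then have "i = j" using p ij by (auto simp: trans_lists_def nth_eq_iff_index_eq)
    then show "s = t" using ij by simp
  qed
  show "fst ` graph p = set cols"
    using cols(2) by (auto simp: graph_def cell_def set_conv_nth image_iff)
  show "snd ` graph p = set rows"
  proof (intro set_eqI iffI)
    fix y assume "y \<in> snd ` graph p"
    then show "y \<in> set rows" using perm_range[OF p] rows(2) by (auto simp: graph_def cell_def)
  next
    fix y assume "y \<in> set rows"
    then obtain j where j: "j < length b" "y = rows ! j" using rows(2) by (auto simp: set_conv_nth)
    then have "Suc j \<in> set p" using p by (auto simp: trans_lists_def)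
    then obtain i where i: "i < length b" "p ! i = Suc j" using p by (auto simp: in_set_conv_nth trans_lists_def)
    then have "snd (cell p i) = y" using j by (simp add: cell_def)
    then show "y \<in> snd ` graph p" using i by (auto simp: graph_def)
  qed
qed

lemma graph_contains3:
  assumes Q: "order_invariant Q" and p: "p \<in> trans_lists b"
  shows "contains3 Q Y (graph p) \<longleftrightarrow> p \<notin> avoid_lists Q b"
proof -
  have mono: "strict_mono_on {1..length b} (\<lambda>v. rows ! (v - 1))"
    by (auto simp: strict_mono_on_def rows_less)
  have Qp: "Q (rows ! (p ! i - 1)) (rows ! (p ! j - 1)) (rows ! (p ! k - 1)) \<longleftrightarrow> Q (p ! i) (p ! j) (p ! k)"
    if "i < length b" "j < length b" "k < length b" for i j k
    using Q[unfolded order_invariant_def, rule_format, OF mono] perm_range[OF p] that by auto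
  have "contains3 Q Y (graph p) \<longleftrightarrow> (\<exists>i j k. i < length b \<and> j < length b \<and> k < length b \<and>
      cols ! i < cols ! j \<and> cols ! j < cols ! k \<and>
      Q (rows ! (p ! i - 1)) (rows ! (p ! j - 1)) (rows ! (p ! k - 1)) \<and>
      (cols ! k, rows ! (p ! i - 1)) \<in> Y \<and> (cols ! k, rows ! (p ! j - 1)) \<in> Y \<and>
      (cols ! k, rows ! (p ! k - 1)) \<in> Y)"
    unfolding contains3_def graph_def cell_def image_def by auto blast
  also have "\<dots> \<longleftrightarrow> (\<exists>i j k. i < j \<and> j < k \<and> k < length b \<and> Q (p ! i) (p ! j) (p ! k) \<and>
      b ! k < p ! i \<and> b ! k < p ! j \<and> b ! k < p ! k)"
    using Qp perm_Y[OF p] cols_less by (smt (verit) order.strict_trans)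
  also have "\<dots> \<longleftrightarrow> p \<notin> avoid_lists Q b" using p unfolding avoid_lists_def by blast
  finally show ?thesis .
qed

lemma graph_inj: "inj_on graph (trans_lists b)"
proof (rule inj_onI)
  fix p q assume pq: "p \<in> trans_lists b" "q \<in> trans_lists b" "graph p = graph q"
  have "p ! i = q ! i" if i: "i < length b" for i
  proof -
    have "cell p i \<in> graph q" using i pq(3) by (auto simp: graph_def)
    then obtain j where j: "j < length b" "cell p i = cell q j" by (auto simp: graph_def)
    then have "j = i" using cols_eq i by (auto simp: cell_def)
    then have "p ! i - 1 = q ! i - 1"
      using j rows_eq perm_range[OF pq(1) i] perm_range[OF pq(2) i] by (auto simp: cell_def)
    then show ?thesis using perm_range[OF pq(1) i] perm_range[OF pq(2) i] by linarith
  qed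
  then show "p = q" using pq(1,2) by (auto simp: trans_lists_def intro: nth_equalityI)
qed

lemma graph_surj:
  assumes T: "transversal (set cols) (set rows) Y T"
  obtains p where "p \<in> trans_lists b" "T = graph p"
proof -
  have "\<exists>v. 1 \<le> v \<and> v \<le> length b \<and> (cols ! i, rows ! (v - 1)) \<in> T" if i: "i < length b" for i
  proof -
    have "cols ! i \<in> fst ` T" using i cols(2) T by (auto simp: transversal_def)
    then obtain y where y: "(cols ! i, y) \<in> T" by auto
    then have "y \<in> set rows" using T by (force simp: transversal_def)
    then obtain j where "j < length b" "y = rows ! j" using rows(2) by (auto simp: set_conv_nth)
    then show ?thesis using y by (intro exI[of _ "Suc j"]) auto
  qed
  then obtain f where f: "\<And>i. i < length b \<Longrightarrow> 1 \<le> f i \<and> f i \<le> length b \<and> (cols ! i, rows ! (f i - 1)) \<in> T"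
    by metis
  define p where "p = map f [0..<length b]"
  have pn: "p ! i = f i" if "i < length b" for i using that by (simp add: p_def)
  have lp: "length p = length b" by (simp add: p_def)
  have sub: "graph p \<subseteq> T" using f by (auto simp: graph_def cell_def pn)
  have "T \<subseteq> graph p"
  proof
    fix t assume t: "t \<in> T"
    then have "fst t \<in> set cols" using T by (auto simp: transversal_def)
    then obtain i where i: "i < length b" "fst t = cols ! i" using cols(2) by (auto simp: set_conv_nth)
    then have "cell p i \<in> T" "fst (cell p i) = fst t" using sub by (auto simp: graph_def cell_def)
    then have "cell p i = t" using t T by (auto simp: transversal_def inj_on_def)
    then show "t \<in> graph p" using i by (auto simp: graph_def)
  qed
  then have Tp: "T = graph p" using sub by blast
  have inj: "inj_on f {..<length b}"
  proof (rule inj_onI)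
    fix i j assume ij: "i \<in> {..<length b}" "j \<in> {..<length b}" "f i = f j"
    then have "(cols ! i, rows ! (f i - 1)) \<in> T" "(cols ! j, rows ! (f i - 1)) \<in> T"
      using f[of i] f[of j] by auto
    moreover have "inj_on snd T" using T by (simp add: transversal_def)
    ultimately have "cols ! i = cols ! j" by (metis inj_onD prod.inject snd_conv)
    then show "i = j" using cols_eq ij by auto
  qed
  have "distinct p" using inj by (simp add: p_def distinct_map atLeast0LessThan)
  moreover have "set p = {1..length b}"
  proof (rule card_subset_eq)
    show "set p \<subseteq> {1..length b}" using f by (auto simp: p_def)
    show "card (set p) = card {1..length b}"
      using distinct_card[OF \<open>distinct p\<close>] lp by simp
  qed simp
  moreover have "b ! i < p ! i" if i: "i < length b" for i
  proof -
    have "(cols ! i, rows ! (f i - 1)) \<in> Y" using f[OF i] T by (auto simp: transversal_def)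
    then have "b ! i \<le> f i - 1" using bY[of i "f i - 1"] f[OF i] i by auto
    then show ?thesis using f[OF i] pn[OF i] by linarith
  qed
  ultimately have "p \<in> trans_lists b" by (simp add: trans_lists_def p_def)
  then show ?thesis using Tp that by blast
qed

lemma card_avoid_sets:
  assumes Q: "order_invariant Q"
  shows "card (avoid_sets Q (set cols) (set rows) Y) = card (avoid_lists Q b)"
proof -
  have sub: "avoid_lists Q b \<subseteq> trans_lists b" by (auto simp: avoid_lists_def)
  have "avoid_sets Q (set cols) (set rows) Y = graph ` avoid_lists Q b"
  proof (intro set_eqI iffI)
    fix T assume "T \<in> avoid_sets Q (set cols) (set rows) Y"
    then show "T \<in> graph ` avoid_lists Q b"
      using graph_contains3[OF Q] by (auto simp: avoid_sets_def elim!: graph_surj)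
  next
    fix T assume "T \<in> graph ` avoid_lists Q b"
    then show "T \<in> avoid_sets Q (set cols) (set rows) Y"
      using graph_contains3[OF Q] graph_transversal sub by (auto simp: avoid_sets_def)
  qed
  then show ?thesis using card_image[OF inj_on_subset[OF graph_inj sub]] by simp
qed

end

text \<open>Columns from \<open>i\<close> on take only values above \<open>b ! i\<close>, so the
  values \<open>1, ..., b ! i\<close> must all fit into the first \<open>i\<close> columns.\<close>

lemma trans_lists_bound:
  assumes "sorted b" "p \<in> trans_lists b"
  shows "\<forall>i<length b. b ! i \<le> i"
proof (intro allI impI)
  fix i assume i: "i < length b"
  have "{1..b ! i} \<subseteq> (!) p ` {..<i}"
  proof
    fix v assume v: "v \<in> {1..b ! i}"
    have "p ! i \<in> set p" "b ! i < p ! i" using assms i by (auto simp: trans_lists_def)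
    then have "b ! i < length b" using assms by (auto simp: trans_lists_def)
    then have "v \<in> set p" using v assms by (auto simp: trans_lists_def)
    then obtain k where k: "k < length b" "p ! k = v" using assms by (auto simp: in_set_conv_nth trans_lists_def)
    have "\<not> i \<le> k"
    proof
      assume "i \<le> k"
      then have "b ! i \<le> b ! k" using assms(1) k by (simp add: sorted_nth_mono)
      moreover have "b ! k < p ! k" using assms k by (auto simp: trans_lists_def)
      ultimately show False using k v by simp
    qed
    then show "v \<in> (!) p ` {..<i}" using k by auto
  qed
  then have "card {1..b ! i} \<le> card ((!) p ` {..<i})" by (intro card_mono) auto
  also have "\<dots> \<le> i" using card_image_le[of "{..<i}" "(!) p"] by simp
  finally show "b ! i \<le> i" by simp
qed

text \<open>A region without transversals gives zero on both sides. Otherwise a transversal exists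
  and forces the bound \<open>b ! i \<le> i\<close> that the list version assumes.\<close>

lemma card_avoid_sets_le:
  assumes le: "\<And>b. sorted b \<Longrightarrow> \<forall>i<length b. b ! i \<le> i \<Longrightarrow>
      card (avoid_lists Q b) \<le> card (avoid_lists Q' b)"
    and Q: "order_invariant Q" "order_invariant Q'" and Y: "nw_closed Y" and fin: "finite C" "finite R"
  shows "card (avoid_sets Q C R Y) \<le> card (avoid_sets Q' C R Y)"
proof (cases "\<exists>T. transversal C R Y T")
  case True
  then obtain T where T: "transversal C R Y T" by blast
  define cols where "cols = sorted_list_of_set C"
  define rows where "rows = sorted_list_of_set R"
  define n where "n = card C"
  define b where "b = map (\<lambda>x. card {j. j < n \<and> (x, rows ! j) \<notin> Y}) cols"
  have "card C = card T" "card R = card T" using T by (auto simp: transversal_def card_image)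
  then have len: "length cols = n" "length rows = n" "length b = n"
    using fin by (auto simp: cols_def rows_def b_def n_def)
  have CR: "set cols = C" "set rows = R" using fin by (auto simp: cols_def rows_def)
  have srt: "sorted_wrt (<) cols" "sorted_wrt (<) rows" by (auto simp: cols_def rows_def)
  have row_le: "rows ! i \<le> rows ! j" if "i \<le> j" "j < n" for i j
    using that srt(2) len by (metis le_neq_implies_less less_imp_le order_refl sorted_wrt_nth_less)
  have col_le: "cols ! i \<le> cols ! j" if "i \<le> j" "j < n" for i j
    using that srt(1) len by (metis le_neq_implies_less less_imp_le order_refl sorted_wrt_nth_less)
  \<comment> \<open>By closure the rows missing in a column are the lowest ones, so their number
    decides membership.\<close>
  have bY: "(cols ! i, rows ! j) \<in> Y \<longleftrightarrow> b ! i \<le> j" if i: "i < n" and j: "j < n" for i j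
  proof -
    let ?S = "{j. j < n \<and> (cols ! i, rows ! j) \<notin> Y}"
    have b: "b ! i = card ?S" using i len by (simp add: b_def)
    have down: "k \<in> ?S" if "l \<in> ?S" "k \<le> l" for k l
      using that nw_closedD[OF Y, of "cols ! i" "rows ! k" "cols ! i" "rows ! l"] row_le[of k l] by auto
    show ?thesis
    proof
      assume "(cols ! i, rows ! j) \<in> Y"
      then have "?S \<subseteq> {..<j}" using down[of _ j] by (metis (mono_tags, lifting) lessThan_iff mem_Collect_eq not_less subsetI)
      then have "card ?S \<le> card {..<j}" by (intro card_mono) auto
      then show "b ! i \<le> j" using b by simp
    next
      assume le: "b ! i \<le> j"
      show "(cols ! i, rows ! j) \<in> Y"
      proof (rule ccontr)
        assume "(cols ! i, rows ! j) \<notin> Y"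
        then have "{..j} \<subseteq> ?S" using down[of j] j by blast
        then have "card {..j} \<le> card ?S" by (intro card_mono) auto
        then show False using b le by simp
      qed
    qed
  qed
  interpret compression cols rows b Y
    by unfold_locales (use srt len bY in auto)
  have b: "sorted b"
    unfolding sorted_iff_nth_mono
  proof (intro allI impI)
    fix i j assume ij: "i \<le> j" "j < length b"
    show "b ! i \<le> b ! j"
    proof (rule ccontr)
      assume "\<not> b ! i \<le> b ! j"
      moreover have "b ! i \<le> n"
      proof -
        have "b ! i = card {k. k < n \<and> (cols ! i, rows ! k) \<notin> Y}" using ij len by (simp add: b_def)
        also have "\<dots> \<le> card {..<n}" by (intro card_mono) auto
        finally show ?thesis by simp
      qed
      ultimately have "(cols ! j, rows ! (b ! j)) \<in> Y" "(cols ! i, rows ! (b ! j)) \<notin> Y"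
        using bY[of j "b ! j"] bY[of i "b ! j"] ij len by auto
      moreover have "cols ! i \<le> cols ! j" using col_le ij len by simp
      ultimately show False using nw_closedD[OF Y, of "cols ! j" _ "cols ! i"] by blast
    qed
  qed
  have "transversal (set cols) (set rows) Y T" unfolding CR by (rule T)
  then obtain p where "p \<in> trans_lists b" by (rule graph_surj)
  then have "\<forall>i<length b. b ! i \<le> i" using trans_lists_bound b by blast
  from le[OF b this] show ?thesis
    unfolding card_avoid_sets[OF Q(1), symmetric] card_avoid_sets[OF Q(2), symmetric] CR .
qed (simp add: avoid_sets_def)

section \<open>Skew sums\<close>

lemma order_iso_skew_sum:
  assumes len: "length as = length \<sigma>" and \<sigma>: "\<forall>s\<in>set \<sigma>. 1 \<le> s" and \<tau>: "\<forall>t\<in>set \<tau>. t \<le> length \<tau>"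
  shows "order_iso (as @ bs) (skew_sum \<sigma> \<tau>) \<longleftrightarrow>
    order_iso as \<sigma> \<and> order_iso bs \<tau> \<and> (\<forall>a\<in>set as. \<forall>b\<in>set bs. b < a)"
proof -
  let ?a = "length as" and ?\<rho> = "skew_sum \<sigma> \<tau>"
  have \<rho>1: "?\<rho> ! i = \<sigma> ! i + length \<tau>" if "i < ?a" for i
    using that len by (simp add: skew_sum_def nth_append)
  have \<rho>2: "?\<rho> ! (?a + j) = \<tau> ! j" for j using len by (simp add: skew_sum_def nth_append)
  have l1: "(as @ bs) ! i = as ! i" if "i < ?a" for i using that by (simp add: nth_append)
  have l2: "(as @ bs) ! (?a + j) = bs ! j" for j by (simp add: nth_append)
  have lt: "\<tau> ! j < \<sigma> ! i + length \<tau>" if "i < ?a" "j < length \<tau>" for i j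
  proof -
    have "1 \<le> \<sigma> ! i" "\<tau> ! j \<le> length \<tau>" using that len \<sigma> \<tau> by auto
    then show ?thesis by linarith
  qed
  show ?thesis
  proof
    assume iso: "order_iso (as @ bs) ?\<rho>"
    then have lb: "length bs = length \<tau>" using len by (simp add: order_iso_def skew_sum_def)
    have cmp: "(as @ bs) ! i < (as @ bs) ! j \<longleftrightarrow> ?\<rho> ! i < ?\<rho> ! j"
      if "i < ?a + length bs" "j < ?a + length bs" for i j
      using iso that by (simp add: order_iso_def)
    have "order_iso as \<sigma>" unfolding order_iso_def
    proof (intro conjI allI impI len)
      fix i j assume "i < ?a" "j < ?a"
      then show "as ! i < as ! j \<longleftrightarrow> \<sigma> ! i < \<sigma> ! j" using cmp[of i j] by (simp add: l1 \<rho>1)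
    qed
    moreover have "order_iso bs \<tau>" unfolding order_iso_def
    proof (intro conjI allI impI lb)
      fix i j assume "i < length bs" "j < length bs"
      then show "bs ! i < bs ! j \<longleftrightarrow> \<tau> ! i < \<tau> ! j" using cmp[of "?a + i" "?a + j"] by (simp add: l2 \<rho>2)
    qed
    moreover have "b < a" if ab: "a \<in> set as" "b \<in> set bs" for a b
    proof -
      obtain i j where ij: "i < ?a" "as ! i = a" "j < length bs" "bs ! j = b"
        using ab by (auto simp: in_set_conv_nth)
      then show ?thesis using cmp[of "?a + j" i] lt[of i j] lb by (simp add: l1 l2 \<rho>1 \<rho>2)
    qed
    ultimately show "order_iso as \<sigma> \<and> order_iso bs \<tau> \<and> (\<forall>a\<in>set as. \<forall>b\<in>set bs. b < a)" by blast
  next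
    assume iso: "order_iso as \<sigma> \<and> order_iso bs \<tau> \<and> (\<forall>a\<in>set as. \<forall>b\<in>set bs. b < a)"
    then have lb: "length bs = length \<tau>" by (simp add: order_iso_def)
    show "order_iso (as @ bs) ?\<rho>" unfolding order_iso_def
    proof (intro conjI allI impI)
      show "length (as @ bs) = length ?\<rho>" using len lb by (simp add: skew_sum_def)
      fix i j assume ij: "i < length (as @ bs)" "j < length (as @ bs)"
      have split: "i' < ?a \<or> (\<exists>d. i' = ?a + d \<and> d < length bs)" if "i' < length (as @ bs)" for i'
        using that by (metis add_less_cancel_left length_append le_Suc_ex not_less)
      have big: "bs ! d < as ! e" if "d < length bs" "e < ?a" for d e using iso that by simp
      consider "i < ?a" "j < ?a" | d where "i < ?a" "j = ?a + d" "d < length bs"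
        | e where "i = ?a + e" "e < length bs" "j < ?a"
        | e d where "i = ?a + e" "e < length bs" "j = ?a + d" "d < length bs"
        using split[OF ij(1)] split[OF ij(2)] by blast
      then show "(as @ bs) ! i < (as @ bs) ! j \<longleftrightarrow> ?\<rho> ! i < ?\<rho> ! j"
      proof cases
        case 1
        then show ?thesis using iso by (simp add: l1 \<rho>1 order_iso_def)
      next
        case (2 d)
        have "bs ! d < as ! i" "\<tau> ! d < \<sigma> ! i + length \<tau>" using big 2 lt lb by auto
        then show ?thesis using 2 by (simp add: l1 \<rho>1 l2 \<rho>2)
      next
        case (3 e)
        have "bs ! e < as ! j" "\<tau> ! e < \<sigma> ! j + length \<tau>" using big 3 lt lb by auto
        then show ?thesis using 3 by (simp add: l1 \<rho>1 l2 \<rho>2)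
      next
        case (4 e d)
        then have "bs ! e < bs ! d \<longleftrightarrow> \<tau> ! e < \<tau> ! d" using iso by (simp add: order_iso_def)
        then show ?thesis unfolding 4(1,3) l2 \<rho>2 .
      qed
    qed
  qed
qed

lemma order_iso_pats:
  "order_iso [x, y, z] [2, 1, 3] \<longleftrightarrow> pat213 x y z"
  "order_iso [x, y, z] [1, 2, 3] \<longleftrightarrow> pat123 x y z"
  "order_iso [x, y, z] [3, 1, 2] \<longleftrightarrow> pat312 x y z"
  by (auto simp: order_iso_def pat213_def pat123_def pat312_def All_less_Suc numeral_3_eq_3 numeral_2_eq_2)

section \<open>From diagrams as lists to closed sets of cells\<close>

text \<open>\<open>cells Y\<close> itself contains neither column 0 nor the rows above the diagram;
  by \<open>closure_cells\<close> the closure only adds cells of that kind.\<close>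

definition nw_closure :: "(nat \<times> nat) set \<Rightarrow> (nat \<times> nat) set" where
  "nw_closure S = {(x, y). \<exists>(x', y')\<in>S. x \<le> x' \<and> y' \<le> y}"

lemma nw_closed_closure: "nw_closed (nw_closure S)"
  unfolding nw_closed_def nw_closure_def by (auto intro: order_trans)

lemma closure_cells:
  assumes Y: "young_diagram Y" and x: "1 \<le> x" and y: "y \<le> length Y"
  shows "(x, y) \<in> nw_closure (cells Y) \<longleftrightarrow> (x, y) \<in> cells Y"
proof
  assume "(x, y) \<in> nw_closure (cells Y)"
  then obtain x' y' where c: "(x', y') \<in> cells Y" "x \<le> x'" "y' \<le> y" by (auto simp: nw_closure_def)
  have "Y ! (length Y - y') \<le> Y ! (length Y - y)"
  proof (cases "y = y'")
    case False
    then have "length Y - y < length Y - y'" "length Y - y' < length Y"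
      using c y by (auto simp: cells_def)
    then show ?thesis
      using Y sorted_wrt_nth_less[of "(\<ge>)" Y "length Y - y" "length Y - y'"] by (simp add: young_diagram_def)
  qed simp
  then show "(x, y) \<in> cells Y" using c x y by (auto simp: cells_def)
qed (auto simp: nw_closure_def)

definition points :: "nat list \<Rightarrow> (nat \<times> nat) set" where
  "points p = (\<lambda>x. (x, p ! (x - 1))) ` {1..length p}"

text \<open>The last column and the least value of an occurrence of \<open>(\<sigma>|\<tau>)\<close>
  both belong to its \<open>\<tau>\<close> part. So the cell condition concerns that copy alone, and
  the \<open>\<sigma>\<close> part just has to lie to its north-west.\<close>

lemma contains_in_skew_sum:
  assumes \<tau>: "\<tau> \<in> permutations_of_set {1..k}" "k \<ge> 1"
    and \<sigma>: "length \<sigma> = 3" "\<forall>s\<in>set \<sigma>. 1 \<le> s" "\<And>x y z. order_iso [x, y, z] \<sigma> \<longleftrightarrow> Q x y z"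
    and Y: "young_diagram Y" and p: "length p = length Y" "set p = {1..length Y}"
  defines "Z \<equiv> nw_closure (cells Y)"
  shows "contains_in Y p (skew_sum \<sigma> \<tau>) \<longleftrightarrow> contains3 Q (white \<tau> Z (points p)) (points p)"
proof -
  define \<pi> where "\<pi> x = p ! (x - 1)" for x
  define n where "n = length Y"
  have \<tau>k: "length \<tau> = k" "\<forall>t\<in>set \<tau>. t \<le> length \<tau>"
    using \<tau> length_finite_permutations_of_set[of \<tau> "{1..k}"] by (auto simp: permutations_of_set_def)
  have pts: "(x, y) \<in> points p \<longleftrightarrow> x \<in> {1..n} \<and> y = \<pi> x" for x y
    using p by (auto simp: points_def \<pi>_def n_def)
  have \<pi>n: "\<pi> x \<in> {1..n}" if "x \<in> {1..n}" for x
  proof -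
    have "x - 1 < length p" using that p n_def by auto
    then have "\<pi> x \<in> set p" unfolding \<pi>_def by (rule nth_mem)
    then show ?thesis using p n_def by simp
  qed
  have Zc: "(x, y) \<in> Z \<longleftrightarrow> (x, y) \<in> cells Y" if "x \<in> {1..n}" "y \<in> {1..n}" for x y
    unfolding Z_def by (rule closure_cells[OF Y]) (use that n_def in auto)
  have iso: "order_iso (map \<pi> ([x, y, z] @ xs)) (skew_sum \<sigma> \<tau>) \<longleftrightarrow>
      Q (\<pi> x) (\<pi> y) (\<pi> z) \<and> order_iso (map \<pi> xs) \<tau> \<and>
      (\<forall>t\<in>set xs. \<pi> t < \<pi> x \<and> \<pi> t < \<pi> y \<and> \<pi> t < \<pi> z)" for x y z xs
    using order_iso_skew_sum[of "map \<pi> [x, y, z]" \<sigma> \<tau> "map \<pi> xs"] \<sigma> \<tau>k(2) by auto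
  have MinE: "Min (\<pi> ` set ([x, y, z] @ xs)) = Min (\<pi> ` set xs)"
    if ne: "xs \<noteq> []" and sm: "\<forall>t\<in>set xs. \<pi> t < \<pi> x \<and> \<pi> t < \<pi> y \<and> \<pi> t < \<pi> z" for x y z xs
  proof -
    obtain t where t: "t \<in> set xs" using ne by (cases xs) auto
    have "Min (\<pi> ` set xs) \<le> \<pi> t" using t by simp
    then have "Min (\<pi> ` set xs) < \<pi> x" "Min (\<pi> ` set xs) < \<pi> y" "Min (\<pi> ` set xs) < \<pi> z"
      using sm t by (meson le_less_trans)+
    then show ?thesis using ne by simp
  qed
  show ?thesis
  proof
    assume "contains_in Y p (skew_sum \<sigma> \<tau>)"
    then obtain xs where xs: "sorted_wrt (<) xs" "set xs \<subseteq> {1..n}" "order_iso (map \<pi> xs) (skew_sum \<sigma> \<tau>)"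
        "(last xs, Min (\<pi> ` set xs)) \<in> cells Y"
      using p unfolding contains_in_def \<pi>_def n_def by auto
    have "length xs = Suc (Suc (Suc k))"
      using xs(3) \<sigma>(1) \<tau>k by (simp add: order_iso_def skew_sum_def)
    then obtain x y z ys where "xs = x # y # z # ys" and ly: "length ys = k"
      by (auto simp: length_Suc_conv)
    then have xyz: "xs = [x, y, z] @ ys" by simp
    have ys: "ys \<noteq> []" using ly \<tau>(2) by auto
    have h: "Q (\<pi> x) (\<pi> y) (\<pi> z)" "order_iso (map \<pi> ys) \<tau>"
       "\<forall>t\<in>set ys. \<pi> t < \<pi> x \<and> \<pi> t < \<pi> y \<and> \<pi> t < \<pi> z"
      using xs(3) unfolding xyz iso by auto
    define ps where "ps = map (\<lambda>x. (x, \<pi> x)) ys"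
    have im: "snd ` set ps = \<pi> ` set ys" by (simp add: ps_def image_image)
    have Yz: "(last ys, Min (\<pi> ` set ys)) \<in> Z"
    proof -
      have "(last ys, Min (\<pi> ` set ys)) \<in> cells Y" using xs(4) ys MinE[OF ys h(3)] by (simp add: xyz)
      then show ?thesis by (auto simp: Z_def nw_closure_def)
    qed
    have occ: "occurrence \<tau> Z (points p) ps"
      unfolding occurrence_def im
    proof (intro conjI)
      show "ps \<noteq> []" using ys by (simp add: ps_def)
      show "set ps \<subseteq> points p" using xs(2) by (auto simp: ps_def pts xyz)
      show "sorted_wrt (\<lambda>p q. fst p < fst q) ps" using xs(1) by (simp add: ps_def xyz sorted_wrt_map)
      show "order_iso (map snd ps) \<tau>" using h(2) by (simp add: ps_def comp_def)
      show "(fst (last ps), Min (\<pi> ` set ys)) \<in> Z" using Yz ys by (simp add: ps_def last_map)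
    qed
    have wh: "(z, u) \<in> white \<tau> Z (points p)" if "\<forall>t\<in>set ys. \<pi> t < u" for u
    proof -
      have "\<forall>q\<in>set ps. z < fst q \<and> snd q < u" using that xs(1) by (auto simp: ps_def xyz)
      then show ?thesis unfolding white_def using occ by blast
    qed
    show "contains3 Q (white \<tau> Z (points p)) (points p)"
      unfolding contains3_def
    proof (intro exI conjI)
      show "(x, \<pi> x) \<in> points p" "(y, \<pi> y) \<in> points p" "(z, \<pi> z) \<in> points p"
        using xs(2) by (auto simp: pts xyz)
      show "x < y" "y < z" using xs(1) by (auto simp: xyz)
    qed (use h wh in auto)
  next
    assume "contains3 Q (white \<tau> Z (points p)) (points p)"
    then obtain x y z where xyz: "x \<in> {1..n}" "y \<in> {1..n}" "z \<in> {1..n}" "x < y" "y < z"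
      "Q (\<pi> x) (\<pi> y) (\<pi> z)" and wh: "(z, \<pi> x) \<in> white \<tau> Z (points p)"
      "(z, \<pi> y) \<in> white \<tau> Z (points p)" "(z, \<pi> z) \<in> white \<tau> Z (points p)"
      unfolding contains3_def pts by auto
    \<comment> \<open>The copy of \<open>\<tau>\<close> south-east of the lowest of the three white
      cells lies below all three values.\<close>
    define m where "m = min (\<pi> x) (min (\<pi> y) (\<pi> z))"
    have "(z, m) \<in> white \<tau> Z (points p)" using wh by (auto simp: m_def min_def)
    then obtain ps where occ: "occurrence \<tau> Z (points p) ps" and se: "\<forall>q\<in>set ps. z < fst q \<and> snd q < m"
      by (auto simp: white_def)
    define ys where "ys = map fst ps"
    have ps: "q \<in> set ps \<Longrightarrow> fst q \<in> {1..n} \<and> snd q = \<pi> (fst q)" for q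
      using occ pts[of "fst q" "snd q"] by (auto simp: occurrence_def)
    have ne: "ps \<noteq> []" "ys \<noteq> []" using occ by (auto simp: occurrence_def ys_def)
    have \<pi>ys: "map \<pi> ys = map snd ps" unfolding ys_def map_map by (rule map_cong) (use ps in auto)
    then have im: "\<pi> ` set ys = snd ` set ps" by (metis set_map)
    have ysn: "set ys \<subseteq> {1..n}" using ps by (auto simp: ys_def)
    have zy: "\<forall>t\<in>set ys. z < t" using se by (auto simp: ys_def)
    have small: "\<forall>t\<in>set ys. \<pi> t < \<pi> x \<and> \<pi> t < \<pi> y \<and> \<pi> t < \<pi> z"
    proof
      fix t assume "t \<in> set ys"
      then have "\<pi> t \<in> snd ` set ps" using im by blast
      then have "\<pi> t < m" using se by auto
      then show "\<pi> t < \<pi> x \<and> \<pi> t < \<pi> y \<and> \<pi> t < \<pi> z" by (simp add: m_def)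
    qed
    have cell: "(last ys, Min (\<pi> ` set ys)) \<in> cells Y"
    proof -
      have "(last ys, Min (\<pi> ` set ys)) \<in> Z" using occ ne unfolding im by (simp add: occurrence_def ys_def last_map)
      moreover have "last ys \<in> {1..n}" using ne(2) ysn last_in_set by blast
      moreover have "Min (\<pi> ` set ys) \<in> \<pi> ` set ys" using ne(2) by (intro Min_in) auto
      then have "Min (\<pi> ` set ys) \<in> {1..n}" using \<pi>n ysn by auto
      ultimately show ?thesis using Zc by blast
    qed
    have srt: "sorted_wrt (<) ([x, y, z] @ ys)"
    proof -
      have "sorted_wrt (<) ys" using occ by (simp add: ys_def occurrence_def sorted_wrt_map)
      moreover have "\<forall>t\<in>set ys. x < t \<and> y < t \<and> z < t" using zy xyz(4,5) by auto
      ultimately show ?thesis using xyz(4,5) by auto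
    qed
    have "order_iso (map \<pi> ([x, y, z] @ ys)) (skew_sum \<sigma> \<tau>)"
      unfolding iso using xyz(6) small occ \<pi>ys by (simp add: occurrence_def)
    moreover have "(last ([x, y, z] @ ys), Min (\<pi> ` set ([x, y, z] @ ys))) \<in> cells Y"
      unfolding MinE[OF ne(2) small] using cell ne(2) by simp
    moreover have "set ([x, y, z] @ ys) \<subseteq> {1..length p}" using xyz(1-3) ysn p n_def by auto
    ultimately show "contains_in Y p (skew_sum \<sigma> \<tau>)"
      unfolding contains_in_def \<pi>_def[symmetric, abs_def] using srt by (intro exI[of _ "[x, y, z] @ ys"]) (simp only: simp_thms)
  qed
qed

lemma points_transversals:
  assumes Y: "young_diagram Y"
  defines "n \<equiv> length Y"
  shows "inj_on points (transversals Y)"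
    "points ` transversals Y = {T. transversal {1..n} {1..n} (nw_closure (cells Y)) T}"
proof -
  \<comment> \<open>For the full plane with zero bounds \<open>trans_lists\<close> consists of all
    permutations, so the bijection \<open>graph\<close> can be reused; the diagram is imposed
    afterwards by \<open>mem\<close>.\<close>
  interpret compression "[1..<Suc n]" "[1..<Suc n]" "replicate n 0" UNIV
    by unfold_locales (auto simp del: upt_Suc)
  have tl: "p \<in> trans_lists (replicate n 0) \<longleftrightarrow> p \<in> permutations_of_set {1..n}" for p
    using length_finite_permutations_of_set[of p "{1..n}"]
    by (auto simp: trans_lists_def permutations_of_set_def) (metis Suc_le_eq atLeastAtMost_iff nth_mem One_nat_def)
  have gr: "graph p = points p" if "p \<in> permutations_of_set {1..n}" for p
  proof -
    have p: "length p = n" "set p = {1..n}"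
      using that length_finite_permutations_of_set[of p "{1..n}"] by (auto simp: permutations_of_set_def)
    have "cell p i = (Suc i, p ! i)" if "i < n" for i
    proof -
      have "p ! i \<in> {1..n}" using p that by (metis nth_mem)
      then show ?thesis unfolding cell_def using that by (auto simp del: upt_Suc)
    qed
    then have "graph p = (\<lambda>i. (Suc i, p ! i)) ` {..<n}"
      unfolding graph_def length_replicate by (intro image_cong refl) simp
    also have "\<dots> = points p"
      unfolding points_def p image_Suc_lessThan[symmetric] image_image by simp
    finally show ?thesis .
  qed
  have sub: "transversals Y \<subseteq> trans_lists (replicate n 0)"
  proof
    fix p assume "p \<in> transversals Y"
    then have "p \<in> permutations_of_set {1..n}" by (simp add: transversals_def n_def)
    then show "p \<in> trans_lists (replicate n 0)" unfolding tl .
  qed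
  have "inj_on graph (transversals Y)" using graph_inj sub inj_on_subset by blast
  moreover have "graph p = points p" if "p \<in> transversals Y" for p
    using gr[of p] that by (simp add: transversals_def n_def)
  ultimately show "inj_on points (transversals Y)" by (simp add: inj_on_def)
  have mem: "p \<in> transversals Y \<longleftrightarrow> points p \<subseteq> nw_closure (cells Y)" if "p \<in> permutations_of_set {1..n}" for p
  proof -
    have p: "length p = n" "set p = {1..n}"
      using that length_finite_permutations_of_set[of p "{1..n}"] by (auto simp: permutations_of_set_def)
    have "(x, p ! (x - 1)) \<in> nw_closure (cells Y) \<longleftrightarrow> (x, p ! (x - 1)) \<in> cells Y" if "x \<in> {1..n}" for x
    proof (rule closure_cells[OF Y])
      have "x - 1 < length p" using that p by auto
      then have "p ! (x - 1) \<in> {1..n}" using p nth_mem by blast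
      then show "p ! (x - 1) \<le> length Y" by (simp add: n_def)
    qed (use that in simp)
    then show ?thesis using that p by (auto simp: transversals_def points_def n_def)
  qed
  have set_n: "set [1..<Suc n] = {1..n}" by auto
  show "points ` transversals Y = {T. transversal {1..n} {1..n} (nw_closure (cells Y)) T}"
  proof (intro set_eqI iffI)
    fix T assume "T \<in> points ` transversals Y"
    then obtain p where p: "p \<in> transversals Y" "T = points p" by blast
    then have pp: "p \<in> permutations_of_set {1..n}" by (simp add: transversals_def n_def)
    have "transversal {1..n} {1..n} UNIV T"
      using graph_transversal[of p] tl pp gr[OF pp] p(2) unfolding set_n by simp
    moreover have "T \<subseteq> nw_closure (cells Y)" using mem[OF pp] p by simp
    ultimately show "T \<in> {T. transversal {1..n} {1..n} (nw_closure (cells Y)) T}"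
      by (simp add: transversal_def)
  next
    fix T assume "T \<in> {T. transversal {1..n} {1..n} (nw_closure (cells Y)) T}"
    then have T: "transversal {1..n} {1..n} (nw_closure (cells Y)) T" by simp
    then have "transversal (set [1..<Suc n]) (set [1..<Suc n]) UNIV T"
      unfolding set_n by (simp add: transversal_def)
    then obtain p where p: "p \<in> trans_lists (replicate n 0)" "T = graph p" by (rule graph_surj)
    then have pp: "p \<in> permutations_of_set {1..n}" "T = points p" using tl gr by auto
    have "p \<in> transversals Y" using mem[OF pp(1)] T pp(2) by (simp add: transversal_def)
    then show "T \<in> points ` transversals Y" using pp(2) by blast
  qed
qed

lemma card_transversals_avoiding_skew_sum:
  assumes \<tau>: "\<tau> \<in> permutations_of_set {1..k}" "k \<ge> 1"
    and \<sigma>: "length \<sigma> = 3" "\<forall>s\<in>set \<sigma>. 1 \<le> s" "\<And>x y z. order_iso [x, y, z] \<sigma> \<longleftrightarrow> Q x y z"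
    and Y: "young_diagram Y"
  defines "Z \<equiv> nw_closure (cells Y)"
  shows "card (transversals_avoiding Y (skew_sum \<sigma> \<tau>)) =
    (\<Sum>M\<in>cores \<tau> {1..length Y} {1..length Y} Z. card (residual Q \<tau> {1..length Y} {1..length Y} Z M))"
proof -
  let ?n = "length Y"
  have c: "contains_in Y p (skew_sum \<sigma> \<tau>) \<longleftrightarrow> contains3 Q (white \<tau> Z (points p)) (points p)"
    if "p \<in> transversals Y" for p
    unfolding Z_def
  proof (rule contains_in_skew_sum[OF \<tau> \<sigma> Y])
    show "length p = ?n" "set p = {1..?n}"
      using that length_finite_permutations_of_set[of p "{1..?n}"]
      by (auto simp: transversals_def permutations_of_set_def)
  qed
  have sub: "transversals_avoiding Y (skew_sum \<sigma> \<tau>) \<subseteq> transversals Y" by (auto simp: transversals_avoiding_def)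
  have "points ` transversals_avoiding Y (skew_sum \<sigma> \<tau>) =
      {T \<in> points ` transversals Y. \<not> contains3 Q (white \<tau> Z T) T}"
    using c by (auto simp: transversals_avoiding_def)
  also have "\<dots> = {T. transversal {1..?n} {1..?n} Z T \<and> \<not> contains3 Q (white \<tau> Z T) T}"
    unfolding points_transversals(2)[OF Y] Z_def by simp
  finally have "card (transversals_avoiding Y (skew_sum \<sigma> \<tau>)) =
      card {T. transversal {1..?n} {1..?n} Z T \<and> \<not> contains3 Q (white \<tau> Z T) T}"
    using card_image[OF inj_on_subset[OF points_transversals(1)[OF Y] sub]] by simp
  then show ?thesis using card_skew_avoiding[of Z "{1..?n}" "{1..?n}" Q \<tau>] nw_closed_closure
    by (simp add: Z_def)
qed

section \<open>Classical avoidance as the case of a square\<close>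

lemma cells_square: "cells (replicate n n) = {1..n} \<times> {1..n}"
  by (auto simp: cells_def)

lemma young_diagram_square: "young_diagram (replicate n n)"
  by (auto simp: young_diagram_def sorted_wrt_iff_nth_less)

lemma subseq_iff_sorted_indices:
  "subseq ys p \<longleftrightarrow> (\<exists>xs. sorted_wrt (<) xs \<and> set xs \<subseteq> {1..length p} \<and> ys = map (\<lambda>x. p ! (x - 1)) xs)"
proof -
  let ?I = "[1..<Suc (length p)]" and ?f = "\<lambda>x. p ! (x - 1)"
  have p: "map ?f ?I = p" by (rule nth_equalityI) (auto simp del: upt_Suc)
  show ?thesis
  proof
    assume "subseq ys p"
    then obtain N where "ys = nths (map ?f ?I) N" unfolding p subseq_conv_nths by blast
    then have "ys = map ?f (nths ?I N)" by (simp only: nths_map)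
    moreover have "sorted_wrt (<) (nths ?I N)"
      unfolding strict_sorted_iff by (intro conjI sorted_nths distinct_nthsI) (simp_all del: upt_Suc)
    moreover have "set (nths ?I N) \<subseteq> {1..length p}"
      using set_nths_subset[of ?I N] by (auto simp del: upt_Suc)
    ultimately show "\<exists>xs. sorted_wrt (<) xs \<and> set xs \<subseteq> {1..length p} \<and> ys = map ?f xs" by blast
  next
    assume "\<exists>xs. sorted_wrt (<) xs \<and> set xs \<subseteq> {1..length p} \<and> ys = map ?f xs"
    then obtain xs where xs: "sorted_wrt (<) xs" "set xs \<subseteq> {1..length p}" "ys = map ?f xs" by blast
    have "xs = filter (\<lambda>x. x \<in> set xs) ?I"
      using xs(1,2) by (intro strict_sorted_equal) (auto simp: sorted_wrt_filter simp del: upt_Suc)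
    then have "subseq xs ?I" by (metis subseq_filter_left)
    then show "subseq ys p" unfolding xs(3) using subseq_map[of xs ?I ?f] p by simp
  qed
qed

text \<open>In a square the cell condition holds for every occurrence; a nonempty
  \<open>\<rho>\<close> keeps \<open>last\<close> and \<open>Min\<close> specified.\<close>

lemma perms_avoiding_eq:
  assumes "n \<ge> 1" "\<rho> \<noteq> []"
  shows "perms_avoiding n \<rho> = transversals_avoiding (replicate n n) \<rho>"
proof -
  have t: "transversals (replicate n n) = permutations_of_set {1..n}"
  proof (intro set_eqI iffI)
    fix p assume p: "p \<in> permutations_of_set {1..n}"
    have "p ! (x - 1) \<in> {1..n}" if "x \<in> {1..n}" for x
    proof -
      have "x - 1 < length p" using p that length_finite_permutations_of_set[OF p] by auto
      then have "p ! (x - 1) \<in> set p" by (rule nth_mem)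
      then show ?thesis using p by (simp add: permutations_of_set_def)
    qed
    then show "p \<in> transversals (replicate n n)" using p by (simp add: transversals_def cells_square)
  qed (simp add: transversals_def)
  have "perm_contains p \<rho> \<longleftrightarrow> contains_in (replicate n n) p \<rho>" if p: "p \<in> permutations_of_set {1..n}" for p
  proof -
    let ?f = "\<lambda>x. p ! (x - 1)"
    have lp: "length p = n" "set p = {1..n}"
      using length_finite_permutations_of_set[OF p] p by (auto simp: permutations_of_set_def)
    have cell: "(last xs, Min (?f ` set xs)) \<in> cells (replicate n n)"
      if xs: "set xs \<subseteq> {1..length p}" "order_iso (map ?f xs) \<rho>" for xs
    proof -
      have ne: "xs \<noteq> []" using xs(2) assms(2) by (auto simp: order_iso_def)
      then have "last xs \<in> {1..n}" using xs(1) lp last_in_set by blast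
      moreover have "Min (?f ` set xs) \<in> ?f ` set xs" using ne by (intro Min_in) auto
      then obtain x where "x \<in> set xs" "Min (?f ` set xs) = p ! (x - 1)" by blast
      moreover from this have "x - 1 < length p" using xs(1) by force
      then have "p ! (x - 1) \<in> {1..n}" using nth_mem lp by blast
      ultimately show ?thesis by (simp add: cells_square)
    qed
    show ?thesis unfolding perm_contains_def contains_in_def subseq_iff_sorted_indices
      using cell by blast
  qed
  then show ?thesis unfolding perms_avoiding_def transversals_avoiding_def t by auto
qed

section \<open>Strictness\<close>

locale separation =
  fixes \<tau> :: "nat list" and k f :: nat
  assumes \<tau>: "\<tau> \<in> permutations_of_set {1..k}" and k: "1 \<le> k"
begin

definition n :: nat where "n = 2 * k + 5 + f"
definition Z :: "(nat \<times> nat) set" where "Z = nw_closure ({1..n} \<times> {1..n})"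

text \<open>The core consisting of two copies of \<open>\<tau>\<close>, the upper right one followed by an increasing run
  of length \<open>f\<close>, leaves over a square of side five without its bottom right corner. This is a
  shape on which all three patterns differ; the run only serves to fill up the size \<open>n\<close>.\<close>

definition A :: "(nat \<times> nat) set" where "A = (\<lambda>i. (5 + i, \<tau> ! i)) ` {..<k}"
definition B :: "(nat \<times> nat) set" where "B = (\<lambda>i. (6 + k + i, k + 1 + \<tau> ! i)) ` {..<k}"
definition D :: "(nat \<times> nat) set" where "D = (\<lambda>i. (6 + 2 * k + i, 2 * k + 2 + i)) ` {..<f}"
definition M :: "(nat \<times> nat) set" where "M = A \<union> B \<union> D"

lemma len: "length \<tau> = k" and set_\<tau>: "set \<tau> = {1..k}" and dist: "distinct \<tau>"
  using \<tau> length_finite_permutations_of_set[of \<tau> "{1..k}"] by (auto simp: permutations_of_set_def)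

lemma \<tau>_range: "i < k \<Longrightarrow> 1 \<le> \<tau> ! i \<and> \<tau> ! i \<le> k"
  using len set_\<tau> nth_mem[of i \<tau>] by auto

lemma \<tau>_image: "(\<lambda>i. \<tau> ! i) ` {..<k} = {1..k}"
  using set_\<tau> len nth_image[of k \<tau>] by (simp add: lessThan_atLeast0)

lemma Z: "(x, y) \<in> Z \<longleftrightarrow> x \<le> n \<and> 1 \<le> y"
proof
  assume "x \<le> n \<and> 1 \<le> y"
  moreover have "1 \<le> n" by (simp add: n_def)
  ultimately have "(n, 1) \<in> {1..n} \<times> {1..n}" "x \<le> n" "1 \<le> y" by auto
  then show "(x, y) \<in> Z" unfolding Z_def nw_closure_def by blast
qed (auto simp: Z_def nw_closure_def)

lemma nwZ: "nw_closed Z"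
  unfolding Z_def by (rule nw_closed_closure)

lemma M_bounds: "M \<subseteq> {1..n} \<times> {1..n}"
  using \<tau>_range by (fastforce simp: M_def A_def B_def D_def n_def)

lemma M_Z: "M \<subseteq> Z"
  using M_bounds Z by auto

lemma occurrence_of_copy:
  assumes "(\<lambda>i. (c + i, d + \<tau> ! i)) ` {..<k} \<subseteq> M"
  shows "occurrence \<tau> Z M (map (\<lambda>i. (c + i, d + \<tau> ! i)) [0..<k])" (is "occurrence _ _ _ ?ps")
proof -
  have sub: "set ?ps \<subseteq> M" using assms by (simp add: lessThan_atLeast0)
  have ne: "?ps \<noteq> []" using k by simp
  have "last ?ps \<in> M" using sub ne last_in_set by blast
  moreover have "Min (snd ` set ?ps) \<in> snd ` set ?ps" using ne by (intro Min_in) auto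
  then obtain q where "q \<in> M" "Min (snd ` set ?ps) = snd q" using sub by blast
  ultimately have "(fst (last ?ps), Min (snd ` set ?ps)) \<in> Z" unfolding Z using M_bounds by fastforce
  moreover have "order_iso (map snd ?ps) \<tau>" by (simp add: order_iso_def len)
  moreover have "sorted_wrt (\<lambda>p q. fst p < fst q) ?ps" by (simp add: sorted_wrt_map)
  ultimately show ?thesis using sub ne by (simp add: occurrence_def)
qed

lemma white_copy:
  assumes "(\<lambda>i. (c + i, d + \<tau> ! i)) ` {..<k} \<subseteq> M" "x < c" "d + k < y"
  shows "(x, y) \<in> white \<tau> Z M"
proof -
  have "\<forall>q\<in>set (map (\<lambda>i. (c + i, d + \<tau> ! i)) [0..<k]). x < fst q \<and> snd q < y"
    using assms(2,3) \<tau>_range by fastforce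
  then show ?thesis unfolding white_def using occurrence_of_copy[OF assms(1)] by blast
qed

text \<open>Used in contrapositive form to show that cells are not white: whatever
  \<open>\<tau>\<close> is, a copy of it needs \<open>k\<close> points to the south-east.\<close>

lemma white_card:
  assumes "(x, y) \<in> white \<tau> Z M"
  shows "k \<le> card {q \<in> M. x < fst q \<and> snd q < y}"
proof -
  obtain ps where ps: "occurrence \<tau> Z M ps" "\<forall>q\<in>set ps. x < fst q \<and> snd q < y"
    using assms by (auto simp: white_def)
  have "sorted_wrt (<) (map fst ps)" using ps(1) by (simp add: occurrence_def sorted_wrt_map)
  then have "distinct (map fst ps)" by (simp add: strict_sorted_iff)
  then have "distinct ps" by (simp add: distinct_map)
  moreover have "length ps = k" using ps(1) len by (simp add: occurrence_def order_iso_def)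
  ultimately have "card (set ps) = k" by (simp add: distinct_card)
  moreover have "finite M" using M_bounds by (rule finite_subset) simp
  then have "card (set ps) \<le> card {q \<in> M. x < fst q \<and> snd q < y}"
    using ps by (intro card_mono) (auto simp: occurrence_def)
  ultimately show ?thesis by simp
qed

lemma card_AB: "card A \<le> k" "card B \<le> k" "finite A" "finite B"
  unfolding A_def B_def using card_image_le[of "{..<k}"] by auto

text \<open>South-east of a point of \<open>A\<close> or \<open>B\<close> there are only other
  points of the same copy, fewer than \<open>k\<close>; south-east of a point of \<open>D\<close>
  there are none.\<close>

lemma M_white_disjoint: "M \<inter> white \<tau> Z M = {}"
proof -
  have False if q: "q \<in> M" "q \<in> white \<tau> Z M" for q
  proof -
    let ?S = "{r \<in> M. fst q < fst r \<and> snd r < snd q}"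
    have c: "k \<le> card ?S" using white_card[of "fst q" "snd q"] q(2) by simp
    consider "q \<in> A" | "q \<in> B" | "q \<in> D" using q(1) M_def by blast
    then show False
    proof cases
      case 1
      then have "?S \<subseteq> A - {q}" using \<tau>_range unfolding M_def A_def B_def D_def by fastforce
      then have "card ?S \<le> card (A - {q})" using card_AB by (intro card_mono) auto
      also have "\<dots> < card A" using 1 card_AB(3) by (rule card_Diff1_less[rotated])
      finally show False using c card_AB by simp
    next
      case 2
      then have "?S \<subseteq> B - {q}" using \<tau>_range unfolding M_def A_def B_def D_def by fastforce
      then have "card ?S \<le> card (B - {q})" using card_AB by (intro card_mono) auto
      also have "\<dots> < card B" using 2 card_AB(4) by (rule card_Diff1_less[rotated])
      finally show False using c card_AB by simp
    next
      case 3
      then have "?S = {}" unfolding M_def A_def B_def D_def by auto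
      then have "card ?S = 0" by (simp only: card.empty)
      then show False using c k by linarith
    qed
  qed
  then show ?thesis by blast
qed

text \<open>Free are four columns left of both copies and one between them, one row between the
  copies and four above everything. The lower copy whitens all these rows in the first four columns.
  Column \<open>k + 5\<close> has only the upper copy to its right, which whitens the four top rows
  but not row \<open>k + 1\<close>: this is the missing corner.\<close>

definition cols :: "nat list" where "cols = [1, 2, 3, 4, k + 5]"
definition rows :: "nat list" where "rows = [k + 1, n - 3, n - 2, n - 1, n]"
definition b :: "nat list" where "b = [0, 0, 0, 0, 1]"

lemma less_5: "i < 5 \<longleftrightarrow> i = 0 \<or> i = 1 \<or> i = 2 \<or> i = 3 \<or> i = (4 :: nat)"
  by auto

sublocale compression cols rows b "white \<tau> Z M"
proof
  show "sorted_wrt (<) cols" "length cols = length b" "length rows = length b"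
    by (auto simp: cols_def rows_def b_def)
  show "sorted_wrt (<) rows" by (auto simp: rows_def n_def)
  fix i j assume ij: "i < length b" "j < length b"
  have l5: "length b = 5" by (simp add: b_def)
  have rj: "k + 1 \<le> rows ! j" "1 \<le> j \<Longrightarrow> 2 * k + 2 \<le> rows ! j"
    using ij(2) unfolding l5 less_5 by (auto simp: rows_def n_def)
  show "(cols ! i, rows ! j) \<in> white \<tau> Z M \<longleftrightarrow> b ! i \<le> j"
  proof (cases "i = 4")
    case False
    then have "cols ! i < 5" "b ! i = 0" using ij(1) unfolding l5 less_5 by (auto simp: cols_def b_def)
    moreover have "(\<lambda>i. (5 + i, 0 + \<tau> ! i)) ` {..<k} \<subseteq> M" unfolding M_def A_def by auto
    from white_copy[OF this] have "(cols ! i, rows ! j) \<in> white \<tau> Z M" using rj(1) calculation(1) by simp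
    ultimately show ?thesis by simp
  next
    case True
    then have i: "cols ! i = k + 5" "b ! i = 1" by (auto simp: cols_def b_def)
    show ?thesis
    proof (cases "1 \<le> j")
      case j: True
      have "(\<lambda>i. (6 + k + i, k + 1 + \<tau> ! i)) ` {..<k} \<subseteq> M" unfolding M_def B_def by auto
      from white_copy[OF this] have "(cols ! i, rows ! j) \<in> white \<tau> Z M" using rj(2)[OF j] i by simp
      then show ?thesis using j i by simp
    next
      case False
      then have "j = 0" by simp
      then have r: "rows ! j = k + 1" by (simp add: rows_def)
      \<comment> \<open>Everything to the right of column \<open>k + 5\<close> lies above row
        \<open>k + 1\<close>.\<close>
      have "{q \<in> M. k + 5 < fst q \<and> snd q < k + 1} = {}"
        using \<tau>_range unfolding M_def A_def B_def D_def by auto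
      then have "card {q \<in> M. k + 5 < fst q \<and> snd q < k + 1} = 0" by (simp only: card.empty)
      then have "(k + 5, k + 1) \<notin> white \<tau> Z M" using white_card[of "k + 5" "k + 1"] k by linarith
      then show ?thesis using i r False by simp
    qed
  qed
qed

lemma fst_M: "{1..n} - fst ` M = set cols"
proof -
  have "fst ` M = (+) 5 ` {..<k} \<union> (+) (6 + k) ` {..<k} \<union> (+) (6 + 2 * k) ` {..<f}"
    unfolding M_def A_def B_def D_def image_Un image_image by simp
  also have "\<dots> = {5..<5 + k} \<union> {6 + k..<6 + k + k} \<union> {6 + 2 * k..<6 + 2 * k + f}"
    by (simp only: lessThan_atLeast0 image_add_atLeastLessThan) (simp add: ac_simps)
  finally have *: "fst ` M = {5..<5 + k} \<union> {6 + k..<6 + k + k} \<union> {6 + 2 * k..<6 + 2 * k + f}" .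
  show ?thesis unfolding * cols_def n_def by auto
qed

lemma snd_M: "{1..n} - snd ` M = set rows"
proof -
  have "snd ` M = (\<lambda>i. \<tau> ! i) ` {..<k} \<union> (+) (k + 1) ` (\<lambda>i. \<tau> ! i) ` {..<k} \<union> (+) (2 * k + 2) ` {..<f}"
    unfolding M_def A_def B_def D_def image_Un image_image by simp
  also have "\<dots> = {1..k} \<union> {k + 1 + 1..k + 1 + k} \<union> {2 * k + 2..<2 * k + 2 + f}"
    unfolding \<tau>_image by (simp only: lessThan_atLeast0 image_add_atLeastLessThan image_add_atLeastAtMost) (simp add: ac_simps)
  finally have *: "snd ` M = {1..k} \<union> {k + 1 + 1..k + 1 + k} \<union> {2 * k + 2..<2 * k + 2 + f}" .
  show ?thesis unfolding * rows_def n_def by auto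
qed

lemma block_iff:
  assumes "p \<in> M"
  shows "p \<in> A \<longleftrightarrow> fst p < 5 + k" "p \<in> A \<longleftrightarrow> snd p < k + 1"
    "p \<in> D \<longleftrightarrow> 6 + 2 * k \<le> fst p" "p \<in> D \<longleftrightarrow> 2 * k + 2 \<le> snd p"
proof -
  have "p \<in> A \<Longrightarrow> fst p < 5 + k \<and> snd p < k + 1"
    "p \<in> B \<Longrightarrow> 6 + k \<le> fst p \<and> fst p < 6 + 2 * k \<and> k + 2 \<le> snd p \<and> snd p < 2 * k + 2"
    using \<tau>_range by (force simp: A_def B_def)+
  moreover have "p \<in> D \<Longrightarrow> 6 + 2 * k \<le> fst p \<and> 2 * k + 2 \<le> snd p"
    by (auto simp: D_def)
  ultimately show "p \<in> A \<longleftrightarrow> fst p < 5 + k" "p \<in> A \<longleftrightarrow> snd p < k + 1"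
    "p \<in> D \<longleftrightarrow> 6 + 2 * k \<le> fst p" "p \<in> D \<longleftrightarrow> 2 * k + 2 \<le> snd p"
    using assms unfolding M_def by force+
qed

lemma inj_M: "inj_on fst M" "inj_on snd M"
proof -
  have nth: "\<tau> ! i = \<tau> ! j \<longleftrightarrow> i = j" if "i < k" "j < k" for i j
    using that dist len by (simp add: nth_eq_iff_index_eq)
  have fst: "inj_on fst A" "inj_on fst B" "inj_on fst D"
    by (auto simp: A_def B_def D_def inj_on_def)
  have snd: "inj_on snd A" "inj_on snd B" "inj_on snd D"
    by (auto simp: A_def B_def D_def inj_on_def nth)
  have same: "(p \<in> A \<and> q \<in> A) \<or> (p \<in> B \<and> q \<in> B) \<or> (p \<in> D \<and> q \<in> D)"
    if "p \<in> M" "q \<in> M" "p \<in> A \<longleftrightarrow> q \<in> A" "p \<in> D \<longleftrightarrow> q \<in> D" for p q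
    using that unfolding M_def by blast
  show "inj_on fst M"
  proof (rule inj_onI)
    fix p q assume pq: "p \<in> M" "q \<in> M" "fst p = fst q"
    have "(p \<in> A \<and> q \<in> A) \<or> (p \<in> B \<and> q \<in> B) \<or> (p \<in> D \<and> q \<in> D)"
      using pq by (intro same) (simp_all add: block_iff(1,3))
    then show "p = q" using fst pq(3) by (auto dest: inj_onD)
  qed
  show "inj_on snd M"
  proof (rule inj_onI)
    fix p q assume pq: "p \<in> M" "q \<in> M" "snd p = snd q"
    have "(p \<in> A \<and> q \<in> A) \<or> (p \<in> B \<and> q \<in> B) \<or> (p \<in> D \<and> q \<in> D)"
      using pq by (intro same) (simp_all add: block_iff(2,4))
    then show "p = q" using snd pq(3) by (auto dest: inj_onD)
  qed
qed

lemma M_core: "M \<in> cores \<tau> {1..n} {1..n} Z"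
proof (rule coresI[OF nwZ M_Z inj_M _ _ _ M_white_disjoint])
  show "fst ` M \<subseteq> {1..n}" "snd ` M \<subseteq> {1..n}" using M_bounds by auto
  \<comment> \<open>Any transversal of the remaining shape would do; the increasing one avoids the
    missing corner.\<close>
  have "[1, 2, 3, 4, 5] \<in> trans_lists b"
    by (auto simp: trans_lists_def b_def less_Suc_eq)
  then show "transversal ({1..n} - fst ` M) ({1..n} - snd ` M) (white \<tau> Z M) (graph [1, 2, 3, 4, 5])"
    unfolding fst_M snd_M by (rule graph_transversal)
qed

lemma card_residual_M:
  "order_invariant Q \<Longrightarrow> card (residual Q \<tau> {1..n} {1..n} Z M) = card (avoid_lists Q [0, 0, 0, 0, 1])"
  unfolding residual_def fst_M snd_M card_avoid_sets b_def[symmetric] ..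

end

section \<open>Transfer to the patterns with \<open>\<tau>\<close> attached\<close>

lemma shape_le_skew_sum:
  assumes \<tau>: "\<tau> \<in> permutations_of_set {1..k}" "k \<ge> 1"
    and \<sigma>: "length \<sigma> = 3" "\<forall>s\<in>set \<sigma>. 1 \<le> s" "\<And>x y z. order_iso [x, y, z] \<sigma> \<longleftrightarrow> Q x y z"
    and \<sigma>': "length \<sigma>' = 3" "\<forall>s\<in>set \<sigma>'. 1 \<le> s" "\<And>x y z. order_iso [x, y, z] \<sigma>' \<longleftrightarrow> Q' x y z"
    and Q: "order_invariant Q" "order_invariant Q'"
    and le: "\<And>b. sorted b \<Longrightarrow> \<forall>i<length b. b ! i \<le> i \<Longrightarrow>
      card (avoid_lists Q b) \<le> card (avoid_lists Q' b)"
  shows "skew_sum \<sigma> \<tau> \<preceq>\<^sub>s skew_sum \<sigma>' \<tau>"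
  unfolding shape_le_def
proof (intro allI impI)
  fix Y assume "proper_diagram Y"
  then have Y: "young_diagram Y" by (simp add: proper_diagram_def)
  show "card (transversals_avoiding Y (skew_sum \<sigma> \<tau>)) \<le> card (transversals_avoiding Y (skew_sum \<sigma>' \<tau>))"
    unfolding card_transversals_avoiding_skew_sum[OF \<tau> \<sigma> Y] card_transversals_avoiding_skew_sum[OF \<tau> \<sigma>' Y]
      residual_def
    by (intro sum_mono card_avoid_sets_le le Q nw_closed_white) auto
qed

text \<open>Every core contributes a weak inequality and \<open>sep.M\<close> a strict one; the
  surplus \<open>n - (2 * k + 5)\<close> is the length of the run \<open>D\<close>.\<close>

lemma card_perms_avoiding_skew_sum_less:
  assumes \<tau>: "\<tau> \<in> permutations_of_set {1..k}" "k \<ge> 1" and n: "n \<ge> 2 * k + 5"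
    and \<sigma>: "length \<sigma> = 3" "\<forall>s\<in>set \<sigma>. 1 \<le> s" "\<And>x y z. order_iso [x, y, z] \<sigma> \<longleftrightarrow> Q x y z"
    and \<sigma>': "length \<sigma>' = 3" "\<forall>s\<in>set \<sigma>'. 1 \<le> s" "\<And>x y z. order_iso [x, y, z] \<sigma>' \<longleftrightarrow> Q' x y z"
    and Q: "order_invariant Q" "order_invariant Q'"
    and le: "\<And>b. sorted b \<Longrightarrow> \<forall>i<length b. b ! i \<le> i \<Longrightarrow>
      card (avoid_lists Q b) \<le> card (avoid_lists Q' b)"
    and less: "card (avoid_lists Q [0, 0, 0, 0, 1]) < card (avoid_lists Q' [0, 0, 0, 0, 1])"
  shows "card (perms_avoiding n (skew_sum \<sigma> \<tau>)) < card (perms_avoiding n (skew_sum \<sigma>' \<tau>))"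
proof -
  interpret sep: separation \<tau> k "n - (2 * k + 5)" by unfold_locales (use \<tau> in auto)
  have nn: "sep.n = n" using n by (simp add: sep.n_def)
  let ?Z = "nw_closure ({1..n} \<times> {1..n})"
  have Z: "sep.Z = ?Z" by (simp only: sep.Z_def nn)
  have ne: "skew_sum \<sigma> \<tau> \<noteq> []" "skew_sum \<sigma>' \<tau> \<noteq> []" "n \<ge> 1"
    using \<sigma>(1) \<sigma>'(1) n by (auto simp: skew_sum_def)
  have "(\<Sum>M\<in>cores \<tau> {1..n} {1..n} ?Z. card (residual Q \<tau> {1..n} {1..n} ?Z M)) <
      (\<Sum>M\<in>cores \<tau> {1..n} {1..n} ?Z. card (residual Q' \<tau> {1..n} {1..n} ?Z M))"
  proof (rule sum_strict_mono_ex1)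
    show "finite (cores \<tau> {1..n} {1..n} ?Z)"
      unfolding cores_def by (intro finite_imageI finite_transversals) auto
    show "\<forall>M\<in>cores \<tau> {1..n} {1..n} ?Z.
        card (residual Q \<tau> {1..n} {1..n} ?Z M) \<le> card (residual Q' \<tau> {1..n} {1..n} ?Z M)"
      unfolding residual_def by (intro ballI card_avoid_sets_le le Q nw_closed_white) auto
    show "\<exists>M\<in>cores \<tau> {1..n} {1..n} ?Z.
        card (residual Q \<tau> {1..n} {1..n} ?Z M) < card (residual Q' \<tau> {1..n} {1..n} ?Z M)"
      using sep.M_core sep.card_residual_M[OF Q(1)] sep.card_residual_M[OF Q(2)] less
      unfolding nn Z by (intro bexI[of _ sep.M]) simp_all
  qed
  then show ?thesis
    unfolding perms_avoiding_eq[OF ne(3,1)] perms_avoiding_eq[OF ne(3,2)]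
      card_transversals_avoiding_skew_sum[OF \<tau> \<sigma> young_diagram_square]
      card_transversals_avoiding_skew_sum[OF \<tau> \<sigma>' young_diagram_square]
      length_replicate cells_square .
qed

lemma card_avoid_lists_123_le_312:
  assumes "sorted b" "\<forall>i<length b. b ! i \<le> i"
  shows "card (avoid_lists pat123 b) \<le> card (avoid_lists pat312 b)"
  using card_avoid_lists_123_le_321[OF assms] card_avoid_lists_321_le_312[OF assms(1)] by (rule order_trans)

theorem corollary1:
  fixes k :: nat and \<tau> :: "nat list"
  assumes "k \<ge> 1" and "\<tau> \<in> permutations_of_set {1..k}"
  shows "skew_sum [2, 1, 3] \<tau> \<preceq>\<^sub>s skew_sum [1, 2, 3] \<tau> \<and>
         skew_sum [1, 2, 3] \<tau> \<preceq>\<^sub>s skew_sum [3, 1, 2] \<tau> \<and>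
         (\<forall>n\<ge>2 * k + 5.
            card (perms_avoiding n (skew_sum [2, 1, 3] \<tau>))
              < card (perms_avoiding n (skew_sum [1, 2, 3] \<tau>)) \<and>
            card (perms_avoiding n (skew_sum [1, 2, 3] \<tau>))
              < card (perms_avoiding n (skew_sum [3, 1, 2] \<tau>)))"
proof -
  note \<tau> = assms(2,1)
  have pos: "length [2, 1, 3 :: nat] = 3" "\<forall>s\<in>set [2, 1, 3 :: nat]. 1 \<le> s"
    "length [1, 2, 3 :: nat] = 3" "\<forall>s\<in>set [1, 2, 3 :: nat]. 1 \<le> s"
    "length [3, 1, 2 :: nat] = 3" "\<forall>s\<in>set [3, 1, 2 :: nat]. 1 \<le> s" by auto
  have "[0, 0, 0, 0, 1] ! i \<le> i" if "i < length [0, 0, 0, 0, 1 :: nat]" for i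
    using that by (auto simp: less_Suc_eq)
  \<comment> \<open>The strict link is 321 against 312; the link from 123 to 321 enters as a weak
    inequality.\<close>
  then have less: "card (avoid_lists pat123 [0, 0, 0, 0, 1]) < card (avoid_lists pat312 [0, 0, 0, 0, 1])"
    using card_avoid_lists_123_le_321[of "[0, 0, 0, 0, 1]"] separating_shape_321_312 by simp
  note p213 = pos(1,2) order_iso_pats(1) and p123 = pos(3,4) order_iso_pats(2) and p312 = pos(5,6) order_iso_pats(3)
  show ?thesis
    using shape_le_skew_sum[OF \<tau> p213 p123 order_invariant_pats(1,2) card_avoid_lists_213_le_123]
      shape_le_skew_sum[OF \<tau> p123 p312 order_invariant_pats(2,4) card_avoid_lists_123_le_312]
      card_perms_avoiding_skew_sum_less[OF \<tau> _ p213 p123 order_invariant_pats(1,2)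
        card_avoid_lists_213_le_123 separating_shape_213_123]
      card_perms_avoiding_skew_sum_less[OF \<tau> _ p123 p312 order_invariant_pats(2,4)
        card_avoid_lists_123_le_312 less]
    by blast
qed

end
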